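(* Let $S=S_{1,1}$ be the one-holed torus, and identify $\operatorname{Teich}(S)$ with the upper half-plane $\mathbb{H}^2$. The Weil-Petersson length of the imaginary axis $I\subset\mathbb{H}^2$ satisfies $$\frac{1}{3}\sqrt{\frac{2}{\pi}}\,\mathcal{V}_8\le \ell_{\rm WP}(I)\le 2\sqrt{30}\,\pi^{3/4}.$$
   Context: $\mathcal{V}_8$ is the volume of the regular ideal hyperbolic octahedron. $\operatorname{Teich}(S)$ is the Teichmüller space of $S$, parametrizing finite-area marked complete hyperbolic structures on $\operatorname{int}(S)$ up to marking-preserving isometry (once-punctured tori); it is identified in the standard way with the upper half-plane $\mathbb{H}^2$ ($\tau$ corresponding to the marked torus $\mathbb{C}/(\mathbb{Z}+\tau\mathbb{Z})$ punctured at one point), so that $\operatorname{Mod}(S)=\mathrm{SL}_2(\mathbb{Z})$ acts by Möbius transformations. $I=\{iy: y>0\}$ is the imaginary axis. The Weil-Petersson metric on $\operatorname{Teich}(S)$ is the Riemannian metric arising from the norm $\|\varphi\|_{\rm WP}^2=\int_X |\varphi|^2/\rho_X$ on the space of integrable holomorphic quadratic differentials on the punctured surface $X$ (the cotangent space at $X$), where $\rho_X$ is the area form of the complete hyperbolic metric of curvature $-1$ on $X$; the metric on tangent vectors is the dual one under the pairing $\operatorname{Re}\int_X\mu\varphi$ with Beltrami differentials $\mu$. $\ell_{\rm WP}$ denotes length in this metric. *)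

theory Defs
  imports "HOL-Analysis.Analysis"
begin

text \<open>
  For \<open>Im \<tau> > 0\<close> the once-punctured torus of modulus \<open>\<tau>\<close> is \<open>X = (\<complex> - \<Lambda>) / \<Lambda>\<close> with
  \<open>\<Lambda> = \<int> + \<tau>\<int>\<close>. Functions on \<open>X\<close>, and the coefficients of tensors on \<open>X\<close> with respect to the
  coordinate \<open>z\<close>, are \<open>\<Lambda>\<close>-periodic functions on \<open>-\<Lambda>\<close>; their values on \<open>\<Lambda>\<close> are irrelevant.
  Points of \<open>X\<close> are the cosets of \<open>\<Lambda>\<close> other than \<open>\<Lambda>\<close> itself.
\<close>

definition lattice :: "complex \<Rightarrow> complex set" where
  "lattice \<tau> = {of_int m + of_int n * \<tau> | m n. True}"

definition periodic :: "complex \<Rightarrow> (complex \<Rightarrow> 'a) \<Rightarrow> bool" where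
  "periodic \<tau> f \<longleftrightarrow> (\<forall>z \<in> - lattice \<tau>. \<forall>\<omega> \<in> lattice \<tau>. f (z + \<omega>) = f z)"

definition punctured_torus :: "complex \<Rightarrow> complex set set" where
  "punctured_torus \<tau> = (\<lambda>z. (\<lambda>\<omega>. z + \<omega>) ` lattice \<tau>) ` (- lattice \<tau>)"

text \<open>Integrals over \<open>X\<close> are integrals over this fundamental domain.\<close>

definition fund_domain :: "complex \<Rightarrow> complex set" where
  "fund_domain \<tau> = {of_real s + of_real t * \<tau> | s t. 0 \<le> s \<and> s < 1 \<and> 0 \<le> t \<and> t < 1}"


section \<open>The complete hyperbolic metric\<close>

text \<open>
  A conformal metric \<open>\<rho> |dz|\<^sup>2\<close> is represented by the density \<open>\<rho>\<close> of its area form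
  \<open>\<rho> dx dy\<close>.
\<close>

definition C2_on :: "complex set \<Rightarrow> (complex \<Rightarrow> real) \<Rightarrow> bool" where
  "C2_on U u \<longleftrightarrow>
     (\<exists>(D :: complex \<Rightarrow> complex \<Rightarrow>\<^sub>L real) (H :: complex \<Rightarrow> complex \<Rightarrow>\<^sub>L (complex \<Rightarrow>\<^sub>L real)).
        (\<forall>z\<in>U. (u has_derivative blinfun_apply (D z)) (at z) \<and>
                (D has_derivative blinfun_apply (H z)) (at z)) \<and>
        continuous_on U H)"

definition laplacian :: "(complex \<Rightarrow> real) \<Rightarrow> complex \<Rightarrow> real" where
  "laplacian u z =
     deriv (deriv (\<lambda>x. u (Complex x (Im z)))) (Re z) +
     deriv (deriv (\<lambda>y. u (Complex (Re z) y))) (Im z)"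

definition gauss_curvature :: "(complex \<Rightarrow> real) \<Rightarrow> complex \<Rightarrow> real" where
  "gauss_curvature \<rho> z = - laplacian (\<lambda>w. ln (\<rho> w)) z / (2 * \<rho> z)"

definition conformal_length :: "(complex \<Rightarrow> real) \<Rightarrow> (real \<Rightarrow> complex) \<Rightarrow> ennreal" where
  "conformal_length \<rho> g =
     (\<integral>\<^sup>+ t \<in> {0..1}. ennreal (sqrt (\<rho> (g t)) * cmod (vector_derivative g (at t))) \<partial>lborel)"

text \<open>
  Piecewise \<open>C\<^sup>1\<close> paths in \<open>X\<close> from \<open>A\<close> to \<open>B\<close> are the projections of piecewise \<open>C\<^sup>1\<close> paths in
  \<open>-\<Lambda>\<close> from a point of the coset \<open>A\<close> to a point of the coset \<open>B\<close>.
\<close>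

definition torus_dist :: "complex \<Rightarrow> (complex \<Rightarrow> real) \<Rightarrow> complex set \<Rightarrow> complex set \<Rightarrow> real" where
  "torus_dist \<tau> \<rho> A B =
     enn2real (INF g \<in> {g. valid_path g \<and> path_image g \<subseteq> - lattice \<tau> \<and>
                           pathstart g \<in> A \<and> pathfinish g \<in> B}. conformal_length \<rho> g)"

definition complete_hyperbolic_metric :: "complex \<Rightarrow> (complex \<Rightarrow> real) \<Rightarrow> bool" where
  "complete_hyperbolic_metric \<tau> \<rho> \<longleftrightarrow>
     periodic \<tau> \<rho> \<and>
     (\<forall>z \<in> - lattice \<tau>. \<rho> z > 0) \<and>
     C2_on (- lattice \<tau>) \<rho> \<and>
     (\<forall>z \<in> - lattice \<tau>. gauss_curvature \<rho> z = -1) \<and>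
     Metric_space.mcomplete (punctured_torus \<tau>) (torus_dist \<tau> \<rho>)"


section \<open>The Weil-Petersson norm\<close>

text \<open>The cotangent space: a function \<open>\<phi>\<close> stands for the quadratic differential \<open>\<phi> dz\<^sup>2\<close>.\<close>

definition quad_differentials :: "complex \<Rightarrow> (complex \<Rightarrow> complex) set" where
  "quad_differentials \<tau> =
     {\<phi>. \<phi> holomorphic_on (- lattice \<tau>) \<and> periodic \<tau> \<phi> \<and>
         set_integrable lborel (fund_domain \<tau>) \<phi>}"

definition wp_conorm_sq :: "(complex \<Rightarrow> real) \<Rightarrow> complex \<Rightarrow> (complex \<Rightarrow> complex) \<Rightarrow> ennreal" where
  "wp_conorm_sq \<rho> \<tau> \<phi> = (\<integral>\<^sup>+ z \<in> fund_domain \<tau>. ennreal ((cmod (\<phi> z))\<^sup>2 / \<rho> z) \<partial>lborel)"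

text \<open>
  A tangent vector \<open>v\<close> to the upper half-plane at \<open>\<tau>\<close> is represented by the Beltrami differential
  \<open>\<mu> d(cnj z) / dz\<close> on \<open>X\<close>, where \<open>\<mu>\<close> is the derivative at \<open>t = 0\<close> of the complex dilatation of
  the affine marking-preserving map from the torus of modulus \<open>\<tau>\<close> to that of modulus \<open>\<tau> + tv\<close>.
\<close>

definition affine_marking_map :: "complex \<Rightarrow> complex \<Rightarrow> complex \<Rightarrow> complex" where
  "affine_marking_map \<tau> \<tau>' z =
     of_real (Re z - Im z / Im \<tau> * Re \<tau>) + of_real (Im z / Im \<tau>) * \<tau>'"

definition complex_dilatation :: "(complex \<Rightarrow> complex) \<Rightarrow> complex \<Rightarrow> complex" where
  "complex_dilatation f z =
     (let D = frechet_derivative f (at z)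
      in ((D 1 + \<i> * D \<i>) / 2) / ((D 1 - \<i> * D \<i>) / 2))"

definition tangent_beltrami :: "complex \<Rightarrow> complex \<Rightarrow> complex \<Rightarrow> complex" where
  "tangent_beltrami \<tau> v z =
     vector_derivative
       (\<lambda>t. complex_dilatation (affine_marking_map \<tau> (\<tau> + of_real t * v)) z) (at 0)"

definition wp_norm :: "(complex \<Rightarrow> real) \<Rightarrow> complex \<Rightarrow> complex \<Rightarrow> ennreal" where
  "wp_norm \<rho> \<tau> v =
     (SUP \<phi> \<in> {\<phi> \<in> quad_differentials \<tau>. wp_conorm_sq \<rho> \<tau> \<phi> \<le> 1}.
        ennreal (Re (LINT z : fund_domain \<tau> | lborel. tangent_beltrami \<tau> v z * \<phi> z)))"

text \<open>Here \<open>\<rho> \<tau>\<close> is the hyperbolic area density on the punctured torus of modulus \<open>\<tau>\<close>.\<close>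

definition wp_length ::
    "(complex \<Rightarrow> complex \<Rightarrow> real) \<Rightarrow> (real \<Rightarrow> complex) \<Rightarrow> real set \<Rightarrow> ennreal" where
  "wp_length \<rho> \<gamma> J =
     (\<integral>\<^sup>+ t \<in> J. wp_norm (\<rho> (\<gamma> t)) (\<gamma> t) (vector_derivative \<gamma> (at t)) \<partial>lborel)"


section \<open>The regular ideal octahedron\<close>

text \<open>
  In the Klein (projective) model on the open unit ball of \<open>\<real>\<^sup>3\<close> the hyperbolic metric is
  \<open>|dx|\<^sup>2 / (1 - |x|\<^sup>2) + (x \<bullet> dx)\<^sup>2 / (1 - |x|\<^sup>2)\<^sup>2\<close>, whose Gram determinant is
  \<open>(1 - |x|\<^sup>2) powr (-4)\<close>. Hyperbolic convex hulls are Euclidean ones, and the ideal points are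
  those of the unit sphere.
\<close>

definition klein_volume :: "(real ^ 3) set \<Rightarrow> ennreal" where
  "klein_volume A = (\<integral>\<^sup>+ x \<in> A. ennreal (1 / (1 - (norm x)\<^sup>2)\<^sup>2) \<partial>lborel)"

definition regular_ideal_octahedron :: "(real ^ 3) set" where
  "regular_ideal_octahedron = convex hull (Basis \<union> uminus ` Basis)"

definition V8 :: ennreal where
  "V8 = klein_volume regular_ideal_octahedron"

end

theory Submission
  imports Defs "HOL-Complex_Analysis.Complex_Analysis"
begin

text \<open>
  At \<open>\<i> y\<close> the tangent vector \<open>\<i>\<close> is the constant Beltrami differential \<open>- 1 / (2 y)\<close>, so its norm is
  governed by \<open>A y = \<integral> 1 / \<rho>\<close> over the torus, and it suffices to bound \<open>\<rho>\<close> from both sides.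

  Comparison with the hyperbolic metric of a disc avoiding the lattice gives \<open>\<rho> \<le> 4 / d\<^sup>2\<close>, where \<open>d\<close> is the
  distance to the lattice. A quadratic differential is holomorphic on the strip between two rows (or
  columns) of lattice points, hence its mean over horizontal (vertical) circles is constant; with
  Cauchy-Schwarz the norm is at most \<open>sqrt 30 * min (y powr (-1/2)) (y powr (-3/2))\<close>.

  For the lower bound the constant quadratic differentials are enough, given \<open>\<rho> \<ge> \<kappa> / (max 1 y)\<^sup>2\<close>. This
  follows from the maximum principle applied to \<open>ln \<rho>\<close> and an explicit subsolution of the curvature
  equation with a cone singularity \<open>1 / \<bar>z\<bar>\<close>, as soon as \<open>\<rho> z \<bar>z\<bar>\<close> tends to infinity at the puncture.
  The latter is where completeness enters: otherwise Harnack's inequality produces a ray of finite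
  length into the puncture. Finally the octahedron is small enough for the crude bound
  \<open>V8 \<le> 17 / 3\<close> to be good enough.
\<close>


section \<open>The Laplacian and the maximum principle\<close>

text \<open>No formula for the hyperbolic density is at hand, so everything is extracted from the
  curvature equation, Laplacian of ln \<rho> = 2 \<rho>, by comparison. Two difficulties shape the
  lower bound. Curvature alone does not force \<rho> to blow up at the puncture (cone points are
  possible), so completeness has to. The true cusp density is of the order of 1 / (|z| ln |z|)^2,
  well above the cone 1 / |z|, so a weak growth statement suffices for the comparison. Moreover the
  quadratic term of the subsolution is not periodic in Im z, so the seam |Im z| = y / 2 needs its
  own argument with first derivatives. Only y \<ge> 1 is compared directly; multiplication by i y
  exchanges the moduli i y and i / y and covers the rest. Upper and lower bounds are multiples of
  one profile, whose integral over the axis is 4. This gives 4 sqrt 30 above and 2 sqrt \<kappa>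
  below, with \<kappa> = (14 / 11) exp (- pi / 4). The latter exceeds (17 / 9) sqrt (2 / pi) by
  about one percent only, hence the finely tuned constants of the subsolution.\<close>

definition has_deriv2 :: "(real \<Rightarrow> real) \<Rightarrow> real \<Rightarrow> real \<Rightarrow> real \<Rightarrow> bool" where
  "has_deriv2 g a b x \<longleftrightarrow>
     (\<exists>g'. (\<forall>\<^sub>F t in nhds x. (g has_real_derivative g' t) (at t)) \<and> g' x = a \<and>
           (g' has_real_derivative b) (at x))"

text \<open>In \<open>has_lap f a b L z\<close>, the numbers \<open>a\<close>, \<open>b\<close> are the partial derivatives and \<open>L\<close> is the
  Laplacian of \<open>f\<close> at \<open>z\<close>. Only second derivatives along the two coordinate lines through \<open>z\<close>
  enter, which is all the maximum principle needs.\<close>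

definition has_lap :: "(complex \<Rightarrow> real) \<Rightarrow> real \<Rightarrow> real \<Rightarrow> real \<Rightarrow> complex \<Rightarrow> bool" where
  "has_lap f a b L z \<longleftrightarrow>
     (\<exists>p q. has_deriv2 (\<lambda>x. f (Complex x (Im z))) a p (Re z) \<and>
            has_deriv2 (\<lambda>y. f (Complex (Re z) y)) b q (Im z) \<and> L = p + q)"

section \<open>Rules for second derivatives along a line\<close>

lemma has_deriv2I:
  assumes "open S" "x \<in> S" "\<And>t. t \<in> S \<Longrightarrow> (g has_real_derivative g' t) (at t)"
    "(g' has_real_derivative b) (at x)" "g' x = a"
  shows "has_deriv2 g a b x"
  unfolding has_deriv2_def using assms eventually_nhds by blast

lemma has_deriv2_imp_deriv:
  assumes "has_deriv2 g a b x"
  shows "(g has_real_derivative a) (at x)"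
  using assms eventually_nhds_x_imp_x unfolding has_deriv2_def by blast

text \<open>Link to the total operator \<open>deriv\<close>, from which \<open>laplacian\<close> is
  built. The relational form also carries existence, which \<open>deriv\<close> does not.\<close>

lemma has_deriv2_deriv_deriv:
  assumes "has_deriv2 g a b x"
  shows "deriv (deriv g) x = b"
proof -
  obtain g' where g': "\<forall>\<^sub>F t in nhds x. (g has_real_derivative g' t) (at t)"
    "(g' has_real_derivative b) (at x)"
    using assms unfolding has_deriv2_def by blast
  have "\<forall>\<^sub>F t in nhds x. deriv g t = g' t"
    using g'(1) by eventually_elim (rule DERIV_imp_deriv)
  then have "deriv (deriv g) x = deriv g' x"
    by (rule deriv_cong_ev) simp
  then show ?thesis using g'(2) DERIV_imp_deriv by metis
qed

lemma has_deriv2_const: "has_deriv2 (\<lambda>x. c) 0 0 x"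
  by (rule has_deriv2I[of UNIV _ _ "\<lambda>x. 0"]) auto

lemma has_deriv2_add:
  assumes "has_deriv2 f a b x" "has_deriv2 g c d x"
  shows "has_deriv2 (\<lambda>x. f x + g x) (a + c) (b + d) x"
proof -
  obtain f' g' where f': "\<forall>\<^sub>F t in nhds x. (f has_real_derivative f' t) (at t)" "f' x = a"
      "(f' has_real_derivative b) (at x)"
    and g': "\<forall>\<^sub>F t in nhds x. (g has_real_derivative g' t) (at t)" "g' x = c"
      "(g' has_real_derivative d) (at x)"
    using assms unfolding has_deriv2_def by blast
  have "\<forall>\<^sub>F t in nhds x. ((\<lambda>x. f x + g x) has_real_derivative (f' t + g' t)) (at t)"
    using f'(1) g'(1) by eventually_elim (rule DERIV_add)
  moreover have "((\<lambda>t. f' t + g' t) has_real_derivative b + d) (at x)"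
    using f'(3) g'(3) by (rule DERIV_add)
  ultimately show ?thesis unfolding has_deriv2_def using f'(2) g'(2)
    by (intro exI[of _ "\<lambda>t. f' t + g' t"]) auto
qed

lemma has_deriv2_compose:
  assumes "has_deriv2 f a b x" "has_deriv2 h c d (f x)"
  shows "has_deriv2 (\<lambda>x. h (f x)) (c * a) (d * a\<^sup>2 + c * b) x"
proof -
  obtain f' h' where f': "\<forall>\<^sub>F t in nhds x. (f has_real_derivative f' t) (at t)" "f' x = a"
      "(f' has_real_derivative b) (at x)"
    and h': "\<forall>\<^sub>F t in nhds (f x). (h has_real_derivative h' t) (at t)" "h' (f x) = c"
      "(h' has_real_derivative d) (at (f x))"
    using assms unfolding has_deriv2_def by blast
  have fa: "(f has_real_derivative a) (at x)"
    using has_deriv2_imp_deriv assms(1) .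
  have "filterlim f (nhds (f x)) (nhds x)"
    using DERIV_isCont[OF fa] by (simp add: isCont_def tendsto_at_iff_tendsto_nhds)
  then have "\<forall>\<^sub>F t in nhds x. (h has_real_derivative h' (f t)) (at (f t))"
    using h'(1) by (rule eventually_compose_filterlim[rotated])
  then have "\<forall>\<^sub>F t in nhds x. ((\<lambda>x. h (f x)) has_real_derivative (h' (f t) * f' t)) (at t)"
    using f'(1) by eventually_elim (rule DERIV_chain2)
  moreover have "((\<lambda>t. h' (f t) * f' t) has_real_derivative d * a\<^sup>2 + c * b) (at x)"
  proof -
    have "((\<lambda>t. h' (f t)) has_real_derivative d * a) (at x)"
      using h'(3) fa by (rule DERIV_chain2)
    from DERIV_mult[OF this f'(3)] show ?thesis
      using f'(2) h'(2) by (simp add: power2_eq_square algebra_simps)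
  qed
  ultimately show ?thesis unfolding has_deriv2_def using f'(2) h'(2)
    by (intro exI[of _ "\<lambda>t. h' (f t) * f' t"]) auto
qed

lemma has_deriv2_ln: "x > 0 \<Longrightarrow> has_deriv2 ln (1 / x) (- 1 / x\<^sup>2) x"
  by (rule has_deriv2I[of "{0<..}" _ _ "\<lambda>x. 1 / x"])
     (auto intro!: derivative_eq_intros simp: field_simps power2_eq_square)

text \<open>If \<open>b\<close> were negative, \<open>g'\<close> would drop below its value 0 just
  to the right of \<open>x\<close>, and by the mean value theorem \<open>g\<close> would be smaller
  there.\<close>

lemma has_deriv2_local_min:
  assumes "has_deriv2 g a b x" "\<forall>\<^sub>F t in nhds x. g x \<le> g t"
  shows "b \<ge> 0"
proof (rule ccontr)
  assume "\<not> 0 \<le> b"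
  then have b: "b < 0" by simp
  obtain g' where g': "\<forall>\<^sub>F t in nhds x. (g has_real_derivative g' t) (at t)" "g' x = a"
    "(g' has_real_derivative b) (at x)"
    using assms unfolding has_deriv2_def by blast
  obtain e where e: "e > 0" "\<And>t. \<bar>t - x\<bar> < e \<Longrightarrow> (g has_real_derivative g' t) (at t)"
    "\<And>t. \<bar>t - x\<bar> < e \<Longrightarrow> g x \<le> g t"
    using eventually_conj[OF g'(1) assms(2)] unfolding eventually_nhds_metric dist_real_def by blast
  have "a = 0"
    using has_deriv2_imp_deriv[OF assms(1)] e(1)
    by (rule DERIV_local_min) (use e(3) in \<open>simp add: abs_minus_commute\<close>)
  obtain d where d: "d > 0" "\<And>h. 0 < h \<Longrightarrow> h < d \<Longrightarrow> g' (x + h) < g' x"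
    using DERIV_neg_dec_right[OF g'(3) b] by blast
  define h where "h = min d e / 2"
  have h: "0 < h" "h < d" "h < e" using d(1) e(1) by (auto simp: h_def min_def)
  obtain z where z: "x < z" "z < x + h" "g (x + h) - g x = (x + h - x) * g' z"
    using MVT2[of x "x + h" g g'] h e(2) by auto
  have "g' z < 0"
    using d(2)[of "z - x"] z h \<open>a = 0\<close> g'(2) by simp
  then have "g (x + h) < g x" using z(3) h(1) mult_pos_neg[of h "g' z"] by simp
  moreover have "g x \<le> g (x + h)" using e(3)[of "x + h"] h by simp
  ultimately show False by simp
qed

section \<open>Rules for the Laplacian\<close>

lemma has_lap_const: "has_lap (\<lambda>z. c) 0 0 0 z"
  unfolding has_lap_def using has_deriv2_const by (metis add_0)

lemma has_lap_add:
  assumes "has_lap f a b L z" "has_lap g c d M z"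
  shows "has_lap (\<lambda>z. f z + g z) (a + c) (b + d) (L + M) z"
proof -
  obtain p q p' q' where *: "has_deriv2 (\<lambda>x. f (Complex x (Im z))) a p (Re z)"
    "has_deriv2 (\<lambda>y. f (Complex (Re z) y)) b q (Im z)" "L = p + q"
    "has_deriv2 (\<lambda>x. g (Complex x (Im z))) c p' (Re z)"
    "has_deriv2 (\<lambda>y. g (Complex (Re z) y)) d q' (Im z)" "M = p' + q'"
    using assms unfolding has_lap_def by blast
  show ?thesis unfolding has_lap_def
    using has_deriv2_add[OF *(1,4)] has_deriv2_add[OF *(2,5)] *(3,6)
    by (intro exI[of _ "p + p'"] exI[of _ "q + q'"]) auto
qed

lemma has_lap_compose:
  assumes "has_lap f a b L z" "has_deriv2 h c d (f z)"
  shows "has_lap (\<lambda>z. h (f z)) (c * a) (c * b) (d * (a\<^sup>2 + b\<^sup>2) + c * L) z"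
proof -
  obtain p q where *: "has_deriv2 (\<lambda>x. f (Complex x (Im z))) a p (Re z)"
    "has_deriv2 (\<lambda>y. f (Complex (Re z) y)) b q (Im z)" "L = p + q"
    using assms unfolding has_lap_def by blast
  show ?thesis unfolding has_lap_def
    using has_deriv2_compose[OF *(1), of h c d] has_deriv2_compose[OF *(2), of h c d] assms(2)
    by (intro exI[of _ "d * a\<^sup>2 + c * p"] exI[of _ "d * b\<^sup>2 + c * q"]) (auto simp: *(3) algebra_simps)
qed

lemma has_lap_cmult:
  assumes "has_lap f a b L z"
  shows "has_lap (\<lambda>z. c * f z) (c * a) (c * b) (c * L) z"
proof -
  have "has_deriv2 ((*) c) c 0 (f z)"
    by (rule has_deriv2I[of UNIV _ _ "\<lambda>x. c"]) (auto intro!: derivative_eq_intros)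
  from has_lap_compose[OF assms this] show ?thesis by simp
qed

lemma has_lap_diff:
  assumes "has_lap f a b L z" "has_lap g c d M z"
  shows "has_lap (\<lambda>z. f z - g z) (a - c) (b - d) (L - M) z"
  using has_lap_add[OF assms(1) has_lap_cmult[OF assms(2), of "-1"]] by simp

lemma has_lap_ln:
  assumes "has_lap f a b L z" "f z > 0"
  shows "has_lap (\<lambda>z. ln (f z)) (a / f z) (b / f z) (L / f z - (a\<^sup>2 + b\<^sup>2) / (f z)\<^sup>2) z"
  using has_lap_compose[OF assms(1) has_deriv2_ln[OF assms(2)]] by simp

lemma continuous_at_imp_tendsto_nhds: "isCont f a \<Longrightarrow> (f \<longlongrightarrow> f a) (nhds a)"
  by (simp add: isCont_def tendsto_at_iff_tendsto_nhds)

lemma has_lap_local_min: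
  assumes "has_lap f a b L z" "\<forall>\<^sub>F w in nhds z. f z \<le> f w"
  shows "L \<ge> 0"
proof -
  obtain p q where *: "has_deriv2 (\<lambda>x. f (Complex x (Im z))) a p (Re z)"
    "has_deriv2 (\<lambda>y. f (Complex (Re z) y)) b q (Im z)" "L = p + q"
    using assms unfolding has_lap_def by blast
  have c: "isCont (\<lambda>x. Complex x (Im z)) (Re z)" "isCont (\<lambda>y. Complex (Re z) y) (Im z)"
    by (auto simp: Complex_eq intro!: continuous_intros)
  have "filterlim (\<lambda>x. Complex x (Im z)) (nhds z) (nhds (Re z))"
    "filterlim (\<lambda>y. Complex (Re z) y) (nhds z) (nhds (Im z))"
    using c[THEN continuous_at_imp_tendsto_nhds] by simp_all
  then have "\<forall>\<^sub>F x in nhds (Re z). f z \<le> f (Complex x (Im z))"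
    "\<forall>\<^sub>F y in nhds (Im z). f z \<le> f (Complex (Re z) y)"
    using assms(2) eventually_compose_filterlim by blast+
  then have "p \<ge> 0" "q \<ge> 0"
    using has_deriv2_local_min[OF *(1)] has_deriv2_local_min[OF *(2)] by simp_all
  then show ?thesis using *(3) by simp
qed

lemma has_lap_laplacian: "has_lap f a b L z \<Longrightarrow> laplacian f z = L"
  unfolding has_lap_def laplacian_def using has_deriv2_deriv_deriv by force

lemma has_lap_norm_sq: "has_lap (\<lambda>z. (cmod (z - p))\<^sup>2) (2 * Re (z - p)) (2 * Im (z - p)) 4 z"
proof -
  have "has_deriv2 (\<lambda>x. (cmod (Complex x (Im z) - p))\<^sup>2) (2 * Re (z - p)) 2 (Re z)"
    by (rule has_deriv2I[of UNIV _ _ "\<lambda>x. 2 * (x - Re p)"])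
       (auto simp: cmod_power2 intro!: derivative_eq_intros)
  moreover have "has_deriv2 (\<lambda>x. (cmod (Complex (Re z) x - p))\<^sup>2) (2 * Im (z - p)) 2 (Im z)"
    by (rule has_deriv2I[of UNIV _ _ "\<lambda>x. 2 * (x - Im p)"])
       (auto simp: cmod_power2 intro!: derivative_eq_intros)
  ultimately show ?thesis unfolding has_lap_def by (intro exI[of _ 2]) auto
qed

text \<open>By the Cauchy-Riemann equations the second derivatives along the two axes are Re g'' and
  - Re g'', which cancel.\<close>

lemma has_lap_Re:
  assumes "open S" "z \<in> S" "g holomorphic_on S"
  shows "has_lap (\<lambda>z. Re (g z)) (Re (deriv g z)) (- Im (deriv g z)) 0 z"
proof -
  define g1 where "g1 = deriv g"
  have g: "(g has_field_derivative g1 w) (at w)" if "w \<in> S" for w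
    using assms that holomorphic_derivI g1_def by blast
  have "g1 holomorphic_on S"
    unfolding g1_def using assms holomorphic_deriv by blast
  then have g1: "(g1 has_field_derivative deriv g1 z) (at z)"
    using assms holomorphic_derivI by blast
  have *: "((\<lambda>t::real. h (c t)) has_vector_derivative (e * D)) (at t)"
    if "(h has_field_derivative D) (at (c t))" "(c has_vector_derivative e) (at t)"
    for h :: "complex \<Rightarrow> complex" and c t e D
    using field_vector_diff_chain_at[OF that(2,1)] by (simp add: o_def)
  have cx: "((\<lambda>x. Complex x b) has_vector_derivative 1) (at x)" for x b
    unfolding Complex_eq by (auto intro!: derivative_eq_intros)
  have cy: "((\<lambda>x. Complex b x) has_vector_derivative \<i>) (at x)" for x b
    unfolding Complex_eq by (auto intro!: derivative_eq_intros)
  have Re': "((\<lambda>t. Re (h t)) has_real_derivative (Re D)) (at t)"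
    if "(h has_vector_derivative D) (at t)" for h D t
    using bounded_linear.has_vector_derivative[OF bounded_linear_Re that]
    by (simp add: has_real_derivative_iff_has_vector_derivative)
  have "has_deriv2 (\<lambda>x. Re (g (Complex x (Im z)))) (Re (g1 z)) (Re (deriv g1 z)) (Re z)"
  proof (rule has_deriv2I)
    show "open ((\<lambda>x. Complex x (Im z)) -` S)"
      using assms(1) by (intro open_vimage) (auto simp: Complex_eq intro!: continuous_intros)
    show "Re z \<in> (\<lambda>x. Complex x (Im z)) -` S" using assms(2) by simp
    show "((\<lambda>x. Re (g (Complex x (Im z)))) has_real_derivative Re (g1 (Complex t (Im z)))) (at t)"
      if "t \<in> (\<lambda>x. Complex x (Im z)) -` S" for t
      using Re'[OF *[OF g cx]] that by simp
    have "((\<lambda>x. Re (g1 (Complex x (Im z)))) has_real_derivative Re (1 * deriv g1 z)) (at (Re z))"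
      by (rule Re'[OF *[OF _ cx]]) (use g1 in simp)
    then show "((\<lambda>x. Re (g1 (Complex x (Im z)))) has_real_derivative Re (deriv g1 z)) (at (Re z))"
      by simp
  qed simp
  moreover have "has_deriv2 (\<lambda>x. Re (g (Complex (Re z) x))) (- Im (g1 z)) (- Re (deriv g1 z)) (Im z)"
  proof (rule has_deriv2I)
    show "open ((\<lambda>x. Complex (Re z) x) -` S)"
      using assms(1) by (intro open_vimage) (auto simp: Complex_eq intro!: continuous_intros)
    show "Im z \<in> (\<lambda>x. Complex (Re z) x) -` S" using assms(2) by simp
    show "((\<lambda>x. Re (g (Complex (Re z) x))) has_real_derivative Re (\<i> * g1 (Complex (Re z) t))) (at t)"
      if "t \<in> (\<lambda>x. Complex (Re z) x) -` S" for t
      using Re'[OF *[OF g cy]] that by simp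
    have "((\<lambda>x. g1 (Complex (Re z) x)) has_vector_derivative (\<i> * deriv g1 z)) (at (Im z))"
      by (rule *[OF _ cy]) (use g1 in simp)
    from has_vector_derivative_mult_right[OF this, of \<i>]
    have "((\<lambda>x. \<i> * g1 (Complex (Re z) x)) has_vector_derivative (\<i> * (\<i> * deriv g1 z))) (at (Im z))" .
    from Re'[OF this]
    show "((\<lambda>x. Re (\<i> * g1 (Complex (Re z) x))) has_real_derivative - Re (deriv g1 z)) (at (Im z))"
      by simp
  qed simp
  ultimately show ?thesis
    unfolding has_lap_def g1_def by (intro exI conjI) auto
qed

lemma has_lap_transform:
  assumes "has_lap f a b L z" "open S" "z \<in> S" "\<And>w. w \<in> S \<Longrightarrow> f w = g w"
  shows "has_lap g a b L z"
proof -
  have tr: "has_deriv2 k a b x" if h: "has_deriv2 h a b x" and T: "open T" "x \<in> T" "\<And>t. t \<in> T \<Longrightarrow> h t = k t"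
    for h k a b x and T :: "real set"
  proof -
    obtain g' where g': "\<forall>\<^sub>F t in nhds x. (h has_real_derivative g' t) (at t)" "g' x = a"
      "(g' has_real_derivative b) (at x)"
      using h unfolding has_deriv2_def by blast
    have "\<forall>\<^sub>F t in nhds x. t \<in> T" using T(1,2) by (rule eventually_nhds_in_open)
    then have "\<forall>\<^sub>F t in nhds x. (k has_real_derivative g' t) (at t)"
      using g'(1)
    proof eventually_elim
      case (elim t)
      show ?case
        by (rule has_field_derivative_transform_within_open[OF elim(2) T(1) elim(1)]) (rule T(3))
    qed
    then show ?thesis unfolding has_deriv2_def using g' by blast
  qed
  obtain p q where *: "has_deriv2 (\<lambda>x. f (Complex x (Im z))) a p (Re z)"
    "has_deriv2 (\<lambda>y. f (Complex (Re z) y)) b q (Im z)" "L = p + q"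
    using assms unfolding has_lap_def by blast
  have "open ((\<lambda>x. Complex x (Im z)) -` S)" "open ((\<lambda>x. Complex (Re z) x) -` S)"
    using assms(2) by (auto intro!: open_vimage simp: Complex_eq intro!: continuous_intros)
  then have "has_deriv2 (\<lambda>x. g (Complex x (Im z))) a p (Re z)"
    "has_deriv2 (\<lambda>y. g (Complex (Re z) y)) b q (Im z)"
    using assms(3,4) by (auto intro: tr[OF *(1)] tr[OF *(2)])
  then show ?thesis unfolding has_lap_def using *(3) by blast
qed

text \<open>Near \<open>z\<close> there is a holomorphic logarithm \<open>h\<close> of
  \<open>g\<close>, so ln |g| = Re h and h' = g' / g.\<close>

lemma has_lap_ln_norm:
  assumes "open S" "z \<in> S" "g holomorphic_on S" "g z \<noteq> 0"
  shows "has_lap (\<lambda>z. ln (cmod (g z))) (Re (deriv g z / g z)) (- Im (deriv g z / g z)) 0 z"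
proof -
  obtain e where e: "e > 0" "ball z e \<subseteq> S" "\<And>w. w \<in> ball z e \<Longrightarrow> g w \<noteq> 0"
  proof -
    have "isCont g z"
      using assms(1-3) holomorphic_on_imp_continuous_on continuous_on_eq_continuous_at by blast
    then have "\<forall>\<^sub>F w in nhds z. g w \<in> - {0}"
      unfolding isCont_def tendsto_at_iff_tendsto_nhds
      by (rule topological_tendstoD) (use assms(4) in auto)
    then have "\<forall>\<^sub>F w in nhds z. g w \<noteq> 0" by simp
    moreover have "\<forall>\<^sub>F w in nhds z. w \<in> S" using assms(1,2) by (rule eventually_nhds_in_open)
    ultimately have "\<forall>\<^sub>F w in nhds z. g w \<noteq> 0 \<and> w \<in> S" by (rule eventually_conj)
    then obtain e where "e > 0" "\<And>w. dist w z < e \<Longrightarrow> g w \<noteq> 0 \<and> w \<in> S"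
      unfolding eventually_nhds_metric by blast
    then show ?thesis by (intro that[of e]) (auto simp: dist_commute)
  qed
  obtain h where h: "h holomorphic_on ball z e" "\<And>w. w \<in> ball z e \<Longrightarrow> g w = exp (h w)"
    using holomorphic_logarithm_exists[OF convex_ball open_ball holomorphic_on_subset[OF assms(3) e(2)], of z]
      e(1,3) by (metis centre_in_ball)
  have "(g has_field_derivative (exp (h z) * deriv h z)) (at z)"
  proof (rule has_field_derivative_transform_within_open[where S = "ball z e"])
    show "((\<lambda>w. exp (h w)) has_field_derivative exp (h z) * deriv h z) (at z)"
      using holomorphic_derivI[OF h(1)] e(1) by (auto intro!: derivative_eq_intros)
  qed (use h(2) e(1) in auto)
  then have "deriv g z = g z * deriv h z" using h(2)[of z] e(1) by (simp add: DERIV_imp_deriv)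
  then have q: "deriv g z / g z = deriv h z" using assms(4) by simp
  have "has_lap (\<lambda>w. Re (h w)) (Re (deriv h z)) (- Im (deriv h z)) 0 z"
    by (rule has_lap_Re[of "ball z e"]) (use e h in auto)
  then show ?thesis unfolding q
    by (rule has_lap_transform[of _ _ _ _ _ "ball z e"]) (use e(1) h(2) in auto)
qed

text \<open>A negative minimum over the closure cannot lie on the frontier, and at an interior
  minimum the Laplacian is nonnegative.\<close>

lemma nonneg_if_superharmonic_where_negative:
  assumes "bounded D" "open D" "continuous_on (closure D) f"
    and "\<And>z. z \<in> frontier D \<Longrightarrow> f z \<ge> 0"
    and "\<And>z. z \<in> D \<Longrightarrow> f z < 0 \<Longrightarrow> \<exists>a b L. has_lap f a b L z \<and> L < 0"
    and "z \<in> D"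
  shows "f z \<ge> 0"
proof (rule ccontr)
  assume neg: "\<not> f z \<ge> 0"
  have "compact (closure D)" using assms(1) by simp
  then obtain m where m: "m \<in> closure D" "\<And>w. w \<in> closure D \<Longrightarrow> f m \<le> f w"
    using continuous_attains_inf[of "closure D" f] assms(3,6) by auto
  have "f m < 0" using m(2)[of z] neg assms(6) closure_subset by fastforce
  then have "m \<in> D" using m(1) assms(2,4) by (force simp: frontier_def interior_open)
  then obtain a b L where L: "has_lap f a b L m" "L < 0" using assms(5) \<open>f m < 0\<close> by blast
  have "\<forall>\<^sub>F w in nhds m. w \<in> D" using assms(2) \<open>m \<in> D\<close> by (rule eventually_nhds_in_open)
  then have "\<forall>\<^sub>F w in nhds m. f m \<le> f w"
    by eventually_elim (use m(2) closure_subset in blast)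
  from has_lap_local_min[OF L(1) this] L(2) show False by simp
qed

lemma nonneg_if_superharmonic:
  assumes D: "bounded D" "open D" "continuous_on (closure D) f"
    and fr: "\<And>z. z \<in> frontier D \<Longrightarrow> f z \<ge> 0"
    and lap: "\<And>z. z \<in> D \<Longrightarrow> \<exists>a b L. has_lap f a b L z \<and> L \<le> 0"
    and z: "z \<in> D"
  shows "f z \<ge> 0"
proof -
  obtain B where B: "B > 0" "\<And>w. w \<in> closure D \<Longrightarrow> cmod w \<le> B"
    using bounded_closure[OF D(1)] bounded_pos by blast
  have "f z + e * B\<^sup>2 \<ge> 0" if e: "e > 0" for e
  proof -
    \<comment> \<open>The correction e (B^2 - |w|^2) is nonnegative on the closure and has Laplacian
      - 4 e, which makes the sign strict; \<open>e\<close> is sent to 0 at the end.\<close>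
    define h where "h w = f w + (e * B\<^sup>2 + (- e) * (cmod (w - 0))\<^sup>2)" for w
    have "h z \<ge> 0"
    proof (rule nonneg_if_superharmonic_where_negative[OF D(1,2)])
      show "continuous_on (closure D) h"
        unfolding h_def using D(3) by (intro continuous_intros)
      show "h w \<ge> 0" if "w \<in> frontier D" for w
      proof -
        have "(cmod w)\<^sup>2 \<le> B\<^sup>2"
          using that B(2)[of w] by (intro power_mono) (auto simp: frontier_def)
        then have "e * (cmod w)\<^sup>2 \<le> e * B\<^sup>2" using e by simp
        then show ?thesis using fr[OF that] unfolding h_def by simp
      qed
      show "\<exists>a b L. has_lap h a b L w \<and> L < 0" if w: "w \<in> D" for w
      proof -
        obtain a b L where L: "has_lap f a b L w" "L \<le> 0" using lap[OF w] by blast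
        have "has_lap h (a + (0 + - e * (2 * Re (w - 0)))) (b + (0 + - e * (2 * Im (w - 0)))) (L + (0 + - e * 4)) w"
          unfolding h_def[abs_def] by (intro has_lap_add has_lap_cmult has_lap_const has_lap_norm_sq L(1))
        then show ?thesis using L(2) e by (intro exI conjI) (assumption, simp)
      qed
    qed (rule z)
    moreover have "e * (cmod z)\<^sup>2 \<ge> 0" using e by simp
    ultimately show ?thesis unfolding h_def by simp
  qed
  note * = this
  have "- f z \<le> 0 + e" if "e > 0" for e
    using *[of "e / B\<^sup>2"] B(1) that by simp
  then have "- f z \<le> 0" by (rule field_le_epsilon)
  then show ?thesis by simp
qed


section \<open>Harnack's inequality\<close>

text \<open>On the unit circle every real polynomial is the real part of a complex one. By Stone-Weierstrass
  the Dirichlet problem on a disc is therefore solvable up to any \<open>\<epsilon>\<close> without the Poisson integral.\<close>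

lemma Re_mult_Re_on_circle:
  fixes p q :: "complex poly"
  shows "\<exists>r. \<forall>z\<in>sphere 0 1. Re (poly p z) * Re (poly q z) = Re (poly r z)"
proof -
  have conj: "\<exists>r. \<forall>z\<in>sphere 0 1. Re (poly p z * cnj (poly q z)) = Re (poly r z)" for q
  proof (induction p arbitrary: q)
    case 0
    show ?case by (intro exI[of _ 0]) simp
  next
    case (pCons a p)
    obtain b q' where q: "q = pCons b q'" by (cases q)
    obtain r where r: "\<And>z. z \<in> sphere 0 1 \<Longrightarrow> Re (poly p z * cnj (poly q' z)) = Re (poly r z)"
      using pCons.IH by blast
    show ?case
    proof (intro exI ballI)
      fix z :: complex assume z: "z \<in> sphere 0 1"
      \<comment> \<open>On the circle \<open>cnj z\<close> is the inverse of \<open>z\<close>, so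
        one factor \<open>z\<close> of \<open>p\<close> cancels one conjugate factor of
        \<open>q\<close>. Both degrees drop, which drives the induction.\<close>
      then have zz: "z * cnj z = 1" by (simp add: complex_norm_square[symmetric])
      have "poly (pCons a p) z * cnj (poly q z) =
          a * cnj (poly q z) + cnj b * z * poly p z + (z * cnj z) * (poly p z * cnj (poly q' z))"
        unfolding q by (simp add: algebra_simps)
      also have "Re \<dots> = Re (cnj a * poly q z) + Re (cnj b * z * poly p z) + Re (poly r z)"
        using r[OF z] by (simp add: zz)
      also have "\<dots> = Re (poly (smult (cnj a) q + smult (cnj b) (pCons 0 p) + r) z)"
        by (simp add: algebra_simps)
      finally show "Re (poly (pCons a p) z * cnj (poly q z)) =
          Re (poly (smult (cnj a) q + smult (cnj b) (pCons 0 p) + r) z)" .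
    qed
  qed
  obtain r where r: "\<And>z. z \<in> sphere 0 1 \<Longrightarrow> Re (poly p z * cnj (poly q z)) = Re (poly r z)"
    using conj by blast
  show ?thesis
  proof (intro exI ballI)
    fix z :: complex assume z: "z \<in> sphere 0 1"
    have "Re (poly p z) * Re (poly q z) =
        (Re (poly p z * poly q z) + Re (poly p z * cnj (poly q z))) / 2"
      by simp
    also have "\<dots> = Re (poly (smult (1/2) (p * q + r)) z)"
      using r[OF z] by simp
    finally show "Re (poly p z) * Re (poly q z) = Re (poly (smult (1/2) (p * q + r)) z)" .
  qed
qed

lemma real_polynomial_on_circle:
  assumes "real_polynomial_function f"
  shows "\<exists>p :: complex poly. \<forall>z\<in>sphere 0 1. f z = Re (poly p z)"
  using assms
proof induction
  case (linear f)
  interpret bounded_linear f by fact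
  have "f z = Re (poly [:0, Complex (f 1) (- f \<i>):] z)" for z
  proof -
    have "f z = f (Re z *\<^sub>R 1 + Im z *\<^sub>R \<i>)" by (intro arg_cong[of _ _ f]) (simp add: complex_eq_iff)
    also have "\<dots> = Re z * f 1 + Im z * f \<i>" by (simp only: add scale) simp
    finally show ?thesis by simp
  qed
  then show ?case by blast
next
  case (const c)
  show ?case by (intro exI[of _ "[:of_real c:]"]) simp
next
  case (add f g)
  then obtain p q where "\<forall>z\<in>sphere 0 1. f z = Re (poly p z)" "\<forall>z\<in>sphere 0 1. g z = Re (poly q z)"
    by blast
  then show ?case by (intro exI[of _ "p + q"]) simp
next
  case (mult f g)
  then obtain p q where "\<forall>z\<in>sphere 0 1. f z = Re (poly p z)" "\<forall>z\<in>sphere 0 1. g z = Re (poly q z)"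
    by blast
  then show ?case using Re_mult_Re_on_circle[of p q] by simp
qed

lemma harmonic_approx_on_circle:
  assumes "R > 0" "continuous_on (sphere c R) g" "e > 0"
  obtains h where "h holomorphic_on UNIV" "\<And>z. z \<in> sphere c R \<Longrightarrow> \<bar>g z - Re (h z)\<bar> < e"
proof -
  have "continuous_on (sphere 0 1) (\<lambda>w. g (c + of_real R * w))"
    by (rule continuous_on_compose2[OF assms(2)])
       (use assms(1) in \<open>auto intro!: continuous_intros simp: dist_norm norm_mult\<close>)
  then obtain f where f: "real_polynomial_function f"
      "\<And>w. w \<in> sphere 0 1 \<Longrightarrow> \<bar>g (c + of_real R * w) - f w\<bar> < e"
    using Stone_Weierstrass_real_polynomial_function[OF compact_sphere _ assms(3)] by metis
  obtain p where p: "\<forall>z\<in>sphere 0 1. f z = Re (poly p z)"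
    using real_polynomial_on_circle[OF f(1)] by blast
  show ?thesis
  proof
    show "(\<lambda>z. poly p ((z - c) / of_real R)) holomorphic_on UNIV"
      using assms(1) by (auto intro!: holomorphic_intros)
    fix z assume z: "z \<in> sphere c R"
    define w where "w = (z - c) / of_real R"
    have w: "w \<in> sphere 0 1"
      using z assms(1) by (auto simp: w_def norm_divide dist_norm norm_minus_commute)
    have "c + of_real R * w = z" using assms(1) by (simp add: w_def)
    then have "\<bar>g z - f w\<bar> < e" using f(2)[OF w] by simp
    then have "\<bar>g z - Re (poly p w)\<bar> < e" using p w by simp
    then show "\<bar>g z - Re (poly p ((z - c) / of_real R))\<bar> < e" by (simp only: w_def)
  qed
qed

text \<open>Schwarz's lemma for the Cayley transform \<open>F\<close>, which takes the right
  half-plane to the unit disc and \<open>h c\<close> to 0. At half the radius |F| \<le> 1/2, and (1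
  - 1/2) / (1 + 1/2) = 1/3 is the Harnack constant.\<close>

lemma Harnack_holomorphic:
  assumes "h holomorphic_on UNIV" "R > 0" "\<And>z. z \<in> ball c R \<Longrightarrow> Re (h z) > 0" "cmod (q - c) \<le> R / 2"
  shows "Re (h q) \<ge> Re (h c) / 3"
proof -
  define F where "F w = (h (c + of_real R * w) - h c) / (h (c + of_real R * w) + cnj (h c))" for w
  have inb: "c + of_real R * w \<in> ball c R" if "cmod w < 1" for w
    using that assms(2) by (simp add: dist_norm norm_mult)
  have c0: "Re (h c) > 0" using assms(2,3) by simp
  have nz: "Re (h (c + of_real R * w) + cnj (h c)) > 0" if "cmod w < 1" for w
    using assms(3)[OF inb[OF that]] c0 by simp
  have key: "(cmod (A + cnj B))\<^sup>2 = (cmod (A - B))\<^sup>2 + 4 * Re A * Re B" for A B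
    unfolding cmod_power2 by (simp add: power2_eq_square algebra_simps)
  have lt: "cmod (F w) < 1" if "cmod w < 1" for w
  proof -
    have "(cmod (h (c + of_real R * w) - h c))\<^sup>2 < (cmod (h (c + of_real R * w) + cnj (h c)))\<^sup>2"
      unfolding key using assms(3)[OF inb[OF that]] c0 by simp
    then have "cmod (h (c + of_real R * w) - h c) < cmod (h (c + of_real R * w) + cnj (h c))"
      by (rule power2_less_imp_less) simp
    then show ?thesis unfolding F_def by (simp add: norm_divide divide_less_eq)
  qed
  define w where "w = (q - c) / of_real R"
  have w: "cmod w \<le> 1 / 2" "q = c + of_real R * w"
    using assms(2,4) by (auto simp: w_def norm_divide field_simps)
  have holh: "(\<lambda>w. h (c + of_real R * w)) holomorphic_on ball 0 1"
  proof -
    have "(h \<circ> (\<lambda>w. c + of_real R * w)) holomorphic_on ball 0 1"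
      by (intro holomorphic_on_compose holomorphic_intros holomorphic_on_subset[OF assms(1) subset_UNIV])
    then show ?thesis by (simp only: o_def)
  qed
  have "F holomorphic_on ball 0 1"
    unfolding F_def
  proof (intro holomorphic_intros holh)
    fix w :: complex assume "w \<in> ball 0 1"
    then have "Re (h (c + of_real R * w) + cnj (h c)) > 0" using nz by simp
    then show "h (c + of_real R * w) + cnj (h c) \<noteq> 0" by force
  qed
  then have "cmod (F w) \<le> cmod w"
    by (rule Schwarz_Lemma(1)) (use lt w in \<open>auto simp: F_def\<close>)
  then have Fw: "cmod (F w) \<le> 1 / 2" using w by simp
  have nz': "cmod (h q + cnj (h c)) > 0"
  proof -
    have "Re (h q + cnj (h c)) > 0" using nz[of w] w(1) unfolding w(2)[symmetric] by linarith
    also have "\<dots> \<le> cmod (h q + cnj (h c))" by (rule complex_Re_le_cmod)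
    finally show ?thesis .
  qed
  have "cmod (h q - h c) \<le> cmod (h q + cnj (h c)) / 2"
    using Fw nz' unfolding F_def w(2)[symmetric] by (simp add: norm_divide field_simps)
  then have "(cmod (h q - h c))\<^sup>2 \<le> (cmod (h q + cnj (h c)) / 2)\<^sup>2"
    by (intro power_mono) auto
  then have "3 * (cmod (h q - h c))\<^sup>2 \<le> 4 * Re (h q) * Re (h c)"
    unfolding power_divide key by simp
  moreover have "(Re (h q) - Re (h c))\<^sup>2 \<le> (cmod (h q - h c))\<^sup>2"
    by (simp add: cmod_power2)
  \<comment> \<open>With a = Re (h q) and b = Re (h c) the facts collected give 3 (a - b)^2 \<le> 4
    a b, and 3 (a - b)^2 - 4 a b factors as (3 a - b) (a - 3 b).\<close>
  ultimately have "(3 * Re (h q) - Re (h c)) * (Re (h q) - 3 * Re (h c)) \<le> 0"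
    by (simp add: power2_eq_square algebra_simps)
  then have "\<not> (3 * Re (h q) < Re (h c) \<and> Re (h q) < 3 * Re (h c))"
    using mult_neg_neg[of "3 * Re (h q) - Re (h c)" "Re (h q) - 3 * Re (h c)"] by auto
  then show ?thesis using c0 by linarith
qed

text \<open>\<open>w\<close> is squeezed between harmonic functions with almost the same boundary
  values: from below directly, from above after adding a paraboloid that compensates the Laplacian.
  Harnack's inequality for the harmonic function then transfers, at the price of the height of the
  paraboloid.\<close>

lemma Harnack_superharmonic:
  assumes R: "R > 0" and cont: "continuous_on (cball c R) w" and nonneg: "\<And>z. z \<in> sphere c R \<Longrightarrow> w z \<ge> 0"
    and lap: "\<And>z. z \<in> ball c R \<Longrightarrow> \<exists>a b L. has_lap w a b L z \<and> - M \<le> L \<and> L \<le> 0"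
    and q: "cmod (q - c) \<le> R / 2"
  shows "w q \<ge> (w c - M * R\<^sup>2 / 4) / 3"
proof -
  have cq: "c \<in> ball c R" "q \<in> ball c R"
    using R q by (auto simp: dist_norm norm_minus_commute)
  have main: "(w c - M * R\<^sup>2 / 4) / 3 \<le> w q + e" if "e > 0" for e
  proof -
    define d where "d = e / 3"
    have d: "d > 0" using that by (simp add: d_def)
    obtain h0 where h0: "h0 holomorphic_on UNIV" "\<And>z. z \<in> sphere c R \<Longrightarrow> \<bar>w z - Re (h0 z)\<bar> < d"
      using harmonic_approx_on_circle[OF R continuous_on_subset[OF cont sphere_cball] d] by blast
    \<comment> \<open>The shift by \<open>2 * d\<close> places Re h between w + d and w + 3 d on the
      circle, so that it is positive there and hence inside.\<close>
    define h where "h z = h0 z + of_real (2 * d)" for z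
    have holh: "h holomorphic_on UNIV"
      unfolding h_def[abs_def] by (intro holomorphic_intros h0)
    have h: "w z + d \<le> Re (h z)" "Re (h z) \<le> w z + 3 * d" if "z \<in> sphere c R" for z
      using h0(2)[OF that] by (auto simp: h_def abs_if split: if_splits)
    have laph: "has_lap (\<lambda>z. Re (h z)) (Re (deriv h z)) (- Im (deriv h z)) 0 z" for z
      by (rule has_lap_Re[OF open_UNIV UNIV_I holh])
    have conth: "continuous_on (cball c R) (\<lambda>z. Re (h z))"
      by (intro continuous_intros continuous_on_subset[OF holomorphic_on_imp_continuous_on[OF holh]]) auto
    have clb: "closure (ball c R) = cball c R" "frontier (ball c R) = sphere c R"
      using R by auto
    have pos: "Re (h z) > 0" if "z \<in> ball c R" for z
    proof -
      have "Re (h z) - d \<ge> 0"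
      proof (rule nonneg_if_superharmonic[of "ball c R" "\<lambda>z. Re (h z) - d"])
        show "\<exists>a b L. has_lap (\<lambda>z. Re (h z) - d) a b L u \<and> L \<le> 0" for u
          using has_lap_diff[OF laph[of u] has_lap_const[of d u]] by fastforce
      qed (use that h nonneg in \<open>auto simp: clb intro!: continuous_intros conth\<close>, force)
      then show ?thesis using d by simp
    qed
    have "w q - (Re (h q) - 3 * d) \<ge> 0"
    proof (rule nonneg_if_superharmonic[of "ball c R" "\<lambda>z. w z - (Re (h z) - 3 * d)"])
      show "\<exists>a b L. has_lap (\<lambda>z. w z - (Re (h z) - 3 * d)) a b L u \<and> L \<le> 0" if u: "u \<in> ball c R" for u
      proof -
        obtain a b L where L: "has_lap w a b L u" "L \<le> 0" using lap[OF u] by blast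
        show ?thesis
          using has_lap_diff[OF L(1) has_lap_diff[OF laph[of u] has_lap_const[of "3 * d" u]]] L(2)
          by fastforce
      qed
      show "0 \<le> w z - (Re (h z) - 3 * d)" if "z \<in> frontier (ball c R)" for z
        using h(2)[OF that[unfolded clb(2)]] by linarith
    qed (use h cq in \<open>auto simp: clb intro!: continuous_intros conth cont\<close>)
    \<comment> \<open>The paraboloid (M / 4) (R^2 - |z - c|^2) vanishes on the circle and has
      Laplacian - M, which absorbs the lower bound for the Laplacian of \<open>w\<close>. Its value
      at the centre is the loss M R^2 / 4.\<close>
    moreover have "Re (h c) + (M / 4) * (R\<^sup>2 - (cmod (c - c))\<^sup>2) - w c \<ge> 0"
    proof (rule nonneg_if_superharmonic[of "ball c R" "\<lambda>z. Re (h z) + (M / 4) * (R\<^sup>2 - (cmod (z - c))\<^sup>2) - w z"])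
      show "\<exists>a b L. has_lap (\<lambda>z. Re (h z) + (M / 4) * (R\<^sup>2 - (cmod (z - c))\<^sup>2) - w z) a b L u \<and> L \<le> 0"
        if u: "u \<in> ball c R" for u
      proof -
        obtain a b L where L: "has_lap w a b L u" "- M \<le> L" using lap[OF u] by blast
        have "has_lap (\<lambda>z. Re (h z) + (M / 4) * (R\<^sup>2 - (cmod (z - c))\<^sup>2) - w z)
            (Re (deriv h u) + (M / 4) * (0 - 2 * Re (u - c)) - a)
            (- Im (deriv h u) + (M / 4) * (0 - 2 * Im (u - c)) - b)
            (0 + (M / 4) * (0 - 4) - L) u"
          by (intro has_lap_diff has_lap_add has_lap_cmult laph has_lap_const has_lap_norm_sq L(1))
        then show ?thesis using L(2) by (intro exI conjI) (assumption, simp)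
      qed
      show "0 \<le> Re (h z) + (M / 4) * (R\<^sup>2 - (cmod (z - c))\<^sup>2) - w z" if "z \<in> frontier (ball c R)" for z
        using that h(1)[of z] d by (simp add: clb dist_norm norm_minus_commute)
    qed (use cq in \<open>auto simp: clb intro!: continuous_intros conth cont\<close>)
    moreover have "Re (h c) / 3 \<le> Re (h q)"
      by (rule Harnack_holomorphic[OF holh R pos q])
    ultimately show ?thesis by (simp add: d_def)
  qed
  then show ?thesis by (rule field_le_epsilon)
qed


section \<open>The distance on the punctured torus\<close>

lemma lattice_0: "0 \<in> lattice \<tau>"
  unfolding lattice_def by (auto intro!: exI[of _ 0])

lemma lattice_add: "a \<in> lattice \<tau> \<Longrightarrow> b \<in> lattice \<tau> \<Longrightarrow> a + b \<in> lattice \<tau>"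
  unfolding lattice_def
proof clarify
  fix m n k l :: int
  show "\<exists>p q. of_int m + of_int n * \<tau> + (of_int k + of_int l * \<tau>) = of_int p + of_int q * \<tau> \<and> True"
    by (intro exI[of _ "m + k"] exI[of _ "n + l"]) (simp add: algebra_simps)
qed

lemma lattice_minus: "a \<in> lattice \<tau> \<Longrightarrow> - a \<in> lattice \<tau>"
  unfolding lattice_def
proof clarify
  fix m n :: int
  show "\<exists>p q. - (of_int m + of_int n * \<tau>) = of_int p + of_int q * \<tau> \<and> True"
    by (intro exI[of _ "- m"] exI[of _ "- n"]) simp
qed

lemma lattice_diff: "a \<in> lattice \<tau> \<Longrightarrow> b \<in> lattice \<tau> \<Longrightarrow> a - b \<in> lattice \<tau>"
  using lattice_add[OF _ lattice_minus] by simp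

lemma lattice_add_iff: "b \<in> lattice \<tau> \<Longrightarrow> a + b \<in> lattice \<tau> \<longleftrightarrow> a \<in> lattice \<tau>"
  using lattice_add[of a \<tau> b] lattice_diff[of "a + b" \<tau> b] by auto

lemma countable_lattice: "countable (lattice \<tau>)"
proof -
  have "lattice \<tau> = (\<lambda>(m, n). of_int m + of_int n * \<tau>) ` (UNIV :: (int \<times> int) set)"
    unfolding lattice_def by auto
  then show ?thesis by simp
qed

definition coset :: "complex \<Rightarrow> complex \<Rightarrow> complex set" where
  "coset \<tau> z = (\<lambda>\<omega>. z + \<omega>) ` lattice \<tau>"

lemma punctured_torus_eq: "punctured_torus \<tau> = coset \<tau> ` (- lattice \<tau>)"
  unfolding punctured_torus_def coset_def ..

lemma coset_eqI:
  assumes "w \<in> lattice \<tau>"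
  shows "coset \<tau> (z + w) = coset \<tau> z"
proof
  show "coset \<tau> (z + w) \<subseteq> coset \<tau> z"
    unfolding coset_def using assms lattice_add by (force simp: add.assoc)
  show "coset \<tau> z \<subseteq> coset \<tau> (z + w)"
  proof
    fix u assume "u \<in> coset \<tau> z"
    then obtain v where "v \<in> lattice \<tau>" "u = z + v" unfolding coset_def by blast
    then have "u = (z + w) + (v - w)" "v - w \<in> lattice \<tau>"
      using assms lattice_diff by auto
    then show "u \<in> coset \<tau> (z + w)" unfolding coset_def by blast
  qed
qed

lemma mem_coset_self: "z \<in> coset \<tau> z"
  unfolding coset_def using lattice_0 by force

lemma mem_coset_iff: "w \<in> coset \<tau> z \<longleftrightarrow> w - z \<in> lattice \<tau>"
proof
  assume "w - z \<in> lattice \<tau>"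
  then have "z + (w - z) \<in> coset \<tau> z" unfolding coset_def by (rule imageI)
  then show "w \<in> coset \<tau> z" by simp
qed (auto simp: coset_def)

lemma coset_translate: "w \<in> lattice \<tau> \<Longrightarrow> u + w \<in> coset \<tau> z \<longleftrightarrow> u \<in> coset \<tau> z"
  unfolding mem_coset_iff using lattice_add_iff[of w \<tau> "u - z"] by (simp add: algebra_simps)

section \<open>Paths and their lengths\<close>

lemma valid_path_C1:
  assumes "valid_path g"
  obtains S where "finite S" "\<And>t. t \<in> {0..1} - S \<Longrightarrow> g differentiable at t"
    "continuous_on ({0..1} - S) (\<lambda>t. vector_derivative g (at t))" "{0, 1} \<subseteq> S"
proof -
  obtain S where S: "finite S" "g C1_differentiable_on ({0..1} - S)"
    using assms unfolding valid_path_def piecewise_C1_differentiable_on_def by blast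
  show ?thesis
  proof (rule that[of "S \<union> {0, 1}"])
    show "continuous_on ({0..1} - (S \<union> {0, 1})) (\<lambda>t. vector_derivative g (at t))"
      using S(2) unfolding C1_differentiable_on_eq by (auto intro: continuous_on_subset)
  qed (use S in \<open>auto simp: C1_differentiable_on_eq\<close>)
qed

lemma AE_not_in_finite: "finite S \<Longrightarrow> AE t in lborel. (t::real) \<notin> S"
  by (rule AE_not_in) (simp add: finite_imp_null_set_lborel)

lemma polynomial_function_imp_valid_path:
  fixes g :: "real \<Rightarrow> complex"
  assumes "polynomial_function g"
  shows "valid_path g"
proof -
  obtain g' where g': "polynomial_function g'" "\<And>t. (g has_vector_derivative g' t) (at t)"
    using has_vector_derivative_polynomial_function[OF assms] by metis
  have "g C1_differentiable_on {0..1}"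
    unfolding C1_differentiable_on_def using g' continuous_on_polymonial_function by blast
  then show ?thesis unfolding valid_path_def by (rule C1_differentiable_imp_piecewise)
qed

text \<open>The path metric depends only on this much: periodicity lets lengths descend to cosets,
  while continuity and positivity bound the density below on small discs and so separate
  points.\<close>

locale periodic_density =
  fixes \<tau> :: complex and \<rho> :: "complex \<Rightarrow> real"
  assumes open_compl: "open (- lattice \<tau>)"
    and periodic: "periodic \<tau> \<rho>"
    and positive: "z \<notin> lattice \<tau> \<Longrightarrow> \<rho> z > 0"
    and continuous: "continuous_on (- lattice \<tau>) \<rho>"
begin

text \<open>With the integrand cut off outside the unit interval, reparametrisations become affine
  substitutions in integrals over the whole line.\<close>

definition speed :: "(real \<Rightarrow> complex) \<Rightarrow> real \<Rightarrow> ennreal" where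
  "speed g t = ennreal (sqrt (\<rho> (g t)) * cmod (vector_derivative g (at t))) * indicator {0..1} t"

lemma conformal_length_speed: "conformal_length \<rho> g = (\<integral>\<^sup>+ t. speed g t \<partial>lborel)"
  unfolding conformal_length_def speed_def ..

definition paths :: "complex set \<Rightarrow> complex set \<Rightarrow> (real \<Rightarrow> complex) set" where
  "paths A B = {g. valid_path g \<and> path_image g \<subseteq> - lattice \<tau> \<and> pathstart g \<in> A \<and> pathfinish g \<in> B}"

text \<open>The velocity is continuous off a finite set, and altering a function on a countable set
  preserves measurability.\<close>

lemma speed_measurable:
  assumes "valid_path g" "path_image g \<subseteq> - lattice \<tau>"
  shows "speed g \<in> borel_measurable borel"
proof -
  obtain S where S: "finite S" "continuous_on ({0..1} - S) (\<lambda>t. vector_derivative g (at t))"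
    using valid_path_C1[OF assms(1)] by metis
  have "continuous_on {0..1} g" using assms(1) valid_path_imp_path path_def by blast
  then have "continuous_on {0..1} (\<lambda>t. \<rho> (g t))"
    by (rule continuous_on_compose2[OF continuous]) (use assms(2) in \<open>auto simp: path_image_def\<close>)
  then have "continuous_on ({0..1} - S) (\<lambda>t. sqrt (\<rho> (g t)) * cmod (vector_derivative g (at t)))"
    by (intro continuous_intros S(2)) (auto intro: continuous_on_subset)
  then have "(\<lambda>t. indicator ({0..1} - S) t *\<^sub>R (sqrt (\<rho> (g t)) * cmod (vector_derivative g (at t))))
      \<in> borel_measurable borel"
    using S(1)
    by (intro borel_measurable_continuous_on_indicator sets.Diff) (auto simp: borel_closed finite_imp_closed)
  then have m: "(\<lambda>t. ennreal (indicator ({0..1} - S) t *\<^sub>R (sqrt (\<rho> (g t)) * cmod (vector_derivative g (at t)))))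
      \<in> borel_measurable borel"
    by simp
  show ?thesis
    by (rule measurable_discrete_difference[OF m, of S])
       (use S(1) in \<open>auto simp: speed_def countable_finite split: split_indicator\<close>)
qed

lemma speed_compose_affine:
  assumes "g differentiable at (a + c * t)" "open U" "t \<in> U"
    "\<And>s. s \<in> U \<Longrightarrow> h s = g (a + c * s)" "t \<in> {0..1}" "a + c * t \<in> {0..1}"
  shows "speed h t = ennreal \<bar>c\<bar> * speed g (a + c * t)"
proof -
  have "((\<lambda>s. a + c * s) has_vector_derivative c) (at t)"
    by (auto intro!: derivative_eq_intros)
  moreover have "(g has_vector_derivative vector_derivative g (at (a + c * t))) (at (a + c * t))"
    using assms(1) vector_derivative_works by blast
  ultimately have "((\<lambda>s. g (a + c * s)) has_vector_derivative (c *\<^sub>R vector_derivative g (at (a + c * t)))) (at t)"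
    using vector_diff_chain_at[of "\<lambda>s. a + c * s" c t g] by (simp add: o_def)
  then have "(h has_vector_derivative (c *\<^sub>R vector_derivative g (at (a + c * t)))) (at t)"
    by (rule has_vector_derivative_transform_within_open[OF _ assms(2,3)]) (simp add: assms(4))
  then have "vector_derivative h (at t) = c *\<^sub>R vector_derivative g (at (a + c * t))"
    by (rule vector_derivative_at)
  then show ?thesis
    using assms(4)[OF assms(3)] assms(5,6)
    by (simp add: speed_def ennreal_mult'[symmetric] mult.left_commute)
qed

lemma conformal_length_reversepath:
  assumes "valid_path g" "path_image g \<subseteq> - lattice \<tau>"
  shows "conformal_length \<rho> (reversepath g) = conformal_length \<rho> g"
proof -
  obtain S where S: "finite S" "\<And>t. t \<in> {0..1} - S \<Longrightarrow> g differentiable at t"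
    using valid_path_C1[OF assms(1)] by metis
  have "AE t in lborel. t \<notin> (\<lambda>x. 1 - x) ` S"
    by (rule AE_not_in_finite) (simp add: S(1))
  then have "AE t in lborel. speed (reversepath g) t = speed g (1 + (-1) * t)"
  proof eventually_elim
    case (elim t)
    show ?case
    proof (cases "t \<in> {0..1}")
      case True
      then have "g differentiable at (1 + (-1) * t)"
        using S(2)[of "1 - t"] elim imageI[of "1 - t" S "\<lambda>x. 1 - x"] by auto
      from speed_compose_affine[OF this, of UNIV "reversepath g"] True show ?thesis
        by (simp add: reversepath_def)
    next
      case False
      then show ?thesis by (auto simp: speed_def)
    qed
  qed
  then have "conformal_length \<rho> (reversepath g) = (\<integral>\<^sup>+ t. speed g (1 + (-1) * t) \<partial>lborel)"
    unfolding conformal_length_speed by (rule nn_integral_cong_AE)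
  also have "\<dots> = conformal_length \<rho> g"
    unfolding conformal_length_speed
    using nn_integral_real_affine[OF speed_measurable[OF assms], of "-1" 1] by simp
  finally show ?thesis .
qed

lemma conformal_length_join:
  assumes "valid_path g" "path_image g \<subseteq> - lattice \<tau>" "valid_path h" "path_image h \<subseteq> - lattice \<tau>"
  shows "conformal_length \<rho> (g +++ h) = conformal_length \<rho> g + conformal_length \<rho> h"
proof -
  obtain S where S: "finite S" "\<And>t. t \<in> {0..1} - S \<Longrightarrow> g differentiable at t"
    using valid_path_C1[OF assms(1)] by metis
  obtain T where T: "finite T" "\<And>t. t \<in> {0..1} - T \<Longrightarrow> h differentiable at t"
    using valid_path_C1[OF assms(3)] by metis
  \<comment> \<open>Excluded are the corners of both paths, pulled back to the joint parameter,
    together with the joining time 1 / 2 and the endpoints.\<close>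
  have "AE t in lborel. t \<notin> (\<lambda>x. x / 2) ` S \<union> (\<lambda>x. (x + 1) / 2) ` T \<union> {1 / 2, 0, 1}"
    by (rule AE_not_in_finite) (simp add: S(1) T(1))
  then have "AE t in lborel. speed (g +++ h) t = ennreal \<bar>2\<bar> * speed g (0 + 2 * t) + ennreal \<bar>2\<bar> * speed h (- 1 + 2 * t)"
  proof eventually_elim
    case (elim t)
    then have t: "t \<noteq> 1 / 2" by auto
    consider "t \<notin> {0..1}" | "0 \<le> t" "t < 1 / 2" | "1 / 2 < t" "t \<le> 1"
      using t by (cases "t < 1 / 2"; cases "t \<in> {0..1}") auto
    then show ?case
    proof cases
      case 1
      then show ?thesis by (auto simp: speed_def split: split_indicator)
    next
      case 2
      have "2 * t \<notin> S"
      proof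
        assume "2 * t \<in> S"
        then have "2 * t / 2 \<in> (\<lambda>x. x / 2) ` S" by (rule imageI)
        then show False using elim by simp
      qed
      then have d: "g differentiable at (0 + 2 * t)" using S(2)[of "2 * t"] 2 by auto
      have "speed (g +++ h) t = ennreal \<bar>2\<bar> * speed g (0 + 2 * t)"
        by (rule speed_compose_affine[OF d, of "{..<1/2}"]) (use 2 in \<open>auto simp: joinpaths_def\<close>)
      moreover have "speed h (- 1 + 2 * t) = 0" using 2 by (simp add: speed_def)
      ultimately show ?thesis by simp
    next
      case 3
      have "2 * t - 1 \<notin> T"
      proof
        assume "2 * t - 1 \<in> T"
        then have "(2 * t - 1 + 1) / 2 \<in> (\<lambda>x. (x + 1) / 2) ` T" by (rule imageI)
        then show False using elim by simp
      qed
      then have d: "h differentiable at (- 1 + 2 * t)" using T(2)[of "2 * t - 1"] 3 by (auto simp: add.commute)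
      have "speed (g +++ h) t = ennreal \<bar>2\<bar> * speed h (- 1 + 2 * t)"
        by (rule speed_compose_affine[OF d, of "{1/2<..}"])
           (use 3 in \<open>auto simp: joinpaths_def algebra_simps\<close>)
      moreover have "speed g (0 + 2 * t) = 0" using 3 by (simp add: speed_def)
      ultimately show ?thesis by simp
    qed
  qed
  then have "conformal_length \<rho> (g +++ h) =
      (\<integral>\<^sup>+ t. ennreal \<bar>2\<bar> * speed g (0 + 2 * t) + ennreal \<bar>2\<bar> * speed h (- 1 + 2 * t) \<partial>lborel)"
    unfolding conformal_length_speed by (rule nn_integral_cong_AE)
  also have "\<dots> = (\<integral>\<^sup>+ t. ennreal \<bar>2\<bar> * speed g (0 + 2 * t) \<partial>lborel) +
      (\<integral>\<^sup>+ t. ennreal \<bar>2\<bar> * speed h (- 1 + 2 * t) \<partial>lborel)"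
    using speed_measurable[OF assms(1,2)] speed_measurable[OF assms(3,4)]
    by (intro nn_integral_add) (auto intro!: borel_measurable_times measurable_compose[of _ lborel borel])
  also have "\<dots> = ennreal \<bar>2\<bar> * (\<integral>\<^sup>+ t. speed g (0 + 2 * t) \<partial>lborel) +
      ennreal \<bar>2\<bar> * (\<integral>\<^sup>+ t. speed h (- 1 + 2 * t) \<partial>lborel)"
    using speed_measurable[OF assms(1,2)] speed_measurable[OF assms(3,4)]
    by (intro arg_cong2[of _ _ _ _ plus] nn_integral_cmult)
       (auto intro!: measurable_compose[of _ lborel borel])
  also have "\<dots> = conformal_length \<rho> g + conformal_length \<rho> h"
    unfolding conformal_length_speed
    using nn_integral_real_affine[OF speed_measurable[OF assms(1,2)], of 2 0]
      nn_integral_real_affine[OF speed_measurable[OF assms(3,4)], of 2 "-1"] by simp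
  finally show ?thesis .
qed

lemma rho_translate: "w \<in> lattice \<tau> \<Longrightarrow> z \<notin> lattice \<tau> \<Longrightarrow> \<rho> (z + w) = \<rho> z"
  using periodic unfolding periodic_def by auto

lemma conformal_length_translate:
  assumes "w \<in> lattice \<tau>" "path_image g \<subseteq> - lattice \<tau>"
  shows "conformal_length \<rho> (\<lambda>t. g t + w) = conformal_length \<rho> g"
  unfolding conformal_length_speed
proof (rule nn_integral_cong)
  fix t
  have "vector_derivative (\<lambda>t. g t + w) (at t) = vector_derivative g (at t)"
    unfolding vector_derivative_def has_vector_derivative_add_const ..
  moreover have "\<rho> (g t + w) = \<rho> (g t)" if "t \<in> {0..1}"
    using subsetD[OF assms(2), of "g t"] that by (intro rho_translate assms(1)) (simp add: path_image_def)
  ultimately show "speed (\<lambda>t. g t + w) t = speed g t"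
    by (simp add: speed_def split: split_indicator)
qed

lemma paths_translate:
  assumes "g \<in> paths (coset \<tau> a) (coset \<tau> b)" "w \<in> lattice \<tau>"
  shows "(\<lambda>t. g t + w) \<in> paths (coset \<tau> a) (coset \<tau> b)"
proof -
  have "valid_path ((\<lambda>z. z + w) \<circ> g)"
  proof (rule valid_path_compose)
    show "(\<lambda>z. z + w) field_differentiable at x" for x
      by (intro field_differentiable_add field_differentiable_const field_differentiable_ident)
    have "deriv (\<lambda>z. z + w) = (\<lambda>z. 1)"
      by (intro ext DERIV_imp_deriv) (auto intro!: derivative_eq_intros)
    then show "continuous_on (path_image g) (deriv (\<lambda>z. z + w))" by simp
  qed (use assms in \<open>simp add: paths_def\<close>)
  moreover have "path_image (\<lambda>t. g t + w) \<subseteq> - lattice \<tau>"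
    using assms lattice_add_iff[OF assms(2)] by (auto simp: paths_def path_image_def)
  ultimately show ?thesis
    using assms coset_translate[OF assms(2)]
    by (auto simp: paths_def o_def pathstart_def pathfinish_def)
qed

text \<open>\<open>enn2real\<close> sends infinity to 0, so the metric axioms are proved for the
  extended value first and transferred by means of \<open>edist_finite\<close>.\<close>

definition edist :: "complex set \<Rightarrow> complex set \<Rightarrow> ennreal" where
  "edist A B = (INF g \<in> paths A B. conformal_length \<rho> g)"

lemma torus_dist_edist: "torus_dist \<tau> \<rho> A B = enn2real (edist A B)"
  unfolding torus_dist_def edist_def paths_def ..

lemma edist_sym: "edist A B = edist B A"
proof -
  have "edist A B \<le> edist B A" for A B
    unfolding edist_def
  proof (rule INF_greatest)
    fix g assume g: "g \<in> paths B A"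
    then have "reversepath g \<in> paths A B"
      by (auto simp: paths_def)
    then have "(INF g \<in> paths A B. conformal_length \<rho> g) \<le> conformal_length \<rho> (reversepath g)"
      by (rule INF_lower)
    then show "(INF g \<in> paths A B. conformal_length \<rho> g) \<le> conformal_length \<rho> g"
      using conformal_length_reversepath g by (simp add: paths_def)
  qed
  then show ?thesis by (intro antisym)
qed

text \<open>A path into the coset of \<open>b\<close> and a path out of it need not meet in the
  plane. A lattice translation of the second one joins them and preserves its length.\<close>

lemma edist_triangle:
  shows "edist (coset \<tau> a) (coset \<tau> c) \<le> edist (coset \<tau> a) (coset \<tau> b) + edist (coset \<tau> b) (coset \<tau> c)"
proof -
  have *: "edist (coset \<tau> a) (coset \<tau> c) \<le> conformal_length \<rho> g + conformal_length \<rho> h"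
    if g: "g \<in> paths (coset \<tau> a) (coset \<tau> b)" and h: "h \<in> paths (coset \<tau> b) (coset \<tau> c)" for g h
  proof -
    define w where "w = pathfinish g - pathstart h"
    have w: "w \<in> lattice \<tau>"
      using g h lattice_diff[of "pathfinish g - b" \<tau> "pathstart h - b"]
      by (simp add: paths_def mem_coset_iff w_def)
    define h' where "h' = (\<lambda>t. h t + w)"
    have h': "h' \<in> paths (coset \<tau> b) (coset \<tau> c)"
      using paths_translate[OF h w] by (simp add: h'_def)
    have "pathstart h' = pathfinish g" by (simp add: h'_def w_def pathstart_def)
    then have "g +++ h' \<in> paths (coset \<tau> a) (coset \<tau> c)"
      using g h' by (auto simp: paths_def intro!: valid_path_join dest!: subsetD[OF path_image_join_subset])
    then have "edist (coset \<tau> a) (coset \<tau> c) \<le> conformal_length \<rho> (g +++ h')"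
      unfolding edist_def by (rule INF_lower)
    also have "\<dots> = conformal_length \<rho> g + conformal_length \<rho> h'"
      using g h' by (intro conformal_length_join) (auto simp: paths_def)
    also have "conformal_length \<rho> h' = conformal_length \<rho> h"
      unfolding h'_def using h by (intro conformal_length_translate w) (auto simp: paths_def)
    finally show ?thesis .
  qed
  show ?thesis
  proof (rule ennreal_le_epsilon)
    fix e :: real
    assume fin: "edist (coset \<tau> a) (coset \<tau> b) + edist (coset \<tau> b) (coset \<tau> c) < top" and e: "0 < e"
    have lt: "x < x + ennreal (e / 2)" if "x < top" for x :: ennreal
      using ennreal_add_left_cancel_less[of x 0 "ennreal (e / 2)"] that e by simp
    have near: "\<exists>g\<in>paths A B. conformal_length \<rho> g < edist A B + ennreal (e / 2)" if "edist A B < top" for A B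
    proof -
      have "(INF g\<in>paths A B. conformal_length \<rho> g) < edist A B + ennreal (e / 2)"
        using lt[OF that] by (simp add: edist_def)
      then show ?thesis by (simp only: INF_less_iff)
    qed
    obtain g where g: "g \<in> paths (coset \<tau> a) (coset \<tau> b)"
      "conformal_length \<rho> g < edist (coset \<tau> a) (coset \<tau> b) + ennreal (e / 2)"
      using near[of "coset \<tau> a" "coset \<tau> b"] fin by auto
    obtain h where h: "h \<in> paths (coset \<tau> b) (coset \<tau> c)"
      "conformal_length \<rho> h < edist (coset \<tau> b) (coset \<tau> c) + ennreal (e / 2)"
      using near[of "coset \<tau> b" "coset \<tau> c"] fin by auto
    have "edist (coset \<tau> a) (coset \<tau> c) \<le> conformal_length \<rho> g + conformal_length \<rho> h"
      by (rule *[OF g(1) h(1)])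
    also have "\<dots> \<le> (edist (coset \<tau> a) (coset \<tau> b) + ennreal (e / 2)) +
        (edist (coset \<tau> b) (coset \<tau> c) + ennreal (e / 2))"
      using g(2) h(2) by (intro add_mono) auto
    also have "\<dots> = edist (coset \<tau> a) (coset \<tau> b) + edist (coset \<tau> b) (coset \<tau> c) +
        (ennreal (e / 2) + ennreal (e / 2))"
      by (simp only: ac_simps)
    also have "ennreal (e / 2) + ennreal (e / 2) = ennreal e"
      using e by (simp add: ennreal_plus[symmetric] del: ennreal_plus)
    finally show "edist (coset \<tau> a) (coset \<tau> c) \<le>
        edist (coset \<tau> a) (coset \<tau> b) + edist (coset \<tau> b) (coset \<tau> c) + ennreal e" .
  qed
qed

text \<open>The complement of a countable set is connected, so a polynomial path exists; along its
  compact image the density is bounded.\<close>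

lemma paths_finite_length:
  assumes "a \<notin> lattice \<tau>" "b \<notin> lattice \<tau>"
  obtains g where "g \<in> paths (coset \<tau> a) (coset \<tau> b)" "conformal_length \<rho> g < top"
proof -
  have "path_connected (- lattice \<tau>)"
    by (rule path_connected_complement_countable) (auto simp: countable_lattice)
  then obtain g where g: "polynomial_function g" "path_image g \<subseteq> - lattice \<tau>" "pathstart g = a" "pathfinish g = b"
    using connected_open_polynomial_connected[OF open_compl path_connected_imp_connected, of a b] assms by auto
  obtain g' where g': "polynomial_function g'" "\<And>t. (g has_vector_derivative g' t) (at t)"
    using has_vector_derivative_polynomial_function[OF g(1)] by metis
  have "continuous_on {0..1} (\<lambda>t. \<rho> (g t))"
    by (rule continuous_on_compose2[OF continuous])
       (use g in \<open>auto simp: path_image_def continuous_on_polymonial_function\<close>)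
  then have "continuous_on {0..1} (\<lambda>t. sqrt (\<rho> (g t)) * cmod (g' t))"
    using g'(1) by (intro continuous_intros) (auto simp: continuous_on_polymonial_function)
  then have "compact ((\<lambda>t. sqrt (\<rho> (g t)) * cmod (g' t)) ` {0..1})"
    by (rule compact_continuous_image) simp
  from compact_imp_bounded[OF this] obtain M where "\<forall>t\<in>{0..1}. \<bar>sqrt (\<rho> (g t)) * cmod (g' t)\<bar> \<le> M"
    unfolding bounded_real by auto
  then have M: "\<And>t. t \<in> {0..1} \<Longrightarrow> sqrt (\<rho> (g t)) * cmod (g' t) \<le> M" by (meson abs_le_D1)
  have "conformal_length \<rho> g \<le> (\<integral>\<^sup>+ t. ennreal M * indicator {0..1::real} t \<partial>lborel)"
    unfolding conformal_length_speed speed_def vector_derivative_at[OF g'(2)]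
    using M by (intro nn_integral_mono) (auto split: split_indicator intro: ennreal_leI)
  also have "\<dots> < top" by (simp add: nn_integral_cmult_indicator ennreal_mult_less_top)
  finally have "conformal_length \<rho> g < top" .
  moreover have "g \<in> paths (coset \<tau> a) (coset \<tau> b)"
    using g mem_coset_self by (auto simp: paths_def polynomial_function_imp_valid_path)
  ultimately show ?thesis using that by blast
qed

lemma edist_finite: "a \<notin> lattice \<tau> \<Longrightarrow> b \<notin> lattice \<tau> \<Longrightarrow> edist (coset \<tau> a) (coset \<tau> b) < top"
  using paths_finite_length INF_lower unfolding edist_def by (metis le_less_trans)

text \<open>Only the part of the path before it first reaches distance \<open>d\<close> from its
  start is counted. It stays in the disc where \<open>\<mu>\<close> is a lower bound, and its
  Euclidean length is at least \<open>d\<close> because the velocity integrates to the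
  displacement.\<close>

lemma conformal_length_ge:
  assumes g: "valid_path g" "path_image g \<subseteq> - lattice \<tau>"
    and \<mu>: "\<And>z. z \<in> cball (g 0) d \<Longrightarrow> \<mu> \<le> sqrt (\<rho> z)" "\<mu> \<ge> 0" and d: "d > 0"
    and far: "cmod (g 1 - g 0) \<ge> d"
  shows "conformal_length \<rho> g \<ge> ennreal (\<mu> * d)"
proof -
  have contg: "continuous_on {0..1} g" using g(1) valid_path_imp_path path_def by blast
  \<comment> \<open>The infimum of this closed set is the first time at distance at least
    \<open>d\<close>.\<close>
  define E where "E = {t \<in> {0..1}. d \<le> cmod (g t - g 0)}"
  have "closed E"
    unfolding E_def by (intro continuous_on_closed_Collect_le continuous_intros contg closed_atLeastAtMost)
  moreover have "1 \<in> E" using far by (simp add: E_def)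
  moreover have bb: "bdd_below E" by (rule bdd_belowI[of _ 0]) (simp add: E_def)
  ultimately have "Inf E \<in> E" by (intro closed_contains_Inf) auto
  define s where "s = Inf E"
  have s: "0 \<le> s" "s \<le> 1" "d \<le> cmod (g s - g 0)"
    using \<open>Inf E \<in> E\<close> by (auto simp: E_def s_def)
  have near: "g t \<in> cball (g 0) d" if "0 \<le> t" "t < s" for t
  proof -
    have "t \<notin> E" using cInf_lower[OF _ bb, of t] that by (auto simp: s_def)
    then show ?thesis using that s by (simp add: E_def dist_norm norm_minus_commute)
  qed
  obtain S where S: "finite S" "\<And>t. t \<in> {0..1} - S \<Longrightarrow> g differentiable at t"
    "continuous_on ({0..1} - S) (\<lambda>t. vector_derivative g (at t))"
    using valid_path_C1[OF g(1)] by metis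
  define T where "T = insert s S"
  \<comment> \<open>The velocity up to that time, set to 0 at the finitely many corners so that it
    is Borel measurable.\<close>
  define F where "F t = indicator ({0..s} - T) t *\<^sub>R vector_derivative g (at t)" for t
  have T: "finite T" using S(1) by (simp add: T_def)
  have "continuous_on ({0..s} - T) (\<lambda>t. vector_derivative g (at t))"
    by (rule continuous_on_subset[OF S(3)]) (use s in \<open>auto simp: T_def\<close>)
  then have Fm: "F \<in> borel_measurable borel"
    unfolding F_def[abs_def] using T
    by (intro borel_measurable_continuous_on_indicator sets.Diff) (auto simp: borel_closed finite_imp_closed)
  have "((\<lambda>t. vector_derivative g (at t)) has_integral (g s - g 0)) {0..s}"
  proof (rule fundamental_theorem_of_calculus_interior_strong[of T])
    show "continuous_on {0..s} g" by (rule continuous_on_subset[OF contg]) (use s in auto)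
    show "(g has_vector_derivative vector_derivative g (at x)) (at x)" if "x \<in> {0<..<s} - T" for x
      using S(2)[of x] that s by (auto simp: T_def vector_derivative_works)
  qed (use s T in auto)
  then have "((\<lambda>t. if t \<in> {0..s} then vector_derivative g (at t) else 0) has_integral (g s - g 0)) UNIV"
    by (simp only: has_integral_restrict_UNIV)
  then have Fi: "(F has_integral (g s - g 0)) UNIV"
    by (rule has_integral_spike_finite[OF T, rotated]) (auto simp: F_def)
  have "ennreal d \<le> (\<integral>\<^sup>+ t. norm (F t) \<partial>lborel)"
  proof (cases "(\<integral>\<^sup>+ t. norm (F t) \<partial>lborel) < \<infinity>")
    case True
    then have "integrable lborel F" using Fm by (intro integrableI_bounded) auto
    moreover from this have "integral\<^sup>L lborel F = g s - g 0"
      using has_integral_integral_lborel has_integral_unique Fi by blast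
    ultimately have "ennreal (norm (g s - g 0)) \<le> (\<integral>\<^sup>+ t. norm (F t) \<partial>lborel)"
      using integral_norm_bound_ennreal[of lborel F] by simp
    then show ?thesis using s(3) ennreal_leI order_trans by blast
  next
    case False
    then have "(\<integral>\<^sup>+ t. norm (F t) \<partial>lborel) = \<infinity>" by (auto simp: not_less top_unique)
    then show ?thesis by simp
  qed
  then have "ennreal (\<mu> * d) \<le> ennreal \<mu> * (\<integral>\<^sup>+ t. norm (F t) \<partial>lborel)"
    using \<mu>(2) d by (simp add: ennreal_mult mult_left_mono)
  also have "\<dots> = (\<integral>\<^sup>+ t. ennreal \<mu> * norm (F t) \<partial>lborel)"
    using Fm by (intro nn_integral_cmult[symmetric]) auto
  also have "\<dots> \<le> (\<integral>\<^sup>+ t. speed g t \<partial>lborel)"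
  proof (rule nn_integral_mono)
    fix t
    show "ennreal \<mu> * norm (F t) \<le> speed g t"
    proof (cases "t \<in> {0..s} - T")
      case True
      then have "g t \<in> cball (g 0) d" "t \<in> {0..1}" using near[of t] s by (auto simp: T_def)
      then show ?thesis
        using \<mu>(1)[of "g t"] \<mu>(2) True
        by (auto simp: speed_def F_def ennreal_mult[symmetric] intro!: ennreal_leI mult_right_mono)
    next
      case False
      then show ?thesis by (simp add: F_def)
    qed
  qed
  finally show ?thesis by (simp add: conformal_length_speed)
qed

text \<open>After a lattice translation every competing path starts at \<open>a\<close> itself, and
  its endpoint, still in the coset of \<open>b\<close>, lies outside the disc.\<close>

lemma edist_ge:
  assumes a: "cball a d \<subseteq> - lattice \<tau>" "ball a d \<inter> coset \<tau> b = {}" "d > 0"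
    and \<mu>: "\<And>z. z \<in> cball a d \<Longrightarrow> \<mu> \<le> sqrt (\<rho> z)" "\<mu> \<ge> 0"
  shows "edist (coset \<tau> a) (coset \<tau> b) \<ge> ennreal (\<mu> * d)"
  unfolding edist_def
proof (rule INF_greatest)
  fix g assume g: "g \<in> paths (coset \<tau> a) (coset \<tau> b)"
  define w where "w = a - g 0"
  have w: "w \<in> lattice \<tau>"
    using g lattice_minus[of "g 0 - a"] by (simp add: paths_def mem_coset_iff pathstart_def w_def)
  define h where "h = (\<lambda>t. g t + w)"
  have h: "h \<in> paths (coset \<tau> a) (coset \<tau> b)" "h 0 = a"
    using paths_translate[OF g w] by (auto simp: h_def w_def)
  have "h 1 \<notin> ball a d" using a(2) h(1) by (auto simp: paths_def pathfinish_def)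
  then have "cmod (h 1 - h 0) \<ge> d" using h(2) by (simp add: dist_norm norm_minus_commute)
  then have "conformal_length \<rho> h \<ge> ennreal (\<mu> * d)"
    using h \<mu> a(3) by (intro conformal_length_ge) (auto simp: paths_def)
  then show "ennreal (\<mu> * d) \<le> conformal_length \<rho> g"
    unfolding h_def using conformal_length_translate[OF w, of g] g by (simp add: paths_def)
qed

lemma sqrt_lower_on_cball:
  assumes "cball a d \<subseteq> - lattice \<tau>" "d > 0"
  obtains \<mu> where "\<mu> > 0" "\<And>z. z \<in> cball a d \<Longrightarrow> \<mu> \<le> sqrt (\<rho> z)"
proof -
  have "continuous_on (cball a d) (\<lambda>z. sqrt (\<rho> z))"
    using assms(1) continuous by (intro continuous_intros) (auto intro: continuous_on_subset)
  then obtain m where m: "m \<in> cball a d" "\<And>z. z \<in> cball a d \<Longrightarrow> sqrt (\<rho> m) \<le> sqrt (\<rho> z)"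
    using continuous_attains_inf[of "cball a d" "\<lambda>z. sqrt (\<rho> z)"] assms(2) by auto
  then show ?thesis using that[of "sqrt (\<rho> m)"] positive assms(1) by auto
qed

lemma Metric_space_torus: "Metric_space (punctured_torus \<tau>) (torus_dist \<tau> \<rho>)"
proof
  show "0 \<le> torus_dist \<tau> \<rho> A B" for A B by (simp add: torus_dist_def)
  show "torus_dist \<tau> \<rho> A B = torus_dist \<tau> \<rho> B A" for A B
    by (simp add: torus_dist_edist edist_sym)
  show "torus_dist \<tau> \<rho> A B = 0 \<longleftrightarrow> A = B" if AB: "A \<in> punctured_torus \<tau>" "B \<in> punctured_torus \<tau>" for A B
  proof -
    obtain a b where ab: "a \<notin> lattice \<tau>" "A = coset \<tau> a" "b \<notin> lattice \<tau>" "B = coset \<tau> b"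
      using AB by (auto simp: punctured_torus_eq)
    show ?thesis
    proof
      assume "A = B"
      have "linepath a a \<in> paths A A"
        using ab mem_coset_self by (auto simp: paths_def)
      then have "edist A A \<le> conformal_length \<rho> (linepath a a)"
        unfolding edist_def by (rule INF_lower)
      also have "\<dots> = 0" unfolding conformal_length_def by simp
      finally show "torus_dist \<tau> \<rho> A B = 0" using \<open>A = B\<close> by (simp add: torus_dist_edist)
    next
      assume 0: "torus_dist \<tau> \<rho> A B = 0"
      show "A = B"
      proof (rule ccontr)
        assume "A \<noteq> B"
        then have anB: "a \<notin> B"
          using coset_eqI[of "a - b" \<tau> b] by (auto simp: ab mem_coset_iff)
        have "B = (\<lambda>z. z - b) -` lattice \<tau>" by (auto simp: ab mem_coset_iff)
        then have "closed B"
          using open_compl by (auto intro!: closed_vimage continuous_intros simp: closed_def)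
        then have "open (- lattice \<tau> \<inter> - B)" using open_compl by auto
        then obtain d where d: "d > 0" "cball a d \<subseteq> - lattice \<tau> \<inter> - B"
          using anB ab(1) open_contains_cball by (metis ComplI IntI)
        obtain \<mu> where \<mu>: "\<mu> > 0" "\<And>z. z \<in> cball a d \<Longrightarrow> \<mu> \<le> sqrt (\<rho> z)"
          using sqrt_lower_on_cball[of a d] d by auto
        have "ball a d \<inter> coset \<tau> b = {}" using d(2) ball_subset_cball[of a d] ab by blast
        then have "ennreal (\<mu> * d) \<le> edist A B"
          unfolding ab using d \<mu> by (intro edist_ge) auto
        then have "enn2real (ennreal (\<mu> * d)) \<le> enn2real (edist A B)"
          using edist_finite[OF ab(1,3)] by (intro enn2real_mono) (auto simp: ab)
        then have "\<mu> * d \<le> torus_dist \<tau> \<rho> A B"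
          using \<mu>(1) d(1) by (simp add: torus_dist_edist)
        then show False using 0 \<mu>(1) d(1) by (simp add: mult_le_0_iff)
      qed
    qed
  qed
  show "torus_dist \<tau> \<rho> A C \<le> torus_dist \<tau> \<rho> A B + torus_dist \<tau> \<rho> B C"
    if ABC: "A \<in> punctured_torus \<tau>" "B \<in> punctured_torus \<tau>" "C \<in> punctured_torus \<tau>" for A B C
  proof -
    obtain a b c where abc: "a \<notin> lattice \<tau>" "A = coset \<tau> a" "b \<notin> lattice \<tau>" "B = coset \<tau> b"
      "c \<notin> lattice \<tau>" "C = coset \<tau> c"
      using ABC by (auto simp: punctured_torus_eq)
    have "enn2real (edist A C) \<le> enn2real (edist A B + edist B C)"
      unfolding abc using abc edist_finite by (intro enn2real_mono edist_triangle) auto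
    also have "\<dots> = enn2real (edist A B) + enn2real (edist B C)"
      unfolding abc using abc edist_finite by (intro enn2real_plus) auto
    finally show ?thesis by (simp add: torus_dist_edist)
  qed
qed


section \<open>Rays of finite length and completeness\<close>

lemma torus_dist_segment_le:
  assumes seg: "closed_segment a b \<subseteq> - lattice \<tau>" and M: "\<And>z. z \<in> closed_segment a b \<Longrightarrow> \<rho> z \<le> M\<^sup>2" "M \<ge> 0"
  shows "torus_dist \<tau> \<rho> (coset \<tau> a) (coset \<tau> b) \<le> M * cmod (b - a)"
proof -
  have "edist (coset \<tau> a) (coset \<tau> b) \<le> conformal_length \<rho> (linepath a b)"
    unfolding edist_def using seg mem_coset_self by (intro INF_lower) (auto simp: paths_def)
  also have "\<dots> \<le> (\<integral>\<^sup>+ t. ennreal (M * cmod (b - a)) * indicator {0..1::real} t \<partial>lborel)"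
    unfolding conformal_length_speed speed_def vector_derivative_linepath_at
  proof (intro nn_integral_mono)
    fix t :: real
    have "sqrt (\<rho> (linepath a b t)) \<le> M" if "t \<in> {0..1}"
      using M(1)[OF linepath_in_path[OF that]] M(2) by (simp add: real_le_lsqrt real_sqrt_le_iff')
    then show "ennreal (sqrt (\<rho> (linepath a b t)) * cmod (b - a)) * indicator {0..1} t
        \<le> ennreal (M * cmod (b - a)) * indicator {0..1} t"
      by (auto split: split_indicator intro!: ennreal_leI mult_right_mono)
  qed
  also have "\<dots> = ennreal (M * cmod (b - a))" by (simp add: nn_integral_cmult_indicator)
  finally have "enn2real (edist (coset \<tau> a) (coset \<tau> b)) \<le> enn2real (ennreal (M * cmod (b - a)))"
    by (intro enn2real_mono) auto
  then show ?thesis using M(2) by (simp add: torus_dist_edist)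
qed

text \<open>The points r / 2^n run into the puncture along the real axis. Consecutive distances
  decay geometrically, so they form a Cauchy sequence. It has no limit: a disc around any point of
  the surface misses the cosets of all late members.\<close>

lemma not_mcomplete_if_finite_ray:
  assumes r: "r > 0" "cball 0 r \<inter> lattice \<tau> = {0}" and c: "0 < c" "c \<le> 1" and K: "K > 0"
    and bound: "\<And>z. z \<noteq> 0 \<Longrightarrow> cmod z \<le> r \<Longrightarrow> \<rho> z \<le> K * cmod z powr (c - 2)"
  shows "\<not> Metric_space.mcomplete (punctured_torus \<tau>) (torus_dist \<tau> \<rho>)"
proof
  assume complete: "Metric_space.mcomplete (punctured_torus \<tau>) (torus_dist \<tau> \<rho>)"
  interpret MS: Metric_space "punctured_torus \<tau>" "torus_dist \<tau> \<rho>" by (rule Metric_space_torus)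
  define x where "x n = r * (1/2) ^ n" for n :: nat
  define z where "z n = complex_of_real (x n)" for n
  define \<sigma> where "\<sigma> n = coset \<tau> (z n)" for n
  have x: "0 < x n" "x n \<le> r" "x n = 2 * x (Suc n)" for n
    using r(1) by (auto simp: x_def mult_le_cancel_left1 power_le_one)
  have nl: "w \<notin> lattice \<tau>" if "w \<noteq> 0" "cmod w \<le> r" for w
  proof
    assume "w \<in> lattice \<tau>"
    then have "w \<in> cball 0 r \<inter> lattice \<tau>" using \<open>cmod w \<le> r\<close> by simp
    then show False using r(2) \<open>w \<noteq> 0\<close> by simp
  qed
  have range: "range \<sigma> \<subseteq> punctured_torus \<tau>"
  proof
    fix A assume "A \<in> range \<sigma>"
    then obtain n where n: "A = coset \<tau> (z n)" by (auto simp: \<sigma>_def)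
    have "z n \<notin> lattice \<tau>" by (rule nl) (use x(1,2)[of n] in \<open>auto simp: z_def\<close>)
    then show "A \<in> punctured_torus \<tau>" by (simp add: n punctured_torus_eq)
  qed
  \<comment> \<open>The ray segment from r / 2^n to r / 2^(n+1) has length of the order of its
    Euclidean size to the power c / 2, so halving the size multiplies the bound by
    \<open>q\<close>.\<close>
  define q where "q = (1/2) powr (c / 2)"
  have q: "0 < q" "q < 1" using c powr_less_mono2[of "c/2" "1/2" 1] by (auto simp: q_def)
  define B where "B = sqrt K * r powr (c / 2)"
  have B: "B > 0" using K r by (simp add: B_def)
  have step: "torus_dist \<tau> \<rho> (\<sigma> n) (\<sigma> (Suc n)) \<le> B * q ^ n" for n
  proof -
    have seg: "cmod w \<le> r \<and> x (Suc n) \<le> cmod w" if "w \<in> closed_segment (z n) (z (Suc n))" for w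
    proof -
      obtain u where u: "0 \<le> u" "u \<le> 1" "w = (1 - u) *\<^sub>R z n + u *\<^sub>R z (Suc n)"
        using \<open>w \<in> closed_segment (z n) (z (Suc n))\<close> unfolding closed_segment_def by blast
      have "w = of_real ((2 - u) * x (Suc n))"
        unfolding u(3) z_def x(3)[of n] by (simp add: scaleR_conv_of_real algebra_simps)
      then have *: "cmod w = (2 - u) * x (Suc n)" using u(2) x(1)[of "Suc n"] by (simp only: norm_of_real) simp
      have "1 * x (Suc n) \<le> (2 - u) * x (Suc n)" "(2 - u) * x (Suc n) \<le> 2 * x (Suc n)"
        using u(1,2) x(1)[of "Suc n"] by (intro mult_right_mono; simp)+
      then show ?thesis using * x(2,3)[of n] by simp
    qed
    \<comment> \<open>The exponent c - 2 is negative, so the bound for the density is worst at the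
      inner end of the segment; \<open>M\<close> is its square root there.\<close>
    define M where "M = sqrt K * x (Suc n) powr (c / 2 - 1)"
    have M0: "M \<ge> 0" using K by (simp add: M_def)
    have M2: "M\<^sup>2 = K * x (Suc n) powr (c - 2)"
    proof -
      have "(x (Suc n) powr (c / 2 - 1))\<^sup>2 = x (Suc n) powr ((c / 2 - 1) + (c / 2 - 1))"
        by (simp only: power2_eq_square powr_add)
      then show ?thesis using K by (simp add: M_def power_mult_distrib)
    qed
    have "torus_dist \<tau> \<rho> (\<sigma> n) (\<sigma> (Suc n)) \<le> M * cmod (z (Suc n) - z n)"
      unfolding \<sigma>_def
    proof (rule torus_dist_segment_le[OF _ _ M0])
      show "closed_segment (z n) (z (Suc n)) \<subseteq> - lattice \<tau>"
      proof
        fix w assume w: "w \<in> closed_segment (z n) (z (Suc n))"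
        have "w \<noteq> 0" using seg[OF w] x(1)[of "Suc n"] by auto
        then show "w \<in> - lattice \<tau>" using nl[of w] seg[OF w] by simp
      qed
      fix w assume w: "w \<in> closed_segment (z n) (z (Suc n))"
      have "w \<noteq> 0" using seg[OF w] x(1)[of "Suc n"] by auto
      then have "\<rho> w \<le> K * cmod w powr (c - 2)" using bound seg[OF w] by blast
      also have "\<dots> \<le> K * x (Suc n) powr (c - 2)"
        using K c seg[OF w] x(1)[of "Suc n"] by (intro mult_left_mono powr_mono2') auto
      finally show "\<rho> w \<le> M\<^sup>2" by (simp add: M2)
    qed
    also have "cmod (z (Suc n) - z n) = x (Suc n)"
      using x(1)[of "Suc n"] unfolding z_def x(3)[of n] by (simp flip: of_real_diff)
    also have "M * x (Suc n) = sqrt K * x (Suc n) powr (c / 2)"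
      using x(1)[of "Suc n"] by (simp add: M_def powr_diff)
    also have "x (Suc n) powr (c / 2) \<le> x n powr (c / 2)"
      using x(1)[of "Suc n"] x(3)[of n] c by (intro powr_mono2) auto
    also have "x n powr (c / 2) = r powr (c / 2) * q ^ n"
      using r by (simp add: x_def powr_mult q_def powr_power powr_powr flip: powr_realpow) (simp add: mult.commute)
    finally show ?thesis using K by (simp add: B_def mult.assoc)
  qed
  \<comment> \<open>The exact partial sum of the geometric series is kept because it closes the
    induction, which a bound independent of \<open>k\<close> would not.\<close>
  have far: "torus_dist \<tau> \<rho> (\<sigma> n) (\<sigma> (n + k)) \<le> B * q ^ n * (1 - q ^ k) / (1 - q)" for n k
  proof (induction k)
    case 0
    show ?case using MS.mdist_zero range by (auto simp: image_subset_iff)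
  next
    case (Suc k)
    have "torus_dist \<tau> \<rho> (\<sigma> n) (\<sigma> (n + Suc k)) \<le>
        torus_dist \<tau> \<rho> (\<sigma> n) (\<sigma> (n + k)) + torus_dist \<tau> \<rho> (\<sigma> (n + k)) (\<sigma> (n + Suc k))"
      by (rule MS.triangle) (use range in auto)
    also have "\<dots> \<le> B * q ^ n * (1 - q ^ k) / (1 - q) + B * q ^ (n + k)"
      using Suc step[of "n + k"] by simp
    also have "\<dots> = B * q ^ n * (1 - q ^ Suc k) / (1 - q)"
      using q by (simp add: field_simps power_add)
    finally show ?case .
  qed
  have far': "torus_dist \<tau> \<rho> (\<sigma> n) (\<sigma> m) \<le> B / (1 - q) * q ^ n" if "n \<le> m" for n m
  proof -
    have "torus_dist \<tau> \<rho> (\<sigma> n) (\<sigma> (n + (m - n))) \<le> B * q ^ n * (1 - q ^ (m - n)) / (1 - q)" by (rule far)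
    also have "\<dots> \<le> B * q ^ n * 1 / (1 - q)"
      using B q by (intro divide_right_mono mult_left_mono) auto
    finally show ?thesis using that by simp
  qed
  have "MS.MCauchy \<sigma>"
    unfolding MS.MCauchy_def
  proof (intro conjI allI impI range)
    fix e :: real assume e: "0 < e"
    have "(\<lambda>n. B / (1 - q) * q ^ n) \<longlonglongrightarrow> B / (1 - q) * 0"
      using q by (intro tendsto_intros LIMSEQ_realpow_zero) auto
    then have "\<forall>\<^sub>F n in sequentially. B / (1 - q) * q ^ n < e"
      using e by (intro order_tendstoD(2)) auto
    then obtain N where N: "\<And>n. n \<ge> N \<Longrightarrow> B / (1 - q) * q ^ n < e"
      unfolding eventually_sequentially by blast
    show "\<exists>N. \<forall>n n'. N \<le> n \<longrightarrow> N \<le> n' \<longrightarrow> torus_dist \<tau> \<rho> (\<sigma> n) (\<sigma> n') < e"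
    proof (intro exI[of _ N] allI impI)
      fix n m assume "N \<le> n" "N \<le> m"
      then show "torus_dist \<tau> \<rho> (\<sigma> n) (\<sigma> m) < e"
        using far'[of n m] far'[of m n] N[of n] N[of m] MS.commute[of "\<sigma> n" "\<sigma> m"]
        by (cases "n \<le> m") auto
    qed
  qed
  then obtain A where A: "limitin MS.mtopology \<sigma> A sequentially"
    using complete unfolding MS.mcomplete_def by blast
  have AM: "A \<in> punctured_torus \<tau>" using A MS.limitin_mspace by blast
  then obtain a where a: "a \<notin> lattice \<tau>" "A = coset \<tau> a" by (auto simp: punctured_torus_eq)
  obtain d0 where d0: "d0 > 0" "cball a d0 \<subseteq> - lattice \<tau>"
    using open_compl a(1) open_contains_cball by (metis ComplI)
  \<comment> \<open>Half of the free radius: a point of the coset of \<open>z n\<close> within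
    \<open>d\<close> of \<open>a\<close> would, for |z n| < d, put a lattice point within
    \<open>d0\<close> of \<open>a\<close>.\<close>
  define d where "d = d0 / 2"
  have d: "d > 0" "d + d = d0" using d0(1) by (auto simp: d_def)
  have "cball a d \<subseteq> cball a d0" using d by (intro subset_cball) simp
  with d0(2) have d2: "cball a d \<subseteq> - lattice \<tau>" by (rule order_trans[rotated])
  obtain \<mu> where \<mu>: "\<mu> > 0" "\<And>z. z \<in> cball a d \<Longrightarrow> \<mu> \<le> sqrt (\<rho> z)"
    using sqrt_lower_on_cball[OF d2 d(1)] by blast
  have ge: "\<mu> * d \<le> torus_dist \<tau> \<rho> A (\<sigma> n)" if "x n < d" for n
  proof -
    have "ball a d \<inter> coset \<tau> (z n) = {}"
    proof (rule ccontr)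
      assume "ball a d \<inter> coset \<tau> (z n) \<noteq> {}"
      then obtain w where w: "w \<in> ball a d" "w - z n \<in> lattice \<tau>" by (auto simp: mem_coset_iff)
      have "dist a (w - z n) \<le> dist a w + dist w (w - z n)" by (rule dist_triangle)
      also have "dist w (w - z n) = x n" using x(1)[of n] by (simp add: dist_norm z_def)
      finally have "w - z n \<in> cball a d0" using w(1) \<open>x n < d\<close> d(2) by simp
      then show False using w(2) d0(2) by blast
    qed
    then have "ennreal (\<mu> * d) \<le> edist A (\<sigma> n)"
      unfolding a(2) \<sigma>_def using \<mu> d d2 by (intro edist_ge) auto
    moreover have "edist A (\<sigma> n) < top"
      unfolding a(2) \<sigma>_def z_def using x[of n] by (intro edist_finite a(1) nl) auto
    ultimately have "enn2real (ennreal (\<mu> * d)) \<le> enn2real (edist A (\<sigma> n))"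
      by (intro enn2real_mono) auto
    then show ?thesis using \<mu>(1) d(1) by (simp add: torus_dist_edist)
  qed
  have "x \<longlonglongrightarrow> r * 0"
    unfolding x_def[abs_def] by (intro tendsto_intros LIMSEQ_realpow_zero) auto
  then have "\<forall>\<^sub>F n in sequentially. x n < d" using d(1) by (intro order_tendstoD(2)) auto
  moreover have "\<forall>\<^sub>F n in sequentially. torus_dist \<tau> \<rho> (\<sigma> n) A < \<mu> * d"
  proof -
    have "\<forall>\<^sub>F n in sequentially. \<sigma> n \<in> punctured_torus \<tau> \<and> torus_dist \<tau> \<rho> (\<sigma> n) A < \<mu> * d"
      using A \<mu>(1) d(1) unfolding MS.limitin_metric by simp
    then show ?thesis by eventually_elim simp
  qed
  ultimately have "\<forall>\<^sub>F n in sequentially. False"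
  proof eventually_elim
    case (elim n)
    then show ?case using ge[of n] MS.commute[of A "\<sigma> n"] by simp
  qed
  then show False by simp
qed

end


section \<open>Behaviour of the metric at the puncture\<close>

lemma lattice_imag_iff:
  assumes "y > 0"
  shows "z \<in> lattice (\<i> * of_real y) \<longleftrightarrow> Re z \<in> \<int> \<and> Im z / y \<in> \<int>"
proof
  assume "z \<in> lattice (\<i> * of_real y)"
  then obtain m n :: int where "z = of_int m + of_int n * (\<i> * of_real y)"
    unfolding lattice_def by blast
  then show "Re z \<in> \<int> \<and> Im z / y \<in> \<int>" using assms by simp
next
  assume "Re z \<in> \<int> \<and> Im z / y \<in> \<int>"
  then obtain m n :: int where "Re z = of_int m" "Im z / y = of_int n" by (auto elim!: Ints_cases)
  then have "z = of_int m + of_int n * (\<i> * of_real y)"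
    using assms by (simp add: complex_eq_iff field_simps)
  then show "z \<in> lattice (\<i> * of_real y)" unfolding lattice_def by blast
qed

lemma open_compl_lattice:
  assumes "y > 0"
  shows "open (- lattice (\<i> * of_real y))"
proof -
  have "lattice (\<i> * of_real y) = Re -` \<int> \<inter> (\<lambda>z. Im z / y) -` \<int>"
    using lattice_imag_iff[OF assms] by auto
  moreover have "closed (Re -` \<int> \<inter> (\<lambda>z. Im z / y) -` \<int>)"
    using assms by (intro closed_Int closed_vimage closed_Ints continuous_intros) auto
  ultimately show ?thesis by (metis open_Compl)
qed

lemma lattice_norm_ge:
  assumes "y > 0" "z \<in> lattice (\<i> * of_real y)" "z \<noteq> 0"
  shows "cmod z \<ge> min 1 y"
proof -
  obtain m n :: int where mn: "Re z = of_int m" "Im z / y = of_int n"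
    using assms(2) unfolding lattice_imag_iff[OF assms(1)] by (auto elim!: Ints_cases)
  have "m \<noteq> 0 \<or> n \<noteq> 0" using mn assms(1,3) by (auto simp: complex_eq_iff)
  then show ?thesis
  proof
    assume "m \<noteq> 0"
    then have "\<bar>Re z\<bar> \<ge> 1" using mn(1) by linarith
    then show ?thesis using abs_Re_le_cmod[of z] by linarith
  next
    assume "n \<noteq> 0"
    then have "\<bar>Im z / y\<bar> \<ge> 1" using mn(2) by linarith
    then have "\<bar>Im z\<bar> \<ge> y" using assms(1) by (simp add: abs_divide field_simps)
    then show ?thesis using abs_Im_le_cmod[of z] by linarith
  qed
qed

text \<open>\<open>lap\<close> is Liouville's equation, that is, curvature -1 expressed through the
  logarithm of the density. Completeness stays outside the locale and reaches the estimates only as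
  a growth condition at the puncture.\<close>

locale hyperbolic_torus =
  fixes y :: real and \<rho> :: "complex \<Rightarrow> real"
  assumes y: "y > 0"
    and per: "z \<notin> lattice (\<i> * of_real y) \<Longrightarrow> w \<in> lattice (\<i> * of_real y) \<Longrightarrow> \<rho> (z + w) = \<rho> z"
    and pos: "z \<notin> lattice (\<i> * of_real y) \<Longrightarrow> \<rho> z > 0"
    and cont: "continuous_on (- lattice (\<i> * of_real y)) \<rho>"
    and lap: "z \<notin> lattice (\<i> * of_real y) \<Longrightarrow> \<exists>a b. has_lap (\<lambda>w. ln (\<rho> w)) a b (2 * \<rho> z) z"
begin

abbreviation "\<Lambda> \<equiv> lattice (\<i> * of_real y)"

text \<open>Ahlfors' form of the Schwarz lemma. On a smaller disc of radius R the quotient of \<rho>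
  by the hyperbolic density 4 R^2 / (R^2 - |z - p|^2)^2 attains its maximum, and the curvature
  equations at that point show that the maximum is at most 1.\<close>

lemma rho_le_ball:
  assumes "d > 0" "ball p d \<inter> \<Lambda> = {}"
  shows "\<rho> p \<le> 4 / d\<^sup>2"
proof -
  have "p \<in> ball p d" using assms(1) by simp
  then have pn: "p \<notin> \<Lambda>" using assms(2) by blast
  have main: "\<rho> p * R\<^sup>2 \<le> 4" if R: "0 < R" "R < d" for R
  proof -
    have sub: "cball p R \<subseteq> - \<Lambda>"
      using assms(2) R(2) by (auto simp: disjoint_iff)
    \<comment> \<open>The factor (q z)^2 vanishes on the circle of radius R and so forces the
      maximum of \<rho> (q z)^2 into the open disc.\<close>
    define q where "q z = R\<^sup>2 - (cmod (z - p))\<^sup>2" for z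
    have "continuous_on (cball p R) (\<lambda>z. \<rho> z * (q z)\<^sup>2)"
      unfolding q_def by (intro continuous_intros continuous_on_subset[OF cont sub])
    then obtain m where m: "m \<in> cball p R" "\<And>z. z \<in> cball p R \<Longrightarrow> \<rho> z * (q z)\<^sup>2 \<le> \<rho> m * (q m)\<^sup>2"
      using continuous_attains_sup[of "cball p R" "\<lambda>z. \<rho> z * (q z)\<^sup>2"] R(1) by auto
    have qp: "q p = R\<^sup>2" by (simp add: q_def)
    have le: "\<rho> p * (R\<^sup>2)\<^sup>2 \<le> \<rho> m * (q m)\<^sup>2" using m(2)[of p] R(1) by (simp add: qp)
    moreover have "\<rho> p * (R\<^sup>2)\<^sup>2 > 0" using pos[OF pn] R(1) by simp
    ultimately have "q m \<noteq> 0" by force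
    moreover have "q z \<ge> 0 \<longleftrightarrow> z \<in> cball p R" for z
      unfolding q_def using R(1) by (auto simp: dist_norm norm_minus_commute power2_le_iff_abs_le)
    ultimately have qm: "q m > 0" using m(1) by (metis order_le_neq_trans)
    have mn: "m \<notin> \<Lambda>" using sub m(1) by blast
    obtain a b where ab: "has_lap (\<lambda>w. ln (\<rho> w)) a b (2 * \<rho> m) m" using lap[OF mn] by blast
    have lq: "has_lap q (0 - 2 * Re (m - p)) (0 - 2 * Im (m - p)) (0 - 4) m"
      unfolding q_def[abs_def] by (intro has_lap_diff has_lap_const has_lap_norm_sq)
    define L where "L = - 1 * (2 * \<rho> m) - 2 * ((0 - 4) / q m - ((0 - 2 * Re (m - p))\<^sup>2 + (0 - 2 * Im (m - p))\<^sup>2) / (q m)\<^sup>2)"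
    have hl: "has_lap (\<lambda>z. - 1 * ln (\<rho> z) - 2 * ln (q z))
        (- 1 * a - 2 * ((0 - 2 * Re (m - p)) / q m)) (- 1 * b - 2 * ((0 - 2 * Im (m - p)) / q m)) L m"
      unfolding L_def by (intro has_lap_diff has_lap_cmult ab has_lap_ln[OF lq qm])
    have "\<forall>\<^sub>F z in nhds m. z \<in> ball p R"
    proof (rule eventually_nhds_in_open)
      have "cmod (m - p) < R" using qm R(1) unfolding q_def by (simp add: power2_less_imp_less)
      then show "m \<in> ball p R" by (simp add: dist_norm norm_minus_commute)
    qed simp
    then have "\<forall>\<^sub>F z in nhds m. - 1 * ln (\<rho> m) - 2 * ln (q m) \<le> - 1 * ln (\<rho> z) - 2 * ln (q z)"
    proof eventually_elim
      case (elim z)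
      then have zc: "z \<in> cball p R" by simp
      have qz: "q z > 0" unfolding q_def using elim R(1)
        by (auto simp: dist_norm norm_minus_commute intro!: power_strict_mono)
      have rz: "\<rho> z > 0" "\<rho> m > 0" using pos sub zc mn by auto
      have "ln (\<rho> z * (q z)\<^sup>2) \<le> ln (\<rho> m * (q m)\<^sup>2)"
        using m(2)[OF zc] rz qz by (intro ln_mono) auto
      then show ?case using rz qz qm by (simp add: ln_mult ln_realpow)
    qed
    from has_lap_local_min[OF hl this] have "L \<ge> 0" .
    have "(0 - 2 * Re (m - p))\<^sup>2 + (0 - 2 * Im (m - p))\<^sup>2 = 4 * (R\<^sup>2 - q m)"
      unfolding q_def cmod_power2 by (simp add: power2_eq_square algebra_simps)
    note eq = this
    from \<open>L \<ge> 0\<close> have "0 \<le> - 2 * \<rho> m - 2 * (- 4 / q m - 4 * (R\<^sup>2 - q m) / (q m)\<^sup>2)"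
      unfolding L_def eq by simp
    also have "\<dots> = (8 * R\<^sup>2 - 2 * \<rho> m * (q m)\<^sup>2) / (q m)\<^sup>2"
      using qm by (simp add: field_simps power2_eq_square)
    finally have "0 \<le> 8 * R\<^sup>2 - 2 * \<rho> m * (q m)\<^sup>2"
      using qm by (simp add: zero_le_divide_iff)
    then have "\<rho> m * (q m)\<^sup>2 \<le> 4 * R\<^sup>2" by simp
    with le have "(\<rho> p * R\<^sup>2) * R\<^sup>2 \<le> 4 * R\<^sup>2" by (simp add: power2_eq_square mult.assoc)
    then show ?thesis using R(1) by simp
  qed
  show ?thesis
  proof (rule ccontr)
    assume "\<not> ?thesis"
    then have "4 / d\<^sup>2 < \<rho> p" by simp
    then have "2\<^sup>2 < (sqrt (\<rho> p) * d)\<^sup>2"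
      using assms(1) pos[OF pn] by (simp add: power_mult_distrib field_simps)
    then have "2 < sqrt (\<rho> p) * d" by (rule power2_less_imp_less) (use assms(1) pos[OF pn] in simp)
    then have "2 / sqrt (\<rho> p) < d" using pos[OF pn] by (simp add: field_simps)
    \<comment> \<open>Replaces the limit of R to \<open>d\<close>: a failure at radius
      \<open>d\<close> is already a failure at some smaller radius.\<close>
    then obtain R where R: "2 / sqrt (\<rho> p) < R" "R < d" using dense by blast
    have "0 < 2 / sqrt (\<rho> p)" using pos[OF pn] by simp
    then have R0: "R > 0" using R(1) by linarith
    have "2 < sqrt (\<rho> p) * R" using R(1) pos[OF pn] by (simp add: field_simps)
    then have "2\<^sup>2 < (sqrt (\<rho> p) * R)\<^sup>2" by (intro power_strict_mono) auto
    then have "4 < \<rho> p * R\<^sup>2" using pos[OF pn] by (simp add: power_mult_distrib)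
    then show False using main[OF R0 R(2)] by simp
  qed
qed

section \<open>Growth of the density near the puncture\<close>

lemma not_in_lattice_small: "z \<noteq> 0 \<Longrightarrow> cmod z < min 1 y \<Longrightarrow> z \<notin> \<Lambda>"
  using lattice_norm_ge[OF y, of z] by fastforce

lemma rho_le_puncture:
  assumes "z \<noteq> 0" "cmod z \<le> min 1 y / 2"
  shows "\<rho> z \<le> 4 / (cmod z)\<^sup>2"
proof (rule rho_le_ball)
  show "cmod z > 0" using assms(1) by simp
  show "ball z (cmod z) \<inter> \<Lambda> = {}"
  proof (rule ccontr)
    assume "ball z (cmod z) \<inter> \<Lambda> \<noteq> {}"
    then obtain w where w: "cmod (z - w) < cmod z" "w \<in> \<Lambda>" by (auto simp: dist_norm)
    have "w \<noteq> 0" using w(1) by auto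
    then have "min 1 y \<le> cmod w" by (rule lattice_norm_ge[OF y w(2)])
    moreover have "cmod w \<le> cmod z + cmod (z - w)"
      using norm_triangle_ineq4[of z "z - w"] by simp
    ultimately show False using w(1) assms(2) by linarith
  qed
qed

text \<open>This function is nonnegative and superharmonic near the puncture, with Laplacian of the order of
  \<open>1 / \<bar>z\<bar>\<^sup>2\<close>, so Harnack's inequality holds on discs of radius \<open>\<bar>z\<bar> / 2\<close>.\<close>

definition defect :: "complex \<Rightarrow> real" where
  "defect z = ln 4 - ln (\<rho> z) - 2 * ln (cmod z)"

lemma defect_nonneg:
  assumes "z \<noteq> 0" "cmod z \<le> min 1 y / 2"
  shows "defect z \<ge> 0"
proof -
  have "z \<notin> \<Lambda>" using assms y by (intro not_in_lattice_small) auto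
  then have "ln (\<rho> z) \<le> ln (4 / (cmod z)\<^sup>2)"
    using rho_le_puncture[OF assms] pos by (intro ln_mono) auto
  then show ?thesis using assms(1) by (simp add: defect_def ln_div ln_realpow)
qed

lemma has_lap_ln_cmod: "z \<noteq> 0 \<Longrightarrow> \<exists>a b. has_lap (\<lambda>z. ln (cmod z)) a b 0 z"
  using has_lap_ln_norm[of UNIV z "\<lambda>z. z"] by auto

lemma has_lap_defect:
  assumes "z \<noteq> 0" "z \<notin> \<Lambda>"
  shows "\<exists>a b. has_lap defect a b (- 2 * \<rho> z) z"
proof -
  obtain a b where ab: "has_lap (\<lambda>w. ln (\<rho> w)) a b (2 * \<rho> z) z" using lap[OF assms(2)] by blast
  obtain c d where cd: "has_lap (\<lambda>w. ln (cmod w)) c d 0 z" using has_lap_ln_cmod[OF assms(1)] by blast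
  have "has_lap (\<lambda>z. ln 4 - ln (\<rho> z) - 2 * ln (cmod z)) (0 - a - 2 * c) (0 - b - 2 * d) (0 - 2 * \<rho> z - 2 * 0) z"
    by (intro has_lap_diff has_lap_cmult has_lap_const ab cd)
  then show ?thesis unfolding defect_def[abs_def] by auto
qed

lemma continuous_defect:
  assumes "S \<subseteq> - \<Lambda>" "0 \<notin> S"
  shows "continuous_on S defect"
proof -
  have "\<rho> z \<noteq> 0" "cmod z \<noteq> 0" if "z \<in> S" for z
    using pos[of z] that assms by auto
  then show ?thesis
    unfolding defect_def[abs_def]
    by (intro continuous_intros continuous_on_subset[OF cont assms(1)]) auto
qed

text \<open>On the disc of radius R = |p| / 2 about \<open>p\<close> every point has modulus at
  least R, so the Laplacian lies between - 8 / R^2 and 0. The loss (8 / R^2) R^2 / 4 = 2 is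
  independent of the scale.\<close>

lemma defect_Harnack:
  assumes "p \<noteq> 0" "cmod p \<le> min 1 y / 4" "cmod (q - p) \<le> cmod p / 4"
  shows "defect q \<ge> (defect p - 2) / 3"
proof -
  define R where "R = cmod p / 2"
  have R: "R > 0" using assms(1) by (simp add: R_def)
  have near: "z \<noteq> 0 \<and> cmod z \<le> min 1 y / 2 \<and> z \<notin> \<Lambda> \<and> R \<le> cmod z" if "z \<in> cball p R" for z
  proof -
    have d: "cmod (p - z) \<le> cmod p / 2" using that by (simp add: dist_norm R_def)
    have 1: "cmod p \<le> cmod z + cmod (p - z)" using norm_triangle_sub by blast
    have 2: "cmod z \<le> cmod p + cmod (p - z)" using norm_triangle_ineq4[of p "p - z"] by simp
    have "z \<noteq> 0" using 1 d R by (auto simp: R_def)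
    moreover have "cmod z \<le> min 1 y / 2" using 2 d assms(2) min_less_iff_conj[of 0 1 y] y by linarith
    ultimately show ?thesis using 1 d y not_in_lattice_small[of z] by (auto simp: R_def)
  qed
  have "defect q \<ge> (defect p - (8 / R\<^sup>2) * R\<^sup>2 / 4) / 3"
  proof (rule Harnack_superharmonic[OF R])
    show "continuous_on (cball p R) defect"
      by (rule continuous_defect) (use near[of 0] near in blast)+
    show "defect z \<ge> 0" if "z \<in> sphere p R" for z
      using defect_nonneg[of z] near[of z] that by simp
    show "\<exists>a b L. has_lap defect a b L z \<and> - (8 / R\<^sup>2) \<le> L \<and> L \<le> 0" if "z \<in> ball p R" for z
    proof -
      have n: "z \<noteq> 0" "cmod z \<le> min 1 y / 2" "z \<notin> \<Lambda>" "R \<le> cmod z" using near[of z] that by auto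
      have "\<rho> z \<le> 4 / (cmod z)\<^sup>2" by (rule rho_le_puncture[OF n(1,2)])
      also have "\<dots> \<le> 4 / R\<^sup>2" using R n(4) by (intro divide_left_mono power_mono mult_pos_pos) auto
      finally have "- (8 / R\<^sup>2) \<le> - 2 * \<rho> z" by simp
      moreover have "- 2 * \<rho> z \<le> 0" using pos[OF n(3)] by simp
      ultimately show ?thesis using has_lap_defect[OF n(1,3)] by blast
    qed
    show "cmod (q - p) \<le> R / 2" using assms(3) by (simp add: R_def)
  qed
  then show ?thesis using R by simp
qed

text \<open>Sixteen Harnack steps reach any point of the circle: a rotation by at most pi / 16 moves
  a point by less than a quarter of its modulus.\<close>

lemma defect_Harnack_circle:
  assumes "p \<noteq> 0" "cmod p \<le> min 1 y / 4" "cmod q = cmod p"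
  shows "defect q \<ge> (1 / 3) ^ 16 * defect p - 1"
proof -
  define \<theta> where "\<theta> = Arg (q / p)"
  define f where "f k = p * cis (\<theta> * real k / 16)" for k :: nat
  have nf: "cmod (f k) = cmod p" for k by (simp add: f_def norm_mult)
  have step: "cmod (f (Suc k) - f k) \<le> cmod p / 4" for k
  proof -
    have "f (Suc k) - f k = f k * (cis (\<theta> / 16) - 1)"
      unfolding f_def by (simp add: algebra_simps add_divide_distrib cis_mult)
    moreover have "cmod (cis (\<theta> / 16) - 1) \<le> 1 / 4"
    proof -
      have "cmod (cis (\<theta> / 16) - 1) \<le> \<bar>\<theta> / 16\<bar>"
        using dist_exp_i_1[of "\<theta> / 16"] abs_sin_x_le_abs_x[of "\<theta> / 16 / 2"]
        by (simp add: cis_conv_exp)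
      also have "\<dots> \<le> pi / 16"
        using Arg_bounded[of "q / p"] by (auto simp: \<theta>_def)
      also have "\<dots> \<le> 1 / 4" using pi_less_4 by simp
      finally show ?thesis .
    qed
    ultimately show ?thesis
      using mult_left_mono[of "cmod (cis (\<theta> / 16) - 1)" "1/4" "cmod p"] by (simp add: norm_mult nf)
  qed
  \<comment> \<open>The constant - 1 is the fixed point of x \<mapsto> (x - 2) / 3, so the additive
    loss does not accumulate along the chain.\<close>
  have ind: "defect (f k) \<ge> (1 / 3) ^ k * defect p - 1" for k
  proof (induction k)
    case 0
    show ?case by (simp add: f_def)
  next
    case (Suc k)
    have "f k \<noteq> 0" using nf[of k] assms(1) by force
    then have "defect (f (Suc k)) \<ge> (defect (f k) - 2) / 3"
      using assms(2) nf step by (intro defect_Harnack) auto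
    then show ?case using Suc by simp
  qed
  have "cmod (q / p) = 1" using assms(1,3) by (simp add: norm_divide)
  moreover from this have "q / p \<noteq> 0" by force
  ultimately have "cis \<theta> = q / p" unfolding \<theta>_def 
    using cis_Arg[of "q / p"] by (auto simp: sgn_div_norm)
  then have "f 16 = q" using assms(1) by (simp add: f_def)
  then show ?thesis using ind[of 16] by simp
qed

text \<open>If \<open>\<rho> z \<bar>z\<bar>\<close> stays small along a sequence tending to the puncture, then by Harnack it is small on
  whole circles, and comparison with \<open>c ln \<bar>z\<bar>\<close> on the annuli between them gives
  \<open>\<rho> \<le> K \<bar>z\<bar> powr (c - 2)\<close>: a ray of finite length runs into the puncture.\<close>

lemma rho_large_at_puncture:
  assumes noray: "\<And>r K c. 0 < r \<Longrightarrow> r < min 1 y \<Longrightarrow> 0 < c \<Longrightarrow> c \<le> 1 \<Longrightarrow> 0 < K \<Longrightarrow>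
      \<exists>z. z \<noteq> 0 \<and> cmod z \<le> r \<and> \<rho> z > K * cmod z powr (c - 2)"
  shows "\<exists>e>0. \<forall>z. z \<noteq> 0 \<longrightarrow> cmod z \<le> e \<longrightarrow> \<rho> z * cmod z \<ge> M"
proof (rule ccontr)
  assume "\<not> ?thesis"
  then have small: "\<exists>z. z \<noteq> 0 \<and> cmod z \<le> e \<and> \<rho> z * cmod z < M" if "e > 0" for e
    using that by (auto simp: not_le)
  define r where "r = min 1 y / 4"
  have r: "r > 0" "r < min 1 y" "r \<le> 1" using y by (auto simp: r_def)
  \<comment> \<open>The constant of the Harnack chain around a circle; it becomes the gain in the
    exponent c - 2.\<close>
  define c :: real where "c = (1 / 3) ^ 16"
  have c: "c > 0" "c \<le> 1" by (auto simp: c_def power_le_one)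
  have M: "M > 0"
  proof -
    obtain z where z: "z \<noteq> 0" "cmod z \<le> r" "\<rho> z * cmod z < M" using small[OF r(1)] by blast
    have "\<rho> z > 0" using z r by (intro pos not_in_lattice_small) auto
    then have "\<rho> z * cmod z > 0" using z(1) by simp
    then show ?thesis using z(3) by simp
  qed
  \<comment> \<open>The first entry serves the inner circle, where the term - c ln |p| of the
    Harnack bound cancels c ln |w|. The second serves the outer circle |w| = r, where the defect is
    merely nonnegative.\<close>
  define K where "K = max (1 - c * (ln 4 - ln M)) (- c * ln r)"
  have bound: "defect z + c * ln (cmod z) + K \<ge> 0" if z: "z \<noteq> 0" "cmod z < r" for z
  proof -
    \<comment> \<open>A point with small density strictly closer to the puncture than
      \<open>z\<close>; \<open>z\<close> then lies in the annulus between the circle through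
      \<open>p\<close> and the circle of radius \<open>r\<close>.\<close>
    obtain p where p: "p \<noteq> 0" "cmod p \<le> cmod z / 2" "\<rho> p * cmod p < M"
      using small[of "cmod z / 2"] z(1) by auto
    have pz: "cmod p < cmod z" "cmod p > 0" "cmod p < r"
    proof -
      have "cmod z > 0" using z(1) by simp
      then show "cmod p < cmod z" "cmod p < r" using p(2) z(2) by linarith+
      show "cmod p > 0" using p(1) by simp
    qed
    define D where "D = ball (0 :: complex) r - cball 0 (cmod p)"
    have near: "w \<noteq> 0 \<and> w \<notin> \<Lambda> \<and> cmod p \<le> cmod w \<and> cmod w \<le> r" if "w \<in> cball 0 r - ball 0 (cmod p)" for w
    proof -
      have "w \<noteq> 0" "cmod w \<le> r" using that pz(2) by auto
      then show ?thesis using that r not_in_lattice_small[of w] by auto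
    qed
    have cl: "closure D \<subseteq> cball 0 r - ball 0 (cmod p)"
      by (rule closure_minimal) (auto simp: D_def)
    have opD: "open D" unfolding D_def by (intro open_Diff) auto
    have "defect z + c * ln (cmod z) + K \<ge> 0"
    proof (rule nonneg_if_superharmonic[of D "\<lambda>w. defect w + c * ln (cmod w) + K"])
      show "bounded D" unfolding D_def by (rule bounded_diff) simp
      show "open D" by (rule opD)
      have nz: "w \<noteq> 0 \<and> w \<notin> \<Lambda>" if "w \<in> closure D" for w
        using near[OF subsetD[OF cl that]] by blast
      show "continuous_on (closure D) (\<lambda>w. defect w + c * ln (cmod w) + K)"
      proof (intro continuous_intros continuous_defect)
      qed (auto dest: nz)
      show "\<exists>a b L. has_lap (\<lambda>w. defect w + c * ln (cmod w) + K) a b L w \<and> L \<le> 0" if w: "w \<in> D" for w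
      proof -
        have wn: "w \<noteq> 0" "w \<notin> \<Lambda>" using near[of w] w by (auto simp: D_def)
        obtain a b where ab: "has_lap defect a b (- 2 * \<rho> w) w" using has_lap_defect[OF wn] by blast
        obtain e d where ed: "has_lap (\<lambda>w. ln (cmod w)) e d 0 w" using has_lap_ln_cmod[OF wn(1)] by blast
        have "has_lap (\<lambda>w. defect w + c * ln (cmod w) + K) (a + c * e + 0) (b + c * d + 0) (- 2 * \<rho> w + c * 0 + 0) w"
          by (intro has_lap_add has_lap_cmult has_lap_const ab ed)
        moreover have "- 2 * \<rho> w + c * 0 + 0 \<le> 0" using pos[OF wn(2)] by simp
        ultimately show ?thesis by blast
      qed
      show "z \<in> D" using z(2) pz(1) by (simp add: D_def)
      show "defect w + c * ln (cmod w) + K \<ge> 0" if w: "w \<in> frontier D" for w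
      proof -
        have wc: "w \<in> cball 0 r - ball 0 (cmod p)" using w cl by (auto simp: frontier_def)
        have "w \<notin> D" using w opD by (simp add: frontier_def interior_open)
        then consider "cmod w = r" | "cmod w = cmod p" using wc by (auto simp: D_def)
        then show ?thesis
        proof cases
          case 1
          have "defect w \<ge> 0" by (rule defect_nonneg) (use near[OF wc] r_def y in auto)
          then show ?thesis using 1 by (simp add: K_def)
        next
          case 2
          have "defect w \<ge> c * defect p - 1"
            unfolding c_def by (rule defect_Harnack_circle) (use p(1) pz(3) 2 in \<open>auto simp: r_def\<close>)
          moreover have "defect p \<ge> ln 4 - ln M - ln (cmod p)"
          proof -
            have "\<rho> p > 0" using near[of p] pz by (intro pos) auto
            then have "ln (\<rho> p) + ln (cmod p) = ln (\<rho> p * cmod p)"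
              using p(1) by (simp add: ln_mult)
            also have "\<dots> \<le> ln M" using p(1,3) \<open>\<rho> p > 0\<close> M by (intro ln_mono) auto
            finally show ?thesis by (simp add: defect_def)
          qed
          then have "c * defect p \<ge> c * (ln 4 - ln M - ln (cmod p))"
            using c(1) by (intro mult_left_mono) auto
          ultimately have "defect w + c * ln (cmod w) \<ge> c * (ln 4 - ln M) - 1"
            using 2 by (simp add: algebra_simps)
          then show ?thesis unfolding K_def by linarith
        qed
      qed
    qed
    then show ?thesis .
  qed
  have ub: "\<rho> z \<le> (4 * exp K) * cmod z powr (c - 2)" if z: "z \<noteq> 0" "cmod z \<le> r / 2" for z
  proof -
    have "z \<notin> \<Lambda>" using z r by (intro not_in_lattice_small) auto
    then have p: "\<rho> z > 0" by (rule pos)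
    have "ln (\<rho> z) \<le> ln 4 + K + (c - 2) * ln (cmod z)"
      using bound[of z] z r(1) by (simp add: defect_def algebra_simps)
    then have "exp (ln (\<rho> z)) \<le> exp (ln 4 + K + (c - 2) * ln (cmod z))" by simp
    then show ?thesis using p z(1) by (simp add: exp_add powr_def)
  qed
  have "\<exists>z. z \<noteq> 0 \<and> cmod z \<le> r / 2 \<and> \<rho> z > (4 * exp K) * cmod z powr (c - 2)"
    by (rule noray) (use r c in auto)
  then show False using ub by force
qed

end


section \<open>A subsolution on the strip\<close>

text \<open>A 1-periodic substitute for |z|: it vanishes to first order exactly at the integers, and
  its logarithm is harmonic elsewhere.\<close>

definition sine_norm :: "complex \<Rightarrow> real" where
  "sine_norm z = cmod (sin (of_real pi * z))"

lemma sine_norm_sq: "(sine_norm z)\<^sup>2 = (sin (pi * Re z))\<^sup>2 + (sinh (pi * Im z))\<^sup>2"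
proof -
  have "(sine_norm z)\<^sup>2 = (sin (pi * Re z) * cosh (pi * Im z))\<^sup>2 + (cos (pi * Re z) * sinh (pi * Im z))\<^sup>2"
    unfolding sine_norm_def cmod_power2 Re_sin Im_sin by (simp add: cosh_field_def sinh_field_def)
  also have "\<dots> = (sin (pi * Re z))\<^sup>2 * (sinh (pi * Im z) ^ 2 + 1) + (1 - (sin (pi * Re z))\<^sup>2) * (sinh (pi * Im z))\<^sup>2"
    unfolding power_mult_distrib cosh_square_eq cos_squared_eq ..
  finally show ?thesis by (simp add: algebra_simps)
qed

lemma cos_norm_sq: "(cmod (cos (of_real pi * z)))\<^sup>2 = (cos (pi * Re z))\<^sup>2 + (sinh (pi * Im z))\<^sup>2"
proof -
  have "(cmod (cos (of_real pi * z)))\<^sup>2 =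
      (cos (pi * Re z) * cosh (pi * Im z))\<^sup>2 + (- sin (pi * Re z) * sinh (pi * Im z))\<^sup>2"
    unfolding cmod_power2 Re_cos Im_cos by (simp add: cosh_field_def sinh_field_def algebra_simps)
  also have "\<dots> = (cos (pi * Re z))\<^sup>2 * (sinh (pi * Im z) ^ 2 + 1) + (1 - (cos (pi * Re z))\<^sup>2) * (sinh (pi * Im z))\<^sup>2"
    unfolding power_mult_distrib cosh_square_eq power2_minus sin_squared_eq ..
  finally show ?thesis by (simp add: algebra_simps)
qed

lemma sine_norm_nonneg: "sine_norm z \<ge> 0"
  by (simp add: sine_norm_def)

lemma sine_norm_eq_0_iff: "sine_norm z = 0 \<longleftrightarrow> Re z \<in> \<int> \<and> Im z = 0"
proof -
  have "sine_norm z = 0 \<longleftrightarrow> (sine_norm z)\<^sup>2 = 0" by simp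
  also have "\<dots> \<longleftrightarrow> sin (pi * Re z) = 0 \<and> sinh (pi * Im z) = 0"
    unfolding sine_norm_sq by (simp add: sum_power2_eq_zero_iff)
  also have "\<dots> \<longleftrightarrow> Re z \<in> \<int> \<and> Im z = 0"
    using sin_times_pi_eq_0[of "Re z"] by (simp add: mult.commute)
  finally show ?thesis .
qed

lemma sine_norm_le_cosh: "sine_norm z \<le> cosh (pi * Im z)"
proof (rule power2_le_imp_le)
  show "(sine_norm z)\<^sup>2 \<le> (cosh (pi * Im z))\<^sup>2"
    unfolding sine_norm_sq cosh_square_eq using sin_squared_eq[of "pi * Re z"] by simp
qed simp

lemma sine_norm_le_exp: "sine_norm z \<le> exp (pi * \<bar>Im z\<bar>)"
proof -
  have "sine_norm z \<le> cosh (pi * \<bar>Im z\<bar>)"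
    using sine_norm_le_cosh[of z] by (metis abs_mult abs_of_pos cosh_real_abs pi_gt_zero)
  also have "\<dots> \<le> exp (pi * \<bar>Im z\<bar>)"
    by (simp add: cosh_field_def)
  finally show ?thesis .
qed

lemma sine_norm_cnj: "sine_norm (Complex (Re z) (- Im z)) = sine_norm z"
proof (rule power2_eq_imp_eq)
  show "(sine_norm (Complex (Re z) (- Im z)))\<^sup>2 = (sine_norm z)\<^sup>2"
    unfolding sine_norm_sq by simp
qed (auto simp: sine_norm_nonneg)

lemma sine_norm_add_int: "n \<in> \<int> \<Longrightarrow> sine_norm (z + of_real n) = sine_norm z"
proof (rule power2_eq_imp_eq)
  assume "n \<in> \<int>"
  then obtain k :: int where k: "n = of_int k" by (auto elim: Ints_cases)
  have s0: "sin (pi * of_int k :: real) = 0"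
    using sin_times_pi_eq_0[of "of_int k"] by (simp add: mult.commute)
  then have "sin (pi * Re z + pi * n) = sin (pi * Re z) * cos (pi * of_int k)"
    unfolding k by (simp add: sin_add)
  moreover have "(cos (pi * of_int k :: real))\<^sup>2 = 1"
    unfolding cos_squared_eq s0 by simp
  ultimately have "(sin (pi * Re z + pi * n))\<^sup>2 = (sin (pi * Re z))\<^sup>2"
    by (simp add: power_mult_distrib)
  then show "(sine_norm (z + of_real n))\<^sup>2 = (sine_norm z)\<^sup>2"
    unfolding sine_norm_sq by (simp add: distrib_left)
qed (auto simp: sine_norm_nonneg)

lemma has_lap_Im_sq: "has_lap (\<lambda>z. (Im z)\<^sup>2) 0 (2 * Im z) 2 z"
proof -
  have "has_deriv2 (\<lambda>x. x\<^sup>2) (2 * Im z) 2 (Im z)"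
    by (rule has_deriv2I[of UNIV _ _ "\<lambda>x. 2 * x"]) (auto intro!: derivative_eq_intros)
  then show ?thesis unfolding has_lap_def using has_deriv2_const[of "(Im z)\<^sup>2"] by (intro exI) auto
qed

text \<open>The gradient is read off the logarithmic derivative pi cot (pi z). Its vertical
  component will give the slope at the seam, its length the curvature estimate.\<close>

lemma has_lap_ln_sine_norm:
  assumes "sine_norm z \<noteq> 0"
  shows "\<exists>a. has_lap (\<lambda>z. ln (sine_norm z)) a (pi * sinh (pi * Im z) * cosh (pi * Im z) / (sine_norm z)\<^sup>2) 0 z \<and>
    a\<^sup>2 + (pi * sinh (pi * Im z) * cosh (pi * Im z) / (sine_norm z)\<^sup>2)\<^sup>2 =
      pi\<^sup>2 * (cmod (cos (of_real pi * z)))\<^sup>2 / (sine_norm z)\<^sup>2"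
proof -
  define g :: "complex \<Rightarrow> complex" where "g = (\<lambda>z. sin (of_real pi * z))"
  have dg: "(g has_field_derivative (of_real pi * cos (of_real pi * z))) (at z)" for z
    unfolding g_def by (auto intro!: derivative_eq_intros)
  then have dg': "deriv g z = of_real pi * cos (of_real pi * z)" by (rule DERIV_imp_deriv)
  have gz: "g z \<noteq> 0" using assms by (simp add: g_def sine_norm_def)
  define c where "c = deriv g z / g z"
  have "g holomorphic_on UNIV" unfolding g_def by (intro holomorphic_intros)
  from has_lap_ln_norm[OF open_UNIV UNIV_I this gz]
  have hl: "has_lap (\<lambda>z. ln (sine_norm z)) (Re c) (- Im c) 0 z"
    by (simp add: c_def g_def sine_norm_def[abs_def])
  have "- Im c = pi * sinh (pi * Im z) * cosh (pi * Im z) / (sine_norm z)\<^sup>2"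
  proof -
    have "cos (of_real pi * z) / g z = cos (of_real pi * z) * cnj (g z) / of_real ((sine_norm z)\<^sup>2)"
      unfolding sine_norm_def g_def[symmetric] complex_div_cnj[of _ "g z"] by (simp add: g_def)
    moreover have "Im (cos (of_real pi * z) * cnj (g z)) =
        - (cosh (pi * Im z) * sinh (pi * Im z) * ((sin (pi * Re z))\<^sup>2 + (cos (pi * Re z))\<^sup>2))"
    proof -
      have "Re (sin w) = sin (Re w) * cosh (Im w)" "Im (sin w) = cos (Re w) * sinh (Im w)"
        "Re (cos w) = cos (Re w) * cosh (Im w)" "Im (cos w) = - (sin (Re w) * sinh (Im w))" for w
        unfolding Re_sin Im_sin Re_cos Im_cos by (simp_all add: cosh_field_def sinh_field_def field_simps)
      then show ?thesis
        unfolding g_def by (simp add: power2_eq_square algebra_simps del: sin_cos_squared_add3)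
    qed
    ultimately have "Im (cos (of_real pi * z) / g z) = - (cosh (pi * Im z) * sinh (pi * Im z)) / (sine_norm z)\<^sup>2"
      by (simp only: Im_divide_of_real sin_cos_squared_add mult_1_right)
    moreover have "c = of_real pi * (cos (of_real pi * z) / g z)" by (simp add: c_def dg')
    ultimately show ?thesis by (simp only: Im_complex_of_real Re_complex_of_real times_complex.simps) simp
  qed
  moreover have "(Re c)\<^sup>2 + (- Im c)\<^sup>2 = pi\<^sup>2 * (cmod (cos (of_real pi * z)))\<^sup>2 / (sine_norm z)\<^sup>2"
  proof -
    have "(Re c)\<^sup>2 + (- Im c)\<^sup>2 = (cmod c)\<^sup>2" by (simp add: cmod_power2)
    moreover have "cmod c = pi * cmod (cos (of_real pi * z)) / sine_norm z"
      unfolding c_def dg' by (simp add: g_def sine_norm_def norm_divide norm_mult)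
    ultimately show ?thesis by (simp add: power_divide power_mult_distrib)
  qed
  ultimately show ?thesis using hl by metis
qed

text \<open>A subsolution with a cone singularity at \<open>0\<close>: its Laplacian dominates \<open>2 * exp\<close> of it on the strip
  \<open>\<bar>Im z\<bar> \<le> y / 2\<close>, and its \<open>y\<close>-periodic extension has only convex kinks. The kinks are convex because
  \<open>7 / 5 < (pi / 2) * tanh (pi / 2)\<close>, and \<open>14 / 11\<close> is \<open>(7 / 5) / (1 + 1 / 10)\<close>, the value forced by the
  curvature inequality at \<open>sine_norm z = 1\<close>, where the gradient of \<open>sine_norm\<close> may vanish.\<close>

definition cone_sub :: "real \<Rightarrow> complex \<Rightarrow> real" where
  "cone_sub y z = ln (14 / 11) - 2 * ln y + 7 / 5 * ((Im z)\<^sup>2 / y\<^sup>2 - 1 / 4) +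
     (1 - 1 / (2 * y)) * ln (1 / 10 + exp (ln (sine_norm z))) - ln (sine_norm z)"

lemma has_lap_cone_sub:
  assumes "sine_norm z \<noteq> 0" "y > 0"
  defines "r \<equiv> sine_norm z"
  shows "\<exists>a. has_lap (cone_sub y) a
    (14 / 5 * Im z / y\<^sup>2 - (1 - (1 - 1 / (2 * y)) * (r / (1 / 10 + r))) *
       (pi * sinh (pi * Im z) * cosh (pi * Im z) / r\<^sup>2))
    (14 / (5 * y\<^sup>2) + (1 - 1 / (2 * y)) / 10 * pi\<^sup>2 * (cmod (cos (of_real pi * z)))\<^sup>2 / (r * (1 / 10 + r)\<^sup>2)) z"
proof -
  define \<beta> where "\<beta> = 1 - 1 / (2 * y)"
  define b where "b = pi * sinh (pi * Im z) * cosh (pi * Im z) / r\<^sup>2"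
  define C where "C = (cmod (cos (of_real pi * z)))\<^sup>2"
  obtain a where a: "has_lap (\<lambda>z. ln (sine_norm z)) a b 0 z" "a\<^sup>2 + b\<^sup>2 = pi\<^sup>2 * C / r\<^sup>2"
    using has_lap_ln_sine_norm[OF assms(1)] unfolding b_def C_def r_def by blast
  have r: "r > 0" using assms(1) sine_norm_nonneg[of z] by (simp add: r_def)
  have e: "exp (ln (sine_norm z)) = r" using r by (simp add: r_def)
  \<comment> \<open>\<open>cone_sub\<close> writes \<open>sine_norm\<close> as the exponential of
    its logarithm precisely so that this term is \<open>h\<close> composed with a harmonic function;
    its Laplacian is then the second derivative of \<open>h\<close> times the squared
    gradient.\<close>
  define h where "h w = ln (1 / 10 + exp w)" for w :: real
  have "has_deriv2 h (r / (1 / 10 + r)) (r / 10 / (1 / 10 + r)\<^sup>2) (ln (sine_norm z))"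
  proof (rule has_deriv2I[of UNIV])
    have p: "(1 / 10 + exp t :: real) > 0" for t by (simp add: add_pos_pos)
    then have nz: "(1 / 10 + exp t :: real) \<noteq> 0" for t by (metis less_irrefl)
    show "(h has_real_derivative exp t / (1 / 10 + exp t)) (at t)" for t
      unfolding h_def using p[of t] by (auto intro!: derivative_eq_intros)
    have "((\<lambda>t. exp t / (1 / 10 + exp t)) has_real_derivative
        (exp t * (1 / 10 + exp t) - exp t * exp t) / ((1 / 10 + exp t) * (1 / 10 + exp t))) (at t)" for t :: real
      using nz[of t] by (auto intro!: derivative_eq_intros)
    from this[of "ln (sine_norm z)"] show "((\<lambda>t. exp t / (1 / 10 + exp t)) has_real_derivative
        r / 10 / (1 / 10 + r)\<^sup>2) (at (ln (sine_norm z)))"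
      unfolding e by (simp add: power2_eq_square algebra_simps)
  qed (auto simp: e)
  from has_lap_compose[OF a(1) this]
  have h: "has_lap (\<lambda>z. h (ln (sine_norm z))) (r / (1 / 10 + r) * a) (r / (1 / 10 + r) * b)
      (r / 10 / (1 / 10 + r)\<^sup>2 * (pi\<^sup>2 * C / r\<^sup>2)) z"
    unfolding a(2) by simp
  have "cone_sub y = (\<lambda>z. (ln (14 / 11) - 2 * ln y - 7 / 20) + 7 / (5 * y\<^sup>2) * (Im z)\<^sup>2 +
      \<beta> * h (ln (sine_norm z)) - ln (sine_norm z))"
    unfolding cone_sub_def[abs_def] h_def \<beta>_def by (auto simp: algebra_simps)
  moreover have "has_lap (\<lambda>z. (ln (14 / 11) - 2 * ln y - 7 / 20) + 7 / (5 * y\<^sup>2) * (Im z)\<^sup>2 +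
      \<beta> * h (ln (sine_norm z)) - ln (sine_norm z))
      (0 + 7 / (5 * y\<^sup>2) * 0 + \<beta> * (r / (1 / 10 + r) * a) - a)
      (0 + 7 / (5 * y\<^sup>2) * (2 * Im z) + \<beta> * (r / (1 / 10 + r) * b) - b)
      (0 + 7 / (5 * y\<^sup>2) * 2 + \<beta> * (r / 10 / (1 / 10 + r)\<^sup>2 * (pi\<^sup>2 * C / r\<^sup>2)) - 0) z"
    by (intro has_lap_diff has_lap_add has_lap_cmult has_lap_const h a(1) has_lap_Im_sq)
  moreover have "0 + 7 / (5 * y\<^sup>2) * (2 * Im z) + \<beta> * (r / (1 / 10 + r) * b) - b =
      14 / 5 * Im z / y\<^sup>2 - (1 - \<beta> * (r / (1 / 10 + r))) * b"
    by (simp add: algebra_simps)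
  moreover have "0 + 7 / (5 * y\<^sup>2) * 2 + \<beta> * (r / 10 / (1 / 10 + r)\<^sup>2 * (pi\<^sup>2 * C / r\<^sup>2)) - 0 =
      14 / (5 * y\<^sup>2) + \<beta> / 10 * pi\<^sup>2 * C / (r * (1 / 10 + r)\<^sup>2)"
    using r by (simp add: power2_eq_square mult_ac)
  ultimately have "\<exists>a. has_lap (cone_sub y) a (14 / 5 * Im z / y\<^sup>2 - (1 - \<beta> * (r / (1 / 10 + r))) * b)
      (14 / (5 * y\<^sup>2) + \<beta> / 10 * pi\<^sup>2 * C / (r * (1 / 10 + r)\<^sup>2)) z"
    by metis
  then show ?thesis unfolding \<beta>_def b_def C_def .
qed

text \<open>The curvature inequality for u < 1, where u = 1 / 10 + \<open>sine_norm z\<close>,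
  multiplied by u^2. The number 49 / 100 is (1 / 2) (1 / 10) (49 / 5), the product of lower bounds
  for y^2 (1 - 1 / (2 y)) and pi^2 with the constant 1 / 10.\<close>

lemma cubic_bound:
  fixes u :: real
  assumes "0 \<le> u" "u \<le> 1"
  shows "14 / 11 * (1 + u) * u\<^sup>2 \<le> 14 / 5 * (u - 1 / 10) * u\<^sup>2 + 49 / 100 * (1 - (u - 1 / 10)\<^sup>2)"
proof -
  \<comment> \<open>867 / 1000 approximates the minimiser of right side minus left side on the unit
    interval. The square times a linear factor reproduces the cubic up to a remainder that is
    positive there.\<close>
  have 1: "0 \<le> (u - 867 / 1000)\<^sup>2 * (84 / 55 * u + 3 / 5)" using assms by simp
  have 2: "(u - 867 / 1000)\<^sup>2 * (84 / 55 * u + 3 / 5) =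
      84 / 55 * (u * u * u) - 14082 / 6875 * (u * u) + 1479969 / 13750000 * u + 2255067 / 5000000"
    by (simp add: power2_eq_square field_simps)
  have 3: "14 / 5 * (u - 1 / 10) * u\<^sup>2 + 49 / 100 * (1 - (u - 1 / 10)\<^sup>2) - 14 / 11 * (1 + u) * u\<^sup>2 =
      84 / 55 * (u * u * u) - 2247 / 1100 * (u * u) + 49 / 500 * u + 4851 / 10000"
    by (simp add: power2_eq_square field_simps)
  have "0 \<le> u * u" by simp
  then have "0 \<le> 14 / 5 * (u - 1 / 10) * u\<^sup>2 + 49 / 100 * (1 - (u - 1 / 10)\<^sup>2) - 14 / 11 * (1 + u) * u\<^sup>2"
    using 1 assms unfolding 2 3 by linarith
  then show ?thesis by simp
qed

text \<open>After multiplication by y^2 r the claim becomes \<open>key\<close>. The quadratic term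
  of \<open>cone_sub\<close> supplies 14 / 5 r, enough on its own once r \<ge> 1; for smaller r the
  gradient term compensates, since C \<ge> 1 - r^2.\<close>

lemma cone_sub_curvature:
  assumes z: "sine_norm z \<noteq> 0" and y: "y \<ge> 1" "\<bar>Im z\<bar> \<le> y / 2"
  shows "\<exists>a b L. has_lap (cone_sub y) a b L z \<and> 2 * exp (cone_sub y z) \<le> L"
proof -
  define r where "r = sine_norm z"
  define u where "u = 1 / 10 + r"
  define \<beta> where "\<beta> = 1 - 1 / (2 * y)"
  define C where "C = (cmod (cos (of_real pi * z)))\<^sup>2"
  have r: "r > 0" using z sine_norm_nonneg[of z] by (simp add: r_def)
  have u: "u > 0" using r by (simp add: u_def)
  have \<beta>: "1 / 2 \<le> \<beta>" "\<beta> \<le> 1" using y(1) by (auto simp: \<beta>_def field_simps)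
  have "C \<ge> 1 - r\<^sup>2"
    unfolding C_def r_def cos_norm_sq sine_norm_sq cos_squared_eq by simp
  then have C: "C \<ge> 0" "C \<ge> 1 - r\<^sup>2" by (auto simp: C_def)
  have y\<beta>: "y\<^sup>2 * \<beta> \<ge> 1 / 2"
  proof -
    have "y\<^sup>2 * \<beta> = y * (y - 1 / 2)" using y(1) by (simp add: \<beta>_def power2_eq_square field_simps)
    moreover have "1 * (1 / 2) \<le> y * (y - 1 / 2)" using y(1) by (intro mult_mono) auto
    ultimately show ?thesis by simp
  qed
  have pi2: "pi\<^sup>2 \<ge> 49 / 5"
  proof -
    have "(3.14 :: real)\<^sup>2 \<le> pi\<^sup>2" using pi_approx by (intro power_mono) auto
    then show ?thesis by (simp add: power2_eq_square)
  qed
  define P where "P = \<beta> * ln u"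
  have key: "28 / 11 * exp P \<le> 14 / 5 * r + y\<^sup>2 * \<beta> / 10 * pi\<^sup>2 * C / u\<^sup>2"
  proof (cases "u \<ge> 1")
    case True
    have "P \<le> 1 * ln u" unfolding P_def using True \<beta> by (intro mult_right_mono) auto
    then have "exp P \<le> exp (ln u)" by simp
    then have ex: "exp P \<le> u" using u by simp
    show ?thesis
    proof (cases "r \<ge> 1")
      case True
      \<comment> \<open>Here u \<le> (11 / 10) r, and (28 / 11) (11 / 10) = 14 / 5 leaves no slack
        at r = 1.\<close>
      have "28 / 11 * exp P \<le> 14 / 5 * r" using ex True by (simp add: u_def)
      moreover have "0 \<le> y\<^sup>2 * \<beta> / 10 * pi\<^sup>2 * C / u\<^sup>2" using \<beta> C by simp
      ultimately show ?thesis by linarith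
    next
      case False
      then have C': "0 \<le> (1 - r) * (1 + r)" "(1 - r) * (1 + r) \<le> C"
        using C(2) r mult_nonneg_nonneg[of "1 - r" "1 + r"] by (simp_all add: power2_eq_square algebra_simps)
      have "u\<^sup>2 \<le> 2" using False r power_mono[of u "11/10" 2] by (simp add: u_def power2_eq_square)
      have "28 / 11 * exp P - 14 / 5 * r \<le> 14 / 55 * (1 - r)" using ex by (simp add: u_def)
      also have "\<dots> \<le> 49 / 100 * ((1 - r) * (1 + r)) / 2"
      proof -
        have "(1 - r) * (19 / 10) \<le> (1 - r) * (1 + r)"
          using False \<open>1 \<le> u\<close> by (intro mult_left_mono) (auto simp: u_def)
        then have "14 / 55 * (1 - r) \<le> 49 / 200 * ((1 - r) * (1 + r))"
          using False mult_left_mono[of "(1 - r) * (19 / 10)" "(1 - r) * (1 + r)" "49 / 200"] by simp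
        then show ?thesis by simp
      qed
      also have "\<dots> \<le> 49 / 100 * ((1 - r) * (1 + r)) / u\<^sup>2"
        using \<open>u\<^sup>2 \<le> 2\<close> u C'(1) by (intro divide_left_mono) auto
      also have "\<dots> \<le> y\<^sup>2 * \<beta> / 10 * pi\<^sup>2 * C / u\<^sup>2"
      proof (intro divide_right_mono)
        have "1 / 2 / 10 * (49 / 5) * ((1 - r) * (1 + r)) \<le> y\<^sup>2 * \<beta> / 10 * pi\<^sup>2 * C"
          using y\<beta> pi2 C' \<beta> by (intro mult_mono) auto
        then show "49 / 100 * ((1 - r) * (1 + r)) \<le> y\<^sup>2 * \<beta> / 10 * pi\<^sup>2 * C" by simp
      qed simp
      finally show ?thesis by linarith
    qed
  next
    case False
    \<comment> \<open>For u < 1 the logarithm is negative, so the smallest exponent 1 / 2 is the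
      worst. It gives sqrt u, which is replaced by the tangent (1 + u) / 2.\<close>
    have "P \<le> 1 / 2 * ln u" unfolding P_def using False u \<beta> by (intro mult_right_mono_neg) auto
    then have "exp P \<le> exp (1 / 2 * ln u)" by simp
    also have "\<dots> = sqrt u" using u by (simp add: powr_half_sqrt[symmetric] powr_def)
    also have "\<dots> \<le> (1 + u) / 2" using arith_geo_mean_sqrt[of 1 u] u by simp
    finally have "28 / 11 * exp P \<le> 14 / 11 * (1 + u)" by simp
    also have "\<dots> \<le> 14 / 5 * r + 49 / 100 * (1 - r\<^sup>2) / u\<^sup>2"
    proof -
      have "14 / 11 * (1 + u) * u\<^sup>2 \<le> 14 / 5 * r * u\<^sup>2 + 49 / 100 * (1 - r\<^sup>2)"
        using cubic_bound[of u] u False by (simp add: u_def)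
      then show ?thesis using u by (simp add: field_simps)
    qed
    also have "49 / 100 * (1 - r\<^sup>2) / u\<^sup>2 \<le> y\<^sup>2 * \<beta> / 10 * pi\<^sup>2 * C / u\<^sup>2"
    proof (intro divide_right_mono)
      have "r \<le> 1" using False by (simp add: u_def)
      then have "r\<^sup>2 \<le> 1" using r by (simp add: power_le_one)
      then have "1 / 2 / 10 * (49 / 5) * (1 - r\<^sup>2) \<le> y\<^sup>2 * \<beta> / 10 * pi\<^sup>2 * C"
        using y\<beta> pi2 C \<beta> by (intro mult_mono) auto
      then show "49 / 100 * (1 - r\<^sup>2) \<le> y\<^sup>2 * \<beta> / 10 * pi\<^sup>2 * C" by simp
    qed simp
    finally show ?thesis by simp
  qed
  have "cone_sub y z = ln (14 / 11) - ln (y\<^sup>2) + 7 / 5 * ((Im z)\<^sup>2 / y\<^sup>2 - 1 / 4) + P - ln r"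
    using r y(1) by (simp add: cone_sub_def P_def \<beta>_def u_def r_def ln_realpow)
  moreover have "7 / 5 * ((Im z)\<^sup>2 / y\<^sup>2 - 1 / 4) \<le> 0"
  proof -
    have "\<bar>Im z\<bar>\<^sup>2 \<le> (y / 2)\<^sup>2" using y(2) by (intro power_mono) auto
    then show ?thesis using y(1) by (simp add: power_divide field_simps)
  qed
  ultimately have "exp (cone_sub y z) \<le> exp (ln (14 / 11) - ln (y\<^sup>2) + P - ln r)" by simp
  also have "\<dots> = 14 / 11 * exp P / (y\<^sup>2 * r)" using r y(1) by (simp add: exp_add exp_diff)
  finally have "2 * exp (cone_sub y z) \<le> 28 / 11 * exp P / (y\<^sup>2 * r)" by simp
  also have "\<dots> \<le> (14 / 5 * r + y\<^sup>2 * \<beta> / 10 * pi\<^sup>2 * C / u\<^sup>2) / (y\<^sup>2 * r)"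
    using key r by (intro divide_right_mono) auto
  also have "\<dots> = 14 / (5 * y\<^sup>2) + \<beta> / 10 * pi\<^sup>2 * C / (r * u\<^sup>2)"
    using r y(1) u by (simp add: field_simps)
  finally show ?thesis
    using has_lap_cone_sub[OF z, of y] y(1) unfolding r_def u_def \<beta>_def C_def by auto
qed

text \<open>19 is the value that yields tanh (pi / 2) \<ge> (19 - 1) / (19 + 1) = 9 / 10.\<close>

lemma exp_pi_ge: "exp pi \<ge> 19"
proof -
  have "(1 + 3/8 + (3/8)\<^sup>2 / 2 :: real) ^ 8 \<le> exp (3/8) ^ 8"
    by (intro power_mono exp_lower_Taylor_quadratic) auto
  also have "\<dots> = exp 3" by (simp flip: exp_of_nat_mult)
  also have "\<dots> \<le> exp pi" using pi_gt3 by simp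
  finally show ?thesis by (simp add: power2_eq_square field_simps)
qed

text \<open>At the upper edge the quadratic term has slope 7 / (5 y), while the logarithmic terms
  contribute less than - (pi / 2) (9 / 10) / y up to equality, and 7 / 5 < 9 pi / 20. A negative
  slope there makes the kink of the reflected extension convex.\<close>

lemma cone_sub_slope:
  assumes z: "sine_norm z \<noteq> 0" and y: "y \<ge> 1" "Im z = y / 2"
  shows "\<exists>a b L. has_lap (cone_sub y) a b L z \<and> b < 0"
proof -
  define r where "r = sine_norm z"
  define t where "t = pi * Im z"
  have r: "r > 0" using z sine_norm_nonneg[of z] by (simp add: r_def)
  have t: "t > 0" using y by (simp add: t_def)
  have "19 \<le> exp (2 * t)"
  proof -
    have "exp pi \<le> exp (2 * t)" using y by (simp add: t_def)
    then show ?thesis using exp_pi_ge by linarith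
  qed
  then have "19 * exp (- t) \<le> exp (2 * t) * exp (- t)" by (intro mult_right_mono) auto
  also have "\<dots> = exp t" by (simp flip: exp_add)
  finally have "9 * cosh t \<le> 10 * sinh t" by (simp add: cosh_field_def sinh_field_def field_simps)
  moreover have ch: "cosh t > 0" by simp
  ultimately have "9 / 10 * (cosh t * cosh t) \<le> sinh t * cosh t" by (simp add: mult_right_mono)
  moreover have "r\<^sup>2 \<le> cosh t * cosh t"
    using power_mono[OF sine_norm_le_cosh[of z] sine_norm_nonneg, of 2]
    by (simp add: r_def t_def power2_eq_square)
  ultimately have "9 / 10 * r\<^sup>2 \<le> sinh t * cosh t" by linarith
  then have q: "9 / 10 \<le> sinh t * cosh t / r\<^sup>2" using r by (simp add: field_simps)
  define F where "F = 1 - (1 - 1 / (2 * y)) * (r / (1 / 10 + r))"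
  have "(1 - 1 / (2 * y)) * (r / (1 / 10 + r)) \<le> (1 - 1 / (2 * y)) * 1"
    using y(1) r by (intro mult_left_mono) auto
  then have F: "1 / (2 * y) \<le> F" by (simp add: F_def)
  have "14 / 5 * Im z / y\<^sup>2 = 7 / 5 / y" using y(1) unfolding y(2) by (simp add: power2_eq_square)
  also have "\<dots> < pi * (9 / 10) * (1 / (2 * y))"
    using y(1) pi_approx by (simp add: field_simps)
  also have "\<dots> \<le> pi * (sinh t * cosh t / r\<^sup>2) * F"
  proof (intro mult_mono mult_left_mono mult_nonneg_nonneg q F)
    show "0 \<le> sinh t * cosh t / r\<^sup>2" using q by linarith
  qed (use y(1) in auto)
  finally have "14 / 5 * Im z / y\<^sup>2 - F * (pi * sinh t * cosh t / r\<^sup>2) < 0"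
    by (simp add: algebra_simps)
  moreover obtain a L where "has_lap (cone_sub y) a (14 / 5 * Im z / y\<^sup>2 - F * (pi * sinh t * cosh t / r\<^sup>2)) L z"
    using has_lap_cone_sub[OF z, of y] y(1) unfolding F_def r_def t_def by auto
  ultimately show ?thesis by blast
qed

text \<open>Put t = |Im z| / y. The cone factor is at least r^(-1 / (2 y)) \<ge> exp (- (pi / 2) t),
  which exceeds its seam value exp (- pi / 4) by the exponent (pi / 2) (1 / 2 - t). This pays for
  the loss (7 / 5) (1 / 4 - t^2) in the quadratic term because 7 / 5 < pi / 2.\<close>

lemma cone_sub_lower:
  assumes z: "sine_norm z \<noteq> 0" and y: "y \<ge> 1" "\<bar>Im z\<bar> \<le> y / 2"
  shows "exp (cone_sub y z) \<ge> 14 / 11 * exp (- pi / 4) / y\<^sup>2"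
proof -
  define r where "r = sine_norm z"
  define \<tau> where "\<tau> = \<bar>Im z\<bar> / y"
  have r: "r > 0" using z sine_norm_nonneg[of z] by (simp add: r_def)
  have \<tau>: "0 \<le> \<tau>" "\<tau> \<le> 1 / 2" using y by (auto simp: \<tau>_def field_simps)
  have "ln r \<le> ln (exp (pi * \<bar>Im z\<bar>))"
    using sine_norm_le_exp[of z] r by (intro ln_mono) (auto simp: r_def)
  then have "1 / (2 * y) * ln r \<le> 1 / (2 * y) * (pi * \<bar>Im z\<bar>)" using y(1) by (intro mult_left_mono) auto
  also have "\<dots> = pi / 2 * \<tau>" by (simp add: \<tau>_def)
  finally have 1: "1 / (2 * y) * ln r \<le> pi / 2 * \<tau>" .
  have "(1 - 1 / (2 * y)) * ln (1 / 10 + r) \<ge> (1 - 1 / (2 * y)) * ln r"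
    using y(1) r by (intro mult_left_mono ln_mono) auto
  then have 2: "(1 - 1 / (2 * y)) * ln (1 / 10 + r) - ln r \<ge> - (pi / 2 * \<tau>)"
    using 1 by (simp add: algebra_simps)
  have "(Im z)\<^sup>2 / y\<^sup>2 = \<tau>\<^sup>2" by (simp add: \<tau>_def power_divide)
  moreover have "7 / 5 * (1 / 4 - \<tau>\<^sup>2) \<le> pi / 2 * (1 / 2 - \<tau>)"
  proof -
    have "7 / 5 * (1 / 4 - \<tau>\<^sup>2) = (7 / 5 * (1 / 2 + \<tau>)) * (1 / 2 - \<tau>)"
      by (simp add: power2_eq_square field_simps)
    also have "\<dots> \<le> pi / 2 * (1 / 2 - \<tau>)"
      using \<tau> pi_gt3 by (intro mult_right_mono) auto
    finally show ?thesis .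
  qed
  ultimately have "cone_sub y z \<ge> ln (14 / 11) - ln (y\<^sup>2) - pi / 4"
    using 2 r y(1) by (simp add: cone_sub_def r_def[symmetric] ln_realpow algebra_simps)
  then have "exp (ln (14 / 11) - ln (y\<^sup>2) - pi / 4) \<le> exp (cone_sub y z)" by simp
  moreover have "exp (ln (14 / 11) - ln (y\<^sup>2) - pi / 4) = 14 / 11 * exp (- pi / 4) / y\<^sup>2"
  proof -
    have "ln (14 / 11) - ln (y\<^sup>2) - pi / 4 = ln (14 / 11) - ln (y\<^sup>2) + (- pi / 4)" by simp
    then show ?thesis using y(1) by (simp only: exp_add exp_diff) simp
  qed
  ultimately show ?thesis by simp
qed

text \<open>Near 0 the function is at most ln (14 / 11) - ln \<open>sine_norm\<close>, and
  \<open>sine_norm z\<close> is at least |z| there. The comparison therefore starts in the right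
  order as soon as \<rho> |z| is at least 14 / 11.\<close>

lemma cone_sub_near_0:
  assumes y: "y \<ge> 1"
  shows "\<exists>e>0. \<forall>z. z \<noteq> 0 \<longrightarrow> cmod z \<le> e \<longrightarrow> exp (cone_sub y z) * cmod z \<le> 14 / 11"
proof -
  have "((\<lambda>z::complex. sin z / z) \<longlongrightarrow> 1) (at 0)"
    using DERIV_sin[of "0::complex"] by (simp add: DERIV_def)
  then have "\<forall>\<^sub>F z in at (0::complex). dist (sin z / z) 1 < 1 / 2"
    by (rule tendstoD) simp
  then obtain d where d: "d > 0" "\<And>z::complex. z \<noteq> 0 \<Longrightarrow> dist z 0 < d \<Longrightarrow> dist (sin z / z) 1 < 1 / 2"
    unfolding eventually_at by blast
  have low: "cmod z \<le> sine_norm z" if z: "z \<noteq> 0" "pi * cmod z < d" for z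
  proof -
    define w where "w = of_real pi * z"
    have w: "w \<noteq> 0" "dist w 0 < d" using z by (auto simp: w_def norm_mult)
    have "1 = cmod (sin w / w - (sin w / w - 1))" by simp
    also have "\<dots> \<le> cmod (sin w / w) + cmod (sin w / w - 1)" by (rule norm_triangle_ineq4)
    finally have "1 / 2 \<le> cmod (sin w / w)" using d(2)[OF w] unfolding dist_norm by linarith
    then have "1 / 2 \<le> cmod (sin w) / cmod w" by (simp only: norm_divide)
    then have "cmod w / 2 \<le> cmod (sin w)" using w(1) by (simp add: field_simps)
    moreover have "cmod w = pi * cmod z" by (simp add: w_def norm_mult)
    moreover have "2 * cmod z \<le> pi * cmod z" using pi_gt3 by (intro mult_right_mono) auto
    ultimately show ?thesis unfolding sine_norm_def w_def by linarith
  qed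
  have "continuous (at 0) sine_norm"
    unfolding sine_norm_def by (intro continuous_intros)
  then have "(sine_norm \<longlongrightarrow> sine_norm 0) (at 0)" by (simp add: isCont_def)
  \<comment> \<open>Below 9 / 10 the argument 1 / 10 + r stays below 1, so the middle logarithm of
    \<open>cone_sub\<close> is nonpositive.\<close>
  then have "\<forall>\<^sub>F z in at 0. sine_norm z < 9 / 10"
    by (rule order_tendstoD(2)) (simp add: sine_norm_def)
  then obtain d' where d': "d' > 0" "\<And>z. z \<noteq> 0 \<Longrightarrow> dist z 0 < d' \<Longrightarrow> sine_norm z < 9 / 10"
    unfolding eventually_at by blast
  define e where "e = min (d / (2 * pi)) (min (d' / 2) (1 / 2))"
  have e: "e > 0" using d(1) d'(1) by (simp add: e_def)
  have "exp (cone_sub y z) * cmod z \<le> 14 / 11" if z: "z \<noteq> 0" "cmod z \<le> e" for z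
  proof -
    define r where "r = sine_norm z"
    have cz: "cmod z > 0" using z(1) by simp
    have "cmod z \<le> d / (2 * pi)" using z(2) by (simp add: e_def)
    then have "pi * cmod z \<le> d / 2" by (simp add: field_simps)
    then have zr: "cmod z \<le> r" using low[OF z(1)] d(1) by (simp add: r_def)
    have "0 < r" using zr cz by linarith
    moreover have "r < 9 / 10" using d'(2)[OF z(1)] z(2) d'(1) by (auto simp: r_def e_def)
    ultimately have r: "0 < r" "r < 9 / 10" by auto
    have "(1 - 1 / (2 * y)) * ln (1 / 10 + r) \<le> 0"
      using y r by (intro mult_nonneg_nonpos) (auto simp: field_simps)
    moreover have "(Im z)\<^sup>2 / y\<^sup>2 \<le> 1 / 4"
    proof -
      have "(Im z)\<^sup>2 \<le> (1 / 2)\<^sup>2"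
        using abs_Im_le_cmod[of z] z(2) by (intro power2_le_iff_abs_le[THEN iffD2]) (auto simp: e_def)
      moreover have "1 / 4 * 1 \<le> 1 / 4 * y\<^sup>2" using y by (intro mult_left_mono) (auto simp: one_le_power)
      ultimately have "(Im z)\<^sup>2 \<le> 1 / 4 * y\<^sup>2" by (simp add: power2_eq_square)
      then show ?thesis using y by (simp add: field_simps)
    qed
    moreover have "ln y \<ge> 0" using y by simp
    ultimately have "cone_sub y z \<le> ln (14 / 11) - ln r"
    proof -
      assume *: "(1 - 1 / (2 * y)) * ln (1 / 10 + r) \<le> 0" "(Im z)\<^sup>2 / y\<^sup>2 \<le> 1 / 4" "0 \<le> ln y"
      have e: "exp (ln r) = r" using r(1) by simp
      have lin: "k - 2 * l + 7 / 5 * (b - 1 / 4) + a - m \<le> k - m" if "a \<le> 0" "b \<le> 1 / 4" "0 \<le> l"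
        for a b k l m :: real using that by argo
      show ?thesis unfolding cone_sub_def r_def[symmetric] e by (rule lin[OF *])
    qed
    then have "exp (cone_sub y z) \<le> exp (ln (14 / 11) - ln r)" by simp
    also have "\<dots> = 14 / 11 / r" using r(1) by (simp add: exp_diff)
    finally have "exp (cone_sub y z) * cmod z \<le> 14 / 11 / r * r"
      using zr cz r by (intro mult_mono) auto
    then show ?thesis using r(1) by simp
  qed
  then show ?thesis using e by blast
qed

lemma cone_sub_reflect: "cone_sub y (Complex x (- t)) = cone_sub y (Complex x t)"
  using sine_norm_cnj[of "Complex x t"] by (simp add: cone_sub_def)

lemma cone_sub_add_int: "n \<in> \<int> \<Longrightarrow> cone_sub y (z + of_real n) = cone_sub y z"
  using sine_norm_add_int[of n z] by (simp add: cone_sub_def)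


section \<open>Lower bounds for the hyperbolic metric\<close>

text \<open>One-sided version, for the seam, where only directional comparison with each side of the
  kink is possible.\<close>

lemma DERIV_right_min_nonneg:
  fixes f :: "real \<Rightarrow> real"
  assumes "(f has_real_derivative D) (at x)" "e > 0" "\<And>h. 0 < h \<Longrightarrow> h < e \<Longrightarrow> f x \<le> f (x + h)"
  shows "D \<ge> 0"
proof (rule ccontr)
  assume "\<not> D \<ge> 0"
  then obtain d where d: "d > 0" "\<And>h. 0 < h \<Longrightarrow> h < d \<Longrightarrow> f (x + h) < f x"
    using DERIV_neg_dec_right[OF assms(1)] by auto
  have "f (x + min d e / 2) < f x" "f x \<le> f (x + min d e / 2)"
    using d(1) assms(2) by (auto intro!: d(2) assms(3) simp: min_def)
  then show False by simp
qed

lemma has_lap_imp_DERIV_Im: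
  assumes "has_lap f a b L z"
  shows "((\<lambda>t. f (Complex (Re z) t)) has_real_derivative b) (at (Im z))"
  using assms has_deriv2_imp_deriv unfolding has_lap_def by blast

context hyperbolic_torus begin

lemma strip_lattice_iff:
  assumes "\<bar>Im z\<bar> \<le> y / 2"
  shows "z \<in> \<Lambda> \<longleftrightarrow> sine_norm z = 0"
proof -
  have "Im z / y \<in> \<int> \<longleftrightarrow> Im z = 0"
  proof
    assume "Im z / y \<in> \<int>"
    then obtain n :: int where n: "Im z / y = of_int n" by (auto elim: Ints_cases)
    have "\<bar>Im z / y\<bar> \<le> 1 / 2" using assms y by (simp add: abs_divide field_simps)
    then have "n = 0" unfolding n by linarith
    then show "Im z = 0" using n y by simp
  qed simp
  then show ?thesis using lattice_imag_iff[OF y] sine_norm_eq_0_iff by simp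
qed

text \<open>A negative minimum of \<open>h\<close> is excluded. At an interior point of the strip,
  \<rho> < exp (\<open>cone_sub\<close>) together with the curvature inequality makes the Laplacian
  of \<open>h\<close> negative. On the seam the convex kink excludes it, and near the puncture
  \<open>near0\<close> does.\<close>

lemma rho_ge_cone_sub:
  assumes y1: "y \<ge> 1"
    and large: "\<And>M. \<exists>e>0. \<forall>z. z \<noteq> 0 \<longrightarrow> cmod z \<le> e \<longrightarrow> \<rho> z * cmod z \<ge> M"
    and z0: "\<bar>Im z0\<bar> \<le> y / 2" "z0 \<notin> \<Lambda>"
  shows "\<rho> z0 \<ge> exp (cone_sub y z0)"
proof -
  define h where "h z = ln (\<rho> z) - cone_sub y z" for z
  have sn: "sine_norm z \<noteq> 0" if "\<bar>Im z\<bar> \<le> y / 2" "z \<notin> \<Lambda>" for z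
    using strip_lattice_iff that by blast
  have int\<Lambda>: "of_int n \<in> \<Lambda>" for n using lattice_imag_iff[OF y] by simp
  have hper: "h (z + of_int n) = h z" if "z \<notin> \<Lambda>" for z and n :: int
    using per[OF that int\<Lambda>[of n]] cone_sub_add_int[of "of_int n" y z] by (simp add: h_def)
  obtain e1 where e1: "e1 > 0" "\<And>z. z \<noteq> 0 \<Longrightarrow> cmod z \<le> e1 \<Longrightarrow> \<rho> z * cmod z \<ge> 14 / 11"
    using large by blast
  obtain e2 where e2: "e2 > 0" "\<And>z. z \<noteq> 0 \<Longrightarrow> cmod z \<le> e2 \<Longrightarrow> exp (cone_sub y z) * cmod z \<le> 14 / 11"
    using cone_sub_near_0[OF y1] by blast
  define e where "e = min (min e1 e2) (1 / 4)"
  have e: "e > 0" "e \<le> 1 / 4" using e1 e2 by (auto simp: e_def)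
  have near0: "h z \<ge> 0" if z: "z \<noteq> 0" "cmod z \<le> e" for z
  proof -
    have "z \<notin> \<Lambda>" using z e y1 by (intro not_in_lattice_small) auto
    then have p: "\<rho> z > 0" by (rule pos)
    have "exp (cone_sub y z) * cmod z \<le> \<rho> z * cmod z"
      using e1(2)[OF z(1)] e2(2)[OF z(1)] z(2) unfolding e_def by auto
    then have "exp (cone_sub y z) \<le> \<rho> z" using z(1) by simp
    then have "ln (exp (cone_sub y z)) \<le> ln (\<rho> z)" using p by (intro ln_mono) auto
    then show ?thesis by (simp add: h_def)
  qed
  define K where "K = cbox (Complex (- 1 / 2) (- y / 2)) (Complex (1 / 2) (y / 2)) - ball 0 e"
  have Kcomp: "compact K" unfolding K_def by (intro compact_diff) auto
  have box: "z \<in> cbox (Complex (- 1 / 2) (- y / 2)) (Complex (1 / 2) (y / 2)) \<longleftrightarrow> \<bar>Re z\<bar> \<le> 1 / 2 \<and> \<bar>Im z\<bar> \<le> y / 2" for z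
    by (auto simp: mem_box Basis_complex_def abs_le_iff)
  have box\<Lambda>: "z \<notin> \<Lambda>" if "\<bar>Re z\<bar> \<le> 1 / 2" "\<bar>Im z\<bar> \<le> y / 2" "z \<noteq> 0" for z
  proof
    assume "z \<in> \<Lambda>"
    then have "Re z \<in> \<int>" "Im z = 0" using strip_lattice_iff[OF that(2)] sine_norm_eq_0_iff by auto
    moreover obtain n :: int where "Re z = of_int n" using calculation(1) by (auto elim: Ints_cases)
    moreover have "n = 0" using that(1) calculation(3) by linarith
    ultimately show False using that(3) by (simp add: complex_eq_iff)
  qed
  have K\<Lambda>: "z \<notin> \<Lambda>" "\<bar>Im z\<bar> \<le> y / 2" "z \<noteq> 0" if "z \<in> K" for z
  proof -
    have "z \<noteq> 0" using that e(1) by (auto simp: K_def)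
    then show "z \<notin> \<Lambda>" "\<bar>Im z\<bar> \<le> y / 2" "z \<noteq> 0" using that box box\<Lambda> by (auto simp: K_def)
  qed
  have "continuous_on K h"
  proof -
    have rn: "\<rho> z \<noteq> 0" "sine_norm z \<noteq> 0" if "z \<in> K" for z
      using K\<Lambda>[OF that] pos[of z] sn[of z] by auto
    have "1 / 10 + exp x \<noteq> 0" for x :: real using exp_gt_zero[of x] by linarith
    moreover have "continuous_on K sine_norm" unfolding sine_norm_def[abs_def] by (intro continuous_intros)
    moreover have "continuous_on K \<rho>" by (rule continuous_on_subset[OF cont]) (use K\<Lambda> in auto)
    ultimately show ?thesis
      unfolding h_def[abs_def] cone_sub_def using rn y by (intro continuous_intros) auto
  qed
  moreover have "Complex (1 / 2) 0 \<in> K"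
  proof -
    have "cmod (Complex (1 / 2) 0) = 1 / 2" by (simp add: cmod_def power2_eq_square real_sqrt_divide)
    then show ?thesis using y e(2) box[of "Complex (1 / 2) 0"] by (simp add: K_def)
  qed
  ultimately obtain m where m: "m \<in> K" "\<And>z. z \<in> K \<Longrightarrow> h m \<le> h z"
    using continuous_attains_inf[OF Kcomp, of h] by blast
  have mK: "m \<notin> \<Lambda>" "\<bar>Im m\<bar> \<le> y / 2" "m \<noteq> 0" using K\<Lambda>[OF m(1)] by auto
  have hm: "h m \<ge> 0"
  proof (rule ccontr)
    assume neg: "\<not> h m \<ge> 0"
    \<comment> \<open>Translation by integers turns the minimum over the cell into one over the
      whole strip, so the vertical sides Re z = 1 / 2 and Re z = - 1 / 2 of the cell are no
      boundary.\<close>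
    have glob: "h m \<le> h z" if z: "\<bar>Im z\<bar> \<le> y / 2" "z \<notin> \<Lambda>" for z
    proof -
      define w where "w = z + of_int (- round (Re z))"
      have w\<Lambda>: "w \<notin> \<Lambda>" unfolding w_def using lattice_add_iff[OF int\<Lambda>] z(2) by blast
      have w: "\<bar>Re w\<bar> \<le> 1 / 2" "\<bar>Im w\<bar> \<le> y / 2"
        using of_int_round_abs_le[of "Re z"] z(1) by (auto simp: w_def abs_minus_commute)
      have "w \<noteq> 0" using w\<Lambda> lattice_0 by metis
      have "h m \<le> h w"
      proof (cases "cmod w \<le> e")
        case True
        then show ?thesis using near0[OF \<open>w \<noteq> 0\<close>] neg by simp
      next
        case False
        then have "w \<in> K" using w box by (simp add: K_def)
        then show ?thesis by (rule m(2))
      qed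
      also have "h w = h z" unfolding w_def by (rule hper[OF z(2)])
      finally show ?thesis .
    qed
    obtain a b where lr: "has_lap (\<lambda>w. ln (\<rho> w)) a b (2 * \<rho> m) m" using lap[OF mK(1)] by blast
    obtain c d L where lc: "has_lap (cone_sub y) c d L m" "2 * exp (cone_sub y m) \<le> L"
      using cone_sub_curvature[OF sn[OF mK(2,1)] y1 mK(2)] by blast
    have "\<rho> m < exp (cone_sub y m)"
    proof -
      have "exp (ln (\<rho> m)) < exp (cone_sub y m)" using neg by (simp add: h_def)
      then show ?thesis using pos[OF mK(1)] by simp
    qed
    then have Lneg: "2 * \<rho> m - L < 0" using lc(2) by linarith
    show False
    proof (cases "\<bar>Im m\<bar> < y / 2")
      case True
      have "open (- \<Lambda> \<inter> {z. \<bar>Im z\<bar> < y / 2})"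
        by (intro open_Int open_compl_lattice[OF y] open_Collect_less continuous_intros)
      then have "\<forall>\<^sub>F z in nhds m. z \<in> - \<Lambda> \<inter> {z. \<bar>Im z\<bar> < y / 2}"
        by (rule eventually_nhds_in_open) (use mK True in auto)
      then have "\<forall>\<^sub>F z in nhds m. h m \<le> h z"
        by eventually_elim (use glob in auto)
      moreover have "has_lap h (a - c) (b - d) (2 * \<rho> m - L) m"
        unfolding h_def[abs_def] by (intro has_lap_diff lr lc(1))
      ultimately show False using has_lap_local_min Lneg by force
    next
      case False
      \<comment> \<open>By periodicity of \<rho> and reflection symmetry of \<open>cone_sub\<close>
        the two seams carry the same values of \<open>h\<close>, so the minimum may be placed on the
        upper one.\<close>
      define x where "x = Re m"
      define top where "top = Complex x (y / 2)"
      have m': "m = top \<or> m = Complex x (- (y / 2))"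
        using False mK(2) by (auto simp: x_def top_def complex_eq_iff)
      have iy: "Complex 0 y \<in> \<Lambda>" "Complex 0 (- y) \<in> \<Lambda>"
        using y by (auto simp: lattice_imag_iff[OF y])
      have shift: "Complex x (t - y) \<in> \<Lambda> \<longleftrightarrow> Complex x t \<in> \<Lambda>" "Complex x t \<notin> \<Lambda> \<Longrightarrow> \<rho> (Complex x (t - y)) = \<rho> (Complex x t)" for t
        using lattice_add_iff[OF iy(2), of "Complex x t"] per[OF _ iy(2), of "Complex x t"] by (auto simp: complex_add)
      have top\<Lambda>: "top \<notin> \<Lambda>"
        using m' mK(1) shift(1)[of "y / 2"] by (auto simp: top_def)
      have htop: "h top = h m"
      proof -
        have "h (Complex x (- (y / 2))) = h top"
          using shift(2)[of "y / 2"] top\<Lambda> cone_sub_reflect[of y x "y / 2"] by (simp add: top_def h_def)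
        then show ?thesis using m' by auto
      qed
      have topIm: "Im top = y / 2" "Re top = x" by (auto simp: top_def)
      have sntop: "sine_norm top \<noteq> 0" using sn[of top] top\<Lambda> y by (simp add: topIm)
      obtain c' d' L' where slope: "has_lap (cone_sub y) c' d' L' top" "d' < 0"
        using cone_sub_slope[OF sntop y1 topIm(1)] by blast
      obtain a' b' where lr': "has_lap (\<lambda>w. ln (\<rho> w)) a' b' (2 * \<rho> top) top" using lap[OF top\<Lambda>] by blast
      have dS: "((\<lambda>t. cone_sub y (Complex x t)) has_real_derivative d') (at (y / 2))"
        using has_lap_imp_DERIV_Im[OF slope(1)] by (simp add: topIm)
      have dR: "((\<lambda>t. ln (\<rho> (Complex x t))) has_real_derivative b') (at (y / 2))"
        using has_lap_imp_DERIV_Im[OF lr'] by (simp add: topIm)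
      have nl: "Complex x t \<notin> \<Lambda>" if t: "0 < \<bar>t\<bar>" "\<bar>t\<bar> < y" for t
      proof
        assume "Complex x t \<in> \<Lambda>"
        then obtain n :: int where n: "t / y = of_int n" by (auto simp: lattice_imag_iff[OF y] elim: Ints_cases)
        then have "\<bar>of_int n\<bar> < (1 :: real)" using t y by (simp add: abs_divide flip: n)
        then have "n = 0" by linarith
        then show False using n t y by simp
      qed
      have below: "h top \<le> ln (\<rho> (Complex x (y / 2 - s))) - cone_sub y (Complex x (y / 2 - s))"
        if "0 < s" "s < y / 2" for s
        using glob[of "Complex x (y / 2 - s)"] nl[of "y / 2 - s"] that htop by (simp add: h_def)
      \<comment> \<open>Just above the seam \<rho> is continued smoothly, while the periodic
        extension of the comparison function is the mirror image of its values below.\<close>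
      have above: "h top \<le> ln (\<rho> (Complex x (y / 2 + s))) - cone_sub y (Complex x (y / 2 - s))"
        if s: "0 < s" "s < y / 2" for s
      proof -
        have "Complex x (y / 2 + s) \<notin> \<Lambda>" using nl[of "y / 2 + s"] s by simp
        then have "\<rho> (Complex x (y / 2 + s)) = \<rho> (Complex x (- (y / 2 - s)))"
          using shift(2)[of "y / 2 + s"] by (simp add: algebra_simps)
        moreover have "h m \<le> h (Complex x (- (y / 2 - s)))"
          using glob[of "Complex x (- (y / 2 - s))"] nl[of "- (y / 2 - s)"] s by simp
        ultimately show ?thesis
          using htop cone_sub_reflect[of y x "y / 2 - s"] by (simp only: h_def)
      qed
      have refl_line: "((\<lambda>s. y / 2 - s) has_real_derivative - 1) (at 0)"
        and shift_line: "((\<lambda>s. y / 2 + s) has_real_derivative 1) (at 0)"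
        by (auto intro!: derivative_eq_intros)
      have S: "((\<lambda>s. cone_sub y (Complex x (y / 2 - s))) has_real_derivative - d') (at 0)"
        using DERIV_chain2[OF _ refl_line, of "\<lambda>t. cone_sub y (Complex x t)" d'] dS by simp
      have "((\<lambda>s. ln (\<rho> (Complex x (y / 2 - s)))) has_real_derivative - b') (at 0)"
        using DERIV_chain2[OF _ refl_line, of "\<lambda>t. ln (\<rho> (Complex x t))" b'] dR by simp
      from DERIV_diff[OF this S] have "- b' - - d' \<ge> 0"
        by (rule DERIV_right_min_nonneg[of _ _ _ "y / 2"]) (use below y in \<open>auto simp: h_def top_def\<close>)
      moreover have "((\<lambda>s. ln (\<rho> (Complex x (y / 2 + s)))) has_real_derivative b') (at 0)"
        using DERIV_chain2[OF _ shift_line, of "\<lambda>t. ln (\<rho> (Complex x t))" b'] dR by simp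
      from DERIV_diff[OF this S] have "b' - - d' \<ge> 0"
        by (rule DERIV_right_min_nonneg[of _ _ _ "y / 2"]) (use above y in \<open>auto simp: h_def top_def\<close>)
      \<comment> \<open>Since \<rho> is differentiable across the seam, \<open>b'\<close> enters
        with opposite signs; adding the two inequalities leaves 2 d' \<ge> 0.\<close>
      ultimately show False using slope(2) by linarith
    qed
  qed
  define w where "w = z0 + of_int (- round (Re z0))"
  have w\<Lambda>: "w \<notin> \<Lambda>" unfolding w_def using lattice_add_iff[OF int\<Lambda>] z0(2) by blast
  have w: "\<bar>Re w\<bar> \<le> 1 / 2" "\<bar>Im w\<bar> \<le> y / 2"
    using of_int_round_abs_le[of "Re z0"] z0(1) by (auto simp: w_def abs_minus_commute)
  have "w \<noteq> 0" using w\<Lambda> lattice_0 by metis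
  have "0 \<le> h w"
  proof (cases "cmod w \<le> e")
    case True
    then show ?thesis using near0[OF \<open>w \<noteq> 0\<close>] by simp
  next
    case False
    then have "w \<in> K" using w box by (simp add: K_def)
    then show ?thesis using m(2) hm by force
  qed
  also have "h w = h z0" unfolding w_def by (rule hper[OF z0(2)])
  finally have "exp (cone_sub y z0) \<le> exp (ln (\<rho> z0))" by (simp add: h_def)
  then show ?thesis using pos[OF z0(2)] by simp
qed

lemma rho_ge_tall:
  assumes y1: "y \<ge> 1"
    and large: "\<And>M. \<exists>e>0. \<forall>z. z \<noteq> 0 \<longrightarrow> cmod z \<le> e \<longrightarrow> \<rho> z * cmod z \<ge> M"
    and z: "z \<notin> \<Lambda>"
  shows "\<rho> z \<ge> 14 / 11 * exp (- pi / 4) / y\<^sup>2"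
proof -
  define k where "k = round (Im z / y)"
  define w where "w = z + Complex 0 (- of_int k * y)"
  have v: "Complex 0 (- of_int k * y) \<in> \<Lambda>" using y by (simp add: lattice_imag_iff[OF y])
  have w: "w \<notin> \<Lambda>" unfolding w_def using lattice_add_iff[OF v] z by blast
  have "\<bar>Im z / y - of_int k\<bar> \<le> 1 / 2"
    using of_int_round_abs_le[of "Im z / y"] by (simp add: k_def abs_minus_commute)
  then have "\<bar>Im z / y - of_int k\<bar> * y \<le> 1 / 2 * y" using y by (intro mult_right_mono) auto
  moreover have "\<bar>Im z / y - of_int k\<bar> * y = \<bar>(Im z / y - of_int k) * y\<bar>" using y by (simp add: abs_mult)
  moreover have "(Im z / y - of_int k) * y = Im w" using y by (simp add: w_def field_simps)
  ultimately have Imw: "\<bar>Im w\<bar> \<le> y / 2" by simp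
  have "14 / 11 * exp (- pi / 4) / y\<^sup>2 \<le> exp (cone_sub y w)"
    using cone_sub_lower[of w y] strip_lattice_iff[OF Imw] w y1 Imw by blast
  also have "\<dots> \<le> \<rho> w" by (rule rho_ge_cone_sub[OF y1 large Imw w])
  also have "\<rho> w = \<rho> z" unfolding w_def by (rule per[OF z v])
  finally show ?thesis .
qed

end

section \<open>The symmetry exchanging tall and wide tori\<close>

lemma has_lap_rotate:
  assumes "has_lap f a b L (\<i> * of_real y * z)"
  shows "has_lap (\<lambda>z. f (\<i> * of_real y * z)) (y * b) (- y * a) (y\<^sup>2 * L) z"
proof -
  have e: "\<i> * of_real y * Complex s t = Complex (- y * t) (y * s)" for s t
    by (simp add: complex_eq_iff)
  have e': "\<i> * of_real y * z = Complex (- y * Im z) (y * Re z)" by (simp add: complex_eq_iff)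
  obtain p q where pq: "has_deriv2 (\<lambda>x. f (Complex x (y * Re z))) a p (- y * Im z)"
    "has_deriv2 (\<lambda>t. f (Complex (- y * Im z) t)) b q (y * Re z)" "L = p + q"
    using assms unfolding has_lap_def e' complex.sel by blast
  have lin: "has_deriv2 (\<lambda>t. c * t) c 0 t" for c t :: real
    by (rule has_deriv2I[of UNIV _ _ "\<lambda>x. c"]) (auto intro!: derivative_eq_intros)
  have "has_deriv2 (\<lambda>s. f (Complex (- y * Im z) (y * s))) (b * y) (q * y\<^sup>2 + b * 0) (Re z)"
    using has_deriv2_compose[OF lin[of y "Re z"] pq(2)] .
  moreover have "has_deriv2 (\<lambda>t. f (Complex (- y * t) (y * Re z))) (a * (- y)) (p * (- y)\<^sup>2 + a * 0) (Im z)"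
    using has_deriv2_compose[OF lin[of "- y" "Im z"] pq(1)] .
  ultimately show ?thesis
    unfolding has_lap_def e pq(3)
    by (intro exI[of _ "q * y\<^sup>2"] exI[of _ "p * y\<^sup>2"]) (simp add: algebra_simps)
qed

context hyperbolic_torus begin

lemma rotate_lattice_iff: "\<i> * of_real y * z \<in> \<Lambda> \<longleftrightarrow> z \<in> lattice (\<i> * of_real (1 / y))"
proof -
  have "- (y * Im z) \<in> \<int> \<longleftrightarrow> Im z * y \<in> \<int>"
    using Ints_minus[of "- (y * Im z)"] Ints_minus[of "y * Im z"] by (auto simp: mult.commute)
  then show ?thesis
    using y lattice_imag_iff[OF y, of "\<i> * of_real y * z"] lattice_imag_iff[of "1 / y" z] by auto
qed

text \<open>Multiplication by i y maps the lattice of i / y onto that of i y; the pulled back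
  density acquires the factor y^2 and still satisfies Liouville's equation.\<close>

lemma hyperbolic_torus_rotate: "hyperbolic_torus (1 / y) (\<lambda>z. y\<^sup>2 * \<rho> (\<i> * of_real y * z))"
proof
  show "1 / y > 0" using y by simp
  show "y\<^sup>2 * \<rho> (\<i> * of_real y * (z + w)) = y\<^sup>2 * \<rho> (\<i> * of_real y * z)"
    if "z \<notin> lattice (\<i> * of_real (1 / y))" "w \<in> lattice (\<i> * of_real (1 / y))" for z w
    using per[of "\<i> * of_real y * z" "\<i> * of_real y * w"] that rotate_lattice_iff by (simp add: distrib_left)
  show "y\<^sup>2 * \<rho> (\<i> * of_real y * z) > 0" if "z \<notin> lattice (\<i> * of_real (1 / y))" for z
    using pos[of "\<i> * of_real y * z"] y that rotate_lattice_iff by simp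
  show "continuous_on (- lattice (\<i> * of_real (1 / y))) (\<lambda>z. y\<^sup>2 * \<rho> (\<i> * of_real y * z))"
    by (intro continuous_intros continuous_on_compose2[OF cont]) (use rotate_lattice_iff in auto)
  show "\<exists>a b. has_lap (\<lambda>w. ln (y\<^sup>2 * \<rho> (\<i> * of_real y * w))) a b (2 * (y\<^sup>2 * \<rho> (\<i> * of_real y * z))) z"
    if z: "z \<notin> lattice (\<i> * of_real (1 / y))" for z
  proof -
    have z': "\<i> * of_real y * z \<notin> \<Lambda>" using z rotate_lattice_iff by blast
    obtain a b where "has_lap (\<lambda>w. ln (\<rho> w)) a b (2 * \<rho> (\<i> * of_real y * z)) (\<i> * of_real y * z)"
      using lap[OF z'] by blast
    from has_lap_add[OF has_lap_const[of "ln (y\<^sup>2)" z] has_lap_rotate[OF this]]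
    have "has_lap (\<lambda>w. ln (y\<^sup>2) + ln (\<rho> (\<i> * of_real y * w))) (0 + y * b) (0 + - y * a)
        (0 + y\<^sup>2 * (2 * \<rho> (\<i> * of_real y * z))) z" .
    then have "has_lap (\<lambda>w. ln (y\<^sup>2 * \<rho> (\<i> * of_real y * w))) (0 + y * b) (0 + - y * a)
        (0 + y\<^sup>2 * (2 * \<rho> (\<i> * of_real y * z))) z"
    proof (rule has_lap_transform)
      show "open (- lattice (\<i> * of_real (1 / y)))" using y by (intro open_compl_lattice) simp
      show "ln (y\<^sup>2) + ln (\<rho> (\<i> * of_real y * w)) = ln (y\<^sup>2 * \<rho> (\<i> * of_real y * w))"
        if "w \<in> - lattice (\<i> * of_real (1 / y))" for w
        using pos[of "\<i> * of_real y * w"] y that rotate_lattice_iff by (simp add: ln_mult)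
    qed (use z in simp)
    moreover have "0 + y\<^sup>2 * (2 * \<rho> (\<i> * of_real y * z)) = 2 * (y\<^sup>2 * \<rho> (\<i> * of_real y * z))" by simp
    ultimately show ?thesis by metis
  qed
qed

lemma rho_ge_wide:
  assumes y1: "y \<le> 1"
    and large: "\<And>M. \<exists>e>0. \<forall>z. z \<noteq> 0 \<longrightarrow> cmod z \<le> e \<longrightarrow> \<rho> z * cmod z \<ge> M"
    and z: "z \<notin> \<Lambda>"
  shows "\<rho> z \<ge> 14 / 11 * exp (- pi / 4)"
proof -
  interpret rot: hyperbolic_torus "1 / y" "\<lambda>z. y\<^sup>2 * \<rho> (\<i> * of_real y * z)" by (rule hyperbolic_torus_rotate)
  define w where "w = z / (\<i> * of_real y)"
  have w: "\<i> * of_real y * w = z" using y by (simp add: w_def)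
  have "14 / 11 * exp (- pi / 4) / (1 / y)\<^sup>2 \<le> y\<^sup>2 * \<rho> (\<i> * of_real y * w)"
  proof (rule rot.rho_ge_tall)
    show "1 / y \<ge> 1" using y y1 by simp
    show "w \<notin> lattice (\<i> * of_real (1 / y))" using rotate_lattice_iff[of w] z w by simp
    show "\<exists>e>0. \<forall>z. z \<noteq> 0 \<longrightarrow> cmod z \<le> e \<longrightarrow> M \<le> y\<^sup>2 * \<rho> (\<i> * of_real y * z) * cmod z" for M
    proof -
      obtain e where e: "e > 0" "\<And>z. z \<noteq> 0 \<Longrightarrow> cmod z \<le> e \<Longrightarrow> \<rho> z * cmod z \<ge> M / y"
        using large by blast
      show ?thesis
      proof (intro exI[of _ "e / y"] conjI allI impI)
        show "e / y > 0" using e(1) y by simp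
        fix u :: complex assume u: "u \<noteq> 0" "cmod u \<le> e / y"
        have "M / y \<le> \<rho> (\<i> * of_real y * u) * cmod (\<i> * of_real y * u)"
          using u y by (intro e(2)) (auto simp: norm_mult field_simps)
        then have "y * (M / y) \<le> y * (\<rho> (\<i> * of_real y * u) * (y * cmod u))"
          using y by (intro mult_left_mono) (auto simp: norm_mult)
        then show "M \<le> y\<^sup>2 * \<rho> (\<i> * of_real y * u) * cmod u"
          using y by (simp add: power2_eq_square mult_ac)
      qed
    qed
  qed
  then have "y\<^sup>2 * (14 / 11 * exp (- pi / 4)) \<le> y\<^sup>2 * \<rho> z"
    unfolding w using y by (simp add: power_divide mult.commute)
  then show ?thesis using y by simp
qed

end


section \<open>Integrals over the fundamental domain\<close>

text \<open>The affine map fixes 1 and stretches the imaginary direction by k = (y + t) / y, so its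
  dilatation is (1 - k) / (1 + k) = - t / (2 y + t).\<close>

lemma tangent_beltrami_imag:
  assumes "y > 0"
  shows "tangent_beltrami (\<i> * of_real y) \<i> z = - of_real (1 / (2 * y))"
proof -
  have dil: "complex_dilatation (affine_marking_map (\<i> * of_real y) (\<i> * of_real y + of_real t * \<i>)) z =
      of_real (- t / (2 * y + t))" for t
  proof -
    define D where "D h = of_real (Re h) + of_real (Im h / y) * (\<i> * of_real y + of_real t * \<i>)" for h
    have "affine_marking_map (\<i> * of_real y) (\<i> * of_real y + of_real t * \<i>) = D"
      by (auto simp: affine_marking_map_def D_def)
    moreover have "bounded_linear D"
      unfolding D_def
      by (intro bounded_linear_add bounded_linear_compose[OF bounded_linear_of_real] bounded_linear_Re
          bounded_linear_compose[OF bounded_linear_mult_left])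
        (auto intro!: bounded_linear_compose[OF bounded_linear_of_real]
          bounded_linear_compose[OF bounded_linear_divide] bounded_linear_Im)
    then have "(D has_derivative D) (at z)" by (rule bounded_linear_imp_has_derivative)
    then have "frechet_derivative D (at z) = D" by (rule frechet_derivative_at[symmetric])
    ultimately have fd: "frechet_derivative
        (affine_marking_map (\<i> * of_real y) (\<i> * of_real y + of_real t * \<i>)) (at z) = D" by simp
    have D1: "D 1 = 1" by (simp add: D_def)
    have "\<i> * D \<i> = - of_real ((y + t) / y)"
      using assms by (simp add: D_def complex_eq_iff field_simps)
    then have "((D 1 + \<i> * D \<i>) / 2) / ((D 1 - \<i> * D \<i>) / 2) =
        of_real ((1 - (y + t) / y) / 2 / ((1 + (y + t) / y) / 2))"
      unfolding D1 by simp
    also have "(1 - (y + t) / y) / 2 / ((1 + (y + t) / y) / 2) = - t / (2 * y + t)"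
    proof -
      have "(1 - (y + t) / y) / 2 = - t / (2 * y)" "(1 + (y + t) / y) / 2 = (2 * y + t) / (2 * y)"
        using assms by (auto simp: field_simps)
      then show ?thesis using assms by (simp only:) simp
    qed
    finally show ?thesis unfolding complex_dilatation_def fd Let_def .
  qed
  have "((\<lambda>t. - t / (2 * y + t)) has_real_derivative - (1 / (2 * y))) (at 0)"
    using assms by (auto intro!: derivative_eq_intros simp: field_simps power2_eq_square)
  then have "((\<lambda>t. complex_of_real (- t / (2 * y + t))) has_vector_derivative of_real (- (1 / (2 * y)))) (at 0)"
    by (rule has_vector_derivative_of_real)
  then have "vector_derivative (\<lambda>t. complex_of_real (- t / (2 * y + t))) (at 0) = of_real (- (1 / (2 * y)))"
    by (rule vector_derivative_at)
  then show ?thesis unfolding tangent_beltrami_def dil by simp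
qed

text \<open>Both orders of the coordinates are covered, so that integrals can be sliced into
  horizontal or into vertical segments.\<close>

lemma lborel_complex:
  assumes "c = Complex \<or> c = (\<lambda>s t. Complex t s)"
  shows "lborel = distr (lborel \<Otimes>\<^sub>M lborel) borel (\<lambda>(s, t). c s t)"
proof (rule lborel_eqI)
  have m: "(\<lambda>(s, t). c s t) \<in> borel_measurable (lborel \<Otimes>\<^sub>M lborel)"
    using assms by (auto simp: Complex_eq case_prod_beta)
  fix l u :: complex assume "\<And>b. b \<in> Basis \<Longrightarrow> l \<bullet> b \<le> u \<bullet> b"
  from this[of 1] this[of \<i>] have le: "Re l \<le> Re u" "Im l \<le> Im u" by (auto simp: Basis_complex_def)
  define A B where "A = (if c = Complex then {Re l<..<Re u} else {Im l<..<Im u})"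
    and "B = (if c = Complex then {Im l<..<Im u} else {Re l<..<Re u})"
  have "(\<lambda>(s, t). c s t) -` box l u \<inter> space (lborel \<Otimes>\<^sub>M lborel) = A \<times> B"
    using assms by (auto simp: A_def B_def box_def Basis_complex_def space_pair_measure)
  then have "emeasure (distr (lborel \<Otimes>\<^sub>M lborel) borel (\<lambda>(s, t). c s t)) (box l u) =
      emeasure (lborel \<Otimes>\<^sub>M lborel) (A \<times> B)"
    using m by (subst emeasure_distr) auto
  also have "\<dots> = emeasure lborel A * emeasure lborel B"
    by (rule lborel.emeasure_pair_measure_Times) (auto simp: A_def B_def)
  also have "\<dots> = ennreal (\<Prod>b\<in>Basis. (u - l) \<bullet> b)"
    using le by (auto simp: A_def B_def Basis_complex_def ennreal_mult[symmetric] mult.commute)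
  finally show "emeasure (distr (lborel \<Otimes>\<^sub>M lborel) borel (\<lambda>(s, t). c s t)) (box l u) =
      ennreal (\<Prod>b\<in>Basis. (u - l) \<bullet> b)" .
qed simp

lemma fund_domain_imag:
  assumes "y > 0"
  shows "fund_domain (\<i> * of_real y) = {z. 0 \<le> Re z \<and> Re z < 1 \<and> 0 \<le> Im z \<and> Im z < y}"
proof -
  have "z \<in> fund_domain (\<i> * of_real y)" if "0 \<le> Re z" "Re z < 1" "0 \<le> Im z" "Im z < y" for z
  proof -
    have "z = of_real (Re z) + of_real (Im z / y) * (\<i> * of_real y)"
      using assms by (simp add: complex_eq_iff)
    moreover have "0 \<le> Im z / y" "Im z / y < 1" using that assms by auto
    ultimately show ?thesis unfolding fund_domain_def using that by blast
  qed
  moreover have "0 \<le> Re z \<and> Re z < 1 \<and> 0 \<le> Im z \<and> Im z < y" if "z \<in> fund_domain (\<i> * of_real y)" for z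
    using that assms unfolding fund_domain_def by auto
  ultimately show ?thesis by blast
qed

text \<open>For a primitive \<open>G\<close> of \<open>f\<close> the difference G (z + a u) - G z
  has derivative f (z + a u) - f z = 0. It is therefore constant on \<open>S\<close>, and it equals
  \<open>u\<close> times the integral over the circle.\<close>

lemma mean_of_periodic_holomorphic:
  assumes S: "convex S" "open S" "S \<noteq> {}" and hol: "f holomorphic_on S" and u: "u \<noteq> 0" and a: "a > 0"
    and S_line: "\<And>z s :: real. z \<in> S \<Longrightarrow> z + of_real s * u \<in> S"
    and per: "\<And>z. z \<in> S \<Longrightarrow> f (z + of_real a * u) = f z"
  obtains e where "\<And>z. z \<in> S \<Longrightarrow> ((\<lambda>s. f (z + of_real s * u)) has_integral e) {0..a}"
proof -
  obtain G where G: "\<And>z. z \<in> S \<Longrightarrow> (G has_field_derivative f z) (at z)"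
    using holomorphic_convex_primitive'[OF S(1,2) hol] at_within_open[OF _ S(2)] by metis
  have "((\<lambda>z. G (z + of_real a * u) - G z) has_field_derivative 0) (at z within S)" if z: "z \<in> S" for z
  proof -
    have "((\<lambda>z. G (z + of_real a * u)) has_field_derivative f (z + of_real a * u) * 1) (at z)"
      by (rule DERIV_chain2[where f = G and g = "\<lambda>z. z + of_real a * u", OF G[OF S_line[OF z, of a]]]) (auto intro!: derivative_eq_intros)
    from DERIV_diff[OF this G[OF z]] show ?thesis
      using per[OF z] by (auto intro: has_field_derivative_at_within)
  qed
  from has_field_derivative_zero_constant[OF S(1) this]
  obtain c where c: "\<And>z. z \<in> S \<Longrightarrow> G (z + of_real a * u) - G z = c" by metis
  show ?thesis
  proof (rule that[of "c / u"])
    fix z assume z: "z \<in> S"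
    have "((\<lambda>s. f (z + of_real s * u) * u) has_integral (G (z + of_real a * u) - G (z + of_real 0 * u))) {0..a}"
    proof (rule fundamental_theorem_of_calculus)
      show "((\<lambda>s. G (z + of_real s * u)) has_vector_derivative f (z + of_real s * u) * u) (at s within {0..a})" for s
      proof -
        have "((\<lambda>s. z + of_real s * u) has_vector_derivative u) (at s within {0..a})"
          by (auto intro!: derivative_eq_intros)
        from field_vector_diff_chain_within[OF this has_field_derivative_at_within[OF G[OF S_line[OF z, of s]]]]
        show ?thesis by (simp add: o_def mult.commute)
      qed
    qed (use a in simp)
    from has_integral_mult_left[OF this, of "inverse u"]
    show "((\<lambda>s. f (z + of_real s * u)) has_integral c / u) {0..a}"
      using u c[OF z] by (simp add: mult.assoc divide_inverse)
  qed
qed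

text \<open>The weight is a polynomial minorant of min (t, b - t)^2 / 4, chosen because it
  integrates in closed form: b^3 B(3, 3) / 4 with B(3, 3) = 1 / 30.\<close>

lemma nn_integral_weight:
  fixes b :: real
  assumes "b > 0"
  shows "(\<integral>\<^sup>+ t. ennreal (t\<^sup>2 * (b - t)\<^sup>2 / (4 * b\<^sup>2)) * indicator {0<..<b} t \<partial>lborel) = ennreal (b ^ 3 / 120)"
proof -
  have "((\<lambda>t. t\<^sup>2 * (b - t)\<^sup>2 / (4 * b\<^sup>2)) has_integral
      ((b\<^sup>2 * b ^ 3 / 3 - 2 * b * b ^ 4 / 4 + b ^ 5 / 5) / (4 * b\<^sup>2) -
       (b\<^sup>2 * 0 ^ 3 / 3 - 2 * b * 0 ^ 4 / 4 + 0 ^ 5 / 5) / (4 * b\<^sup>2))) {0..b}"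
  proof (rule fundamental_theorem_of_calculus)
    show "((\<lambda>t. (b\<^sup>2 * t ^ 3 / 3 - 2 * b * t ^ 4 / 4 + t ^ 5 / 5) / (4 * b\<^sup>2)) has_vector_derivative
        t\<^sup>2 * (b - t)\<^sup>2 / (4 * b\<^sup>2)) (at t within {0..b})" for t
      unfolding has_real_derivative_iff_has_vector_derivative[symmetric]
      using assms by (auto intro!: derivative_eq_intros simp: field_simps power2_eq_square power3_eq_cube power4_eq_xxxx)
  qed (use assms in simp)
  moreover have "(b\<^sup>2 * b ^ 3 / 3 - 2 * b * b ^ 4 / 4 + b ^ 5 / 5) / (4 * b\<^sup>2) -
       (b\<^sup>2 * 0 ^ 3 / 3 - 2 * b * 0 ^ 4 / 4 + 0 ^ 5 / 5) / (4 * b\<^sup>2) = b ^ 3 / 120"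
    using assms by (simp add: field_simps power2_eq_square eval_nat_numeral)
  ultimately have "((\<lambda>t. t\<^sup>2 * (b - t)\<^sup>2 / (4 * b\<^sup>2)) has_integral b ^ 3 / 120) {0..b}"
    by (simp only:)
  then have "((\<lambda>t. t\<^sup>2 * (b - t)\<^sup>2 / (4 * b\<^sup>2)) has_integral b ^ 3 / 120) {0<..<b}"
    unfolding has_integral_Icc_iff_Ioo .
  from nn_integral_has_integral_lebesgue'[OF _ this]
  show ?thesis by simp
qed

text \<open>Cauchy-Schwarz with the mean value, obtained by integrating |f - c|^2 \<ge> 0.\<close>

lemma has_integral_norm_sq_ge:
  fixes f :: "real \<Rightarrow> complex"
  assumes a: "a > 0" and cont: "continuous_on {0..a} f" and int: "(f has_integral of_real a * c) {0..a}"
  shows "(\<integral>\<^sup>+ s. ennreal ((cmod (f s))\<^sup>2) * indicator {0..<a} s \<partial>lborel) \<ge> ennreal (a * (cmod c)\<^sup>2)"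
proof -
  have "continuous_on {0..a} (\<lambda>s. (cmod (f s))\<^sup>2)" by (intro continuous_intros cont)
  then obtain I where I: "((\<lambda>s. (cmod (f s))\<^sup>2) has_integral I) {0..a}"
    using integrable_continuous_interval by blast
  have "((\<lambda>s. 2 * Re (cnj c * f s) - (cmod c)\<^sup>2) has_integral
      (2 * Re (cnj c * (of_real a * c)) - a * (cmod c)\<^sup>2)) {0..a}"
    using a has_integral_const_real[of "(cmod c)\<^sup>2" 0 a]
    by (intro has_integral_diff has_integral_mult_right
        has_integral_linear[OF has_integral_mult_right[OF int, of "cnj c"] bounded_linear_Re, unfolded o_def]) auto
  moreover have "2 * Re (cnj c * (of_real a * c)) - a * (cmod c)\<^sup>2 = a * (cmod c)\<^sup>2"
    unfolding cmod_power2 by (simp add: power2_eq_square algebra_simps)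
  moreover have "2 * Re (cnj c * f s) - (cmod c)\<^sup>2 \<le> (cmod (f s))\<^sup>2" for s
  proof -
    have "0 \<le> (cmod (f s - c))\<^sup>2" by simp
    then show ?thesis unfolding cmod_power2 by (simp add: power2_eq_square algebra_simps)
  qed
  ultimately have le: "a * (cmod c)\<^sup>2 \<le> I"
    using has_integral_le[OF _ I] by metis
  have "((\<lambda>s. (cmod (f s))\<^sup>2) has_integral I) {0<..<a}"
    using I unfolding has_integral_Icc_iff_Ioo .
  from nn_integral_has_integral_lebesgue'[OF _ this]
  have "ennreal I = (\<integral>\<^sup>+ s. ennreal ((cmod (f s))\<^sup>2) * indicator {0<..<a} s \<partial>lborel)" by simp
  also have "\<dots> \<le> (\<integral>\<^sup>+ s. ennreal ((cmod (f s))\<^sup>2) * indicator {0..<a} s \<partial>lborel)"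
    by (intro nn_integral_mono) (auto split: split_indicator)
  finally show ?thesis using ennreal_leI[OF le] by (rule order_trans[rotated])
qed

text \<open>The parametrisation \<open>c\<close> lets either coordinate play the role of the circle variable: circles are
  horizontal for the bound at large \<open>y\<close> and vertical for the one at small \<open>y\<close>.\<close>

lemma rectangle_mean_bound:
  fixes f :: "complex \<Rightarrow> complex" and c :: "real \<Rightarrow> real \<Rightarrow> complex"
  assumes c: "c = Complex \<or> c = (\<lambda>s t. Complex t s)" and a: "a > 0" and b: "b > 0"
    and F: "\<And>s t. c s t \<in> F \<longleftrightarrow> 0 \<le> s \<and> s < a \<and> 0 \<le> t \<and> t < b"
    and int: "set_integrable lborel F f"
    and cont: "\<And>t. 0 < t \<Longrightarrow> t < b \<Longrightarrow> continuous_on {0..a} (\<lambda>s. f (c s t))"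
    and mean: "\<And>t. 0 < t \<Longrightarrow> t < b \<Longrightarrow> ((\<lambda>s. f (c s t)) has_integral of_real a * k) {0..a}"
    and W: "\<And>s t. 0 \<le> s \<Longrightarrow> s < a \<Longrightarrow> 0 < t \<Longrightarrow> t < b \<Longrightarrow> t\<^sup>2 * (b - t)\<^sup>2 / (4 * b\<^sup>2) \<le> W (c s t)"
  shows "(LINT z:F|lborel. f z) = of_real (a * b) * k"
    and "(\<integral>\<^sup>+ z \<in> F. ennreal ((cmod (f z))\<^sup>2 * W z) \<partial>lborel) \<ge> ennreal (a * b ^ 3 / 120 * (cmod k)\<^sup>2)"
proof -
  define g where "g z = indicator F z *\<^sub>R f z" for z
  have g: "integrable lborel g" using int unfolding set_integrable_def g_def .
  then have gm: "g \<in> borel_measurable borel" by auto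
  \<comment> \<open>The transverse variable \<open>t\<close> comes first, so that the inner
    integrals of the iterated integral run over circles.\<close>
  define q where "q = (\<lambda>(t, s). c s t)"
  have q: "lborel = distr (lborel \<Otimes>\<^sub>M lborel) borel q"
    unfolding q_def by (rule lborel_complex) (use c in auto)
  have qm: "q \<in> (lborel \<Otimes>\<^sub>M lborel) \<rightarrow>\<^sub>M borel"
    using c by (auto simp: q_def Complex_eq case_prod_beta)
  have cm: "(\<lambda>s. c s t) \<in> borel_measurable borel" for t
    using c by (auto simp: Complex_eq)
  have g2: "integrable (lborel \<Otimes>\<^sub>M lborel) (\<lambda>p. g (q p))"
    using g integrable_distr_eq[OF qm gm] q by simp
  \<comment> \<open>The edge t = 0 belongs to the fundamental domain but passes through lattice
    points, so nothing is known about the mean there; it is a null set.\<close>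
  have slice: "(LINT s|lborel. g (q (t, s))) = indicator {0<..<b} t *\<^sub>R (of_real a * k)"
    if t: "t \<noteq> 0" for t
  proof (cases "0 < t \<and> t < b")
    case True
    have "set_integrable lborel {0..a} (\<lambda>s. f (c s t))"
      unfolding set_integrable_def using cont True by (intro borel_integrable_compact) auto
    from set_borel_integral_eq_integral(2)[OF this]
    have "(LINT s:{0..a}|lborel. f (c s t)) = of_real a * k"
      using integral_unique[OF mean] True by simp
    moreover have "(LINT s|lborel. g (c s t)) = (LINT s:{0..a}|lborel. f (c s t))"
      unfolding set_lebesgue_integral_def
    proof (rule integral_cong_AE)
      show "(\<lambda>s. g (c s t)) \<in> borel_measurable lborel" using measurable_compose[OF cm gm] by simp
      show "(\<lambda>s. indicator {0..a} s *\<^sub>R f (c s t)) \<in> borel_measurable lborel"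
        using cont True borel_measurable_continuous_on_indicator[of "{0..a}" "\<lambda>s. f (c s t)"] by simp
      have "AE s in lborel. s \<noteq> a" by (rule AE_lborel_singleton)
      then show "AE s in lborel. g (c s t) = indicator {0..a} s *\<^sub>R f (c s t)"
        by eventually_elim (use F True in \<open>auto simp: g_def split: split_indicator\<close>)
    qed
    ultimately show ?thesis using True by (simp add: q_def)
  next
    case False
    then have "g (c s t) = 0" for s using F t by (auto simp: g_def)
    then show ?thesis using False by (simp add: q_def)
  qed
  have "(LINT z:F|lborel. f z) = (LINT z|lborel. g z)" unfolding set_lebesgue_integral_def g_def ..
  also have "\<dots> = (LINT p|(lborel \<Otimes>\<^sub>M lborel). g (q p))"
    using integral_distr[OF qm gm] q by simp
  also have "\<dots> = (LINT t|lborel. LINT s|lborel. g (q (t, s)))"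
    by (rule lborel_pair.integral_fst'[OF g2, symmetric])
  also have "\<dots> = (LINT t|lborel. indicator {0<..<b} t *\<^sub>R (of_real a * k))"
  proof (rule integral_cong_AE)
    show "(\<lambda>t. LINT s|lborel. g (q (t, s))) \<in> borel_measurable lborel"
      using lborel_pair.integrable_fst'[OF g2] by (rule borel_measurable_integrable)
    have "AE t in lborel. t \<noteq> (0 :: real)" by (rule AE_lborel_singleton)
    then show "AE t in lborel. (LINT s|lborel. g (q (t, s))) = indicator {0<..<b} t *\<^sub>R (of_real a * k)"
      by eventually_elim (rule slice)
  qed simp
  also have "\<dots> = of_real (a * b) * k" using b by (simp add: scaleR_conv_of_real)
  finally show "(LINT z:F|lborel. f z) = of_real (a * b) * k" .
  define \<tau> where "\<tau> = (if c = Complex then Im else Re)"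
  have \<tau>: "\<tau> (c s t) = t" for s t using c by (auto simp: \<tau>_def)
  have \<tau>m: "\<tau> \<in> borel_measurable borel" by (simp add: \<tau>_def)
  define w where "w t = ennreal (t\<^sup>2 * (b - t)\<^sup>2 / (4 * b\<^sup>2)) * indicator {0<..<b} t" for t
  have wm: "w \<in> borel_measurable borel" unfolding w_def by measurable
  have Gm: "(\<lambda>z. w (\<tau> z) * ennreal ((cmod (g z))\<^sup>2)) \<in> borel_measurable borel"
    using measurable_compose[OF \<tau>m wm] gm by measurable
  have Gm2: "(\<lambda>p. w (\<tau> (q p)) * ennreal ((cmod (g (q p)))\<^sup>2)) \<in> borel_measurable (lborel \<Otimes>\<^sub>M lborel)"
    using measurable_compose[OF qm Gm] .
  have sm: "(\<lambda>s. ennreal ((cmod (g (c s t)))\<^sup>2)) \<in> borel_measurable lborel" for t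
    using measurable_compose[OF cm gm] by simp
  have inner: "w t * ennreal (a * (cmod k)\<^sup>2) \<le> (\<integral>\<^sup>+ s. w (\<tau> (q (t, s))) * ennreal ((cmod (g (q (t, s))))\<^sup>2) \<partial>lborel)" for t
  proof (cases "0 < t \<and> t < b")
    case True
    have "ennreal (a * (cmod k)\<^sup>2) \<le> (\<integral>\<^sup>+ s. ennreal ((cmod (f (c s t)))\<^sup>2) * indicator {0..<a} s \<partial>lborel)"
      using True by (intro has_integral_norm_sq_ge a cont mean) auto
    also have "\<dots> = (\<integral>\<^sup>+ s. ennreal ((cmod (g (c s t)))\<^sup>2) \<partial>lborel)"
      using True F by (intro nn_integral_cong) (auto simp: g_def split: split_indicator)
    finally have "w t * ennreal (a * (cmod k)\<^sup>2) \<le> w t * (\<integral>\<^sup>+ s. ennreal ((cmod (g (c s t)))\<^sup>2) \<partial>lborel)"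
      by (rule mult_left_mono) simp
    also have "\<dots> = (\<integral>\<^sup>+ s. w t * ennreal ((cmod (g (c s t)))\<^sup>2) \<partial>lborel)"
      by (rule nn_integral_cmult[OF sm, symmetric])
    finally show ?thesis by (simp add: q_def \<tau>)
  next
    case False
    then show ?thesis by (auto simp: w_def)
  qed
  have "ennreal (a * b ^ 3 / 120 * (cmod k)\<^sup>2) = (\<integral>\<^sup>+ t. w t \<partial>lborel) * ennreal (a * (cmod k)\<^sup>2)"
    unfolding w_def nn_integral_weight[OF b] using a b by (simp add: ennreal_mult[symmetric] mult_ac)
  also have "\<dots> = (\<integral>\<^sup>+ t. w t * ennreal (a * (cmod k)\<^sup>2) \<partial>lborel)"
    using wm by (intro nn_integral_multc[symmetric]) simp
  also have "\<dots> \<le> (\<integral>\<^sup>+ t. (\<integral>\<^sup>+ s. w (\<tau> (q (t, s))) * ennreal ((cmod (g (q (t, s))))\<^sup>2) \<partial>lborel) \<partial>lborel)"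
    by (intro nn_integral_mono inner)
  also have "\<dots> = (\<integral>\<^sup>+ p. w (\<tau> (q p)) * ennreal ((cmod (g (q p)))\<^sup>2) \<partial>(lborel \<Otimes>\<^sub>M lborel))"
    by (rule lborel.nn_integral_fst[OF Gm2])
  also have "\<dots> = (\<integral>\<^sup>+ z. w (\<tau> z) * ennreal ((cmod (g z))\<^sup>2) \<partial>lborel)"
    by (subst q) (simp add: nn_integral_distr[OF qm] Gm)
  also have "\<dots> \<le> (\<integral>\<^sup>+ z \<in> F. ennreal ((cmod (f z))\<^sup>2 * W z) \<partial>lborel)"
  proof (rule nn_integral_mono)
    fix z
    obtain s t where z: "z = c s t"
      using c by (metis complex.collapse)
    show "w (\<tau> z) * ennreal ((cmod (g z))\<^sup>2) \<le> ennreal ((cmod (f z))\<^sup>2 * W z) * indicator F z"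
    proof (cases "z \<in> F \<and> 0 < t")
      case True
      then have st: "0 \<le> s" "s < a" "0 < t" "t < b" using F z by auto
      have "w (\<tau> z) * ennreal ((cmod (g z))\<^sup>2) = ennreal ((cmod (f z))\<^sup>2 * (t\<^sup>2 * (b - t)\<^sup>2 / (4 * b\<^sup>2)))"
        using True st by (simp add: w_def \<tau> z g_def ennreal_mult[symmetric] mult.commute)
      also have "\<dots> \<le> ennreal ((cmod (f z))\<^sup>2 * W z)"
        unfolding z using W[OF st] by (intro ennreal_leI mult_left_mono) auto
      finally show ?thesis using True by simp
    next
      case False
      then show ?thesis by (auto simp: w_def \<tau> z g_def)
    qed
  qed
  finally show "(\<integral>\<^sup>+ z \<in> F. ennreal ((cmod (f z))\<^sup>2 * W z) \<partial>lborel) \<ge> ennreal (a * b ^ 3 / 120 * (cmod k)\<^sup>2)" .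
qed


section \<open>Bounds for the Weil-Petersson norm\<close>

lemma has_lap_if_C2:
  assumes S: "open S" "z \<in> S"
    and D: "\<And>w. w \<in> S \<Longrightarrow> (u has_derivative blinfun_apply (D w)) (at w)"
    and H: "(D has_derivative blinfun_apply (H :: complex \<Rightarrow>\<^sub>L (complex \<Rightarrow>\<^sub>L real))) (at z)"
  shows "\<exists>a b L. has_lap u a b L z"
proof -
  have line: "has_deriv2 (\<lambda>x. u (l x)) (blinfun_apply (D z) v) (blinfun_apply (blinfun_apply H v) v) x0"
    if l: "\<And>x. (l has_derivative (\<lambda>h. h *\<^sub>R v)) (at x)" and lz: "l x0 = z" for l v x0
  proof (rule has_deriv2I)
    have "continuous_on UNIV l" using l by (meson has_derivative_continuous continuous_at_imp_continuous_on)
    then show "open (l -` S)" using S(1) by (rule open_vimage[rotated])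
    show "x0 \<in> l -` S" using lz S(2) by simp
    show "((\<lambda>x. u (l x)) has_real_derivative blinfun_apply (D (l x)) v) (at x)" if "x \<in> l -` S" for x
    proof -
      have "((\<lambda>x. u (l x)) has_derivative (\<lambda>h. blinfun_apply (D (l x)) (h *\<^sub>R v))) (at x)"
        using has_derivative_compose[OF l D] that by simp
      then show ?thesis
        by (simp add: has_field_derivative_def blinfun.scaleR_right mult_commute_abs)
    qed
    have "((\<lambda>x. D (l x)) has_derivative (\<lambda>h. blinfun_apply H (h *\<^sub>R v))) (at x0)"
      using has_derivative_compose[OF l[of x0], of D "blinfun_apply H"] H lz by simp
    then have "((\<lambda>x. blinfun_apply (D (l x)) v) has_derivative
        (\<lambda>h. blinfun_apply (blinfun_apply H (h *\<^sub>R v)) v)) (at x0)"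
      by (rule bounded_linear.has_derivative[OF blinfun.bounded_linear_left])
    then show "((\<lambda>x. blinfun_apply (D (l x)) v) has_real_derivative
        blinfun_apply (blinfun_apply H v) v) (at x0)"
      by (simp add: has_field_derivative_def blinfun.scaleR_right blinfun.scaleR_left mult_commute_abs)
  qed (simp add: lz)
  have "has_deriv2 (\<lambda>x. u (Complex x (Im z))) (blinfun_apply (D z) 1)
      (blinfun_apply (blinfun_apply H 1) 1) (Re z)"
    by (rule line) (auto simp: Complex_eq scaleR_conv_of_real complex_eq[symmetric] intro!: derivative_eq_intros)
  moreover have "has_deriv2 (\<lambda>x. u (Complex (Re z) x)) (blinfun_apply (D z) \<i>)
      (blinfun_apply (blinfun_apply H \<i>) \<i>) (Im z)"
    by (rule line) (auto simp: Complex_eq scaleR_conv_of_real complex_eq[symmetric] intro!: derivative_eq_intros)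
  ultimately show ?thesis unfolding has_lap_def by blast
qed

lemma hyperbolic_torusI:
  assumes y: "y > 0" and chm: "complete_hyperbolic_metric (\<i> * of_real y) \<rho>"
  shows "hyperbolic_torus y \<rho>"
proof
  let ?L = "lattice (\<i> * of_real y)"
  note op = open_compl_lattice[OF y]
  show "y > 0" by fact
  show "\<rho> (z + w) = \<rho> z" if "z \<notin> ?L" "w \<in> ?L" for z w
    using chm that unfolding complete_hyperbolic_metric_def periodic_def by simp
  show pos: "\<rho> z > 0" if "z \<notin> ?L" for z
    using chm that unfolding complete_hyperbolic_metric_def by simp
  obtain D H where DH: "\<And>z. z \<in> - ?L \<Longrightarrow> (\<rho> has_derivative blinfun_apply (D z)) (at z)"
    "\<And>z. z \<in> - ?L \<Longrightarrow> (D has_derivative blinfun_apply (H z :: complex \<Rightarrow>\<^sub>L (complex \<Rightarrow>\<^sub>L real))) (at z)"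
    using chm unfolding complete_hyperbolic_metric_def C2_on_def by metis
  show "continuous_on (- ?L) \<rho>"
    using DH(1) by (meson has_derivative_continuous continuous_at_imp_continuous_on)
  show "\<exists>a b. has_lap (\<lambda>w. ln (\<rho> w)) a b (2 * \<rho> z) z" if z: "z \<notin> ?L" for z
  proof -
    have z': "z \<in> - ?L" using z by simp
    obtain a b L where "has_lap \<rho> a b L z" using has_lap_if_C2[OF op z' DH(1) DH(2)[OF z']] by blast
    from has_lap_ln[OF this pos[OF z]] obtain a b L where L: "has_lap (\<lambda>w. ln (\<rho> w)) a b L z" by blast
    have "gauss_curvature \<rho> z = -1" using chm z' unfolding complete_hyperbolic_metric_def by blast
    then have "L / (2 * \<rho> z) = 1" unfolding gauss_curvature_def has_lap_laplacian[OF L] by simp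
    then have "L = 2 * \<rho> z" using pos[OF z] by (simp add: field_simps)
    then show ?thesis using L by blast
  qed
qed

lemma rho_large_if_complete:
  assumes y: "y > 0" and chm: "complete_hyperbolic_metric (\<i> * of_real y) \<rho>"
  shows "\<exists>e>0. \<forall>z. z \<noteq> 0 \<longrightarrow> cmod z \<le> e \<longrightarrow> \<rho> z * cmod z \<ge> M"
proof -
  interpret hyperbolic_torus y \<rho> by (rule hyperbolic_torusI[OF assms])
  interpret periodic_density "\<i> * of_real y" \<rho>
    using chm open_compl_lattice[OF y] cont pos
    by unfold_locales (auto simp: complete_hyperbolic_metric_def)
  show ?thesis
  proof (rule rho_large_at_puncture)
    fix r K c :: real
    assume r: "0 < r" "r < min 1 y" and c: "0 < c" "c \<le> 1" and K: "0 < K"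
    show "\<exists>z. z \<noteq> 0 \<and> cmod z \<le> r \<and> \<rho> z > K * cmod z powr (c - 2)"
    proof (rule ccontr)
      assume "\<not> ?thesis"
      then have "\<rho> z \<le> K * cmod z powr (c - 2)" if "z \<noteq> 0" "cmod z \<le> r" for z
        using that by (meson not_le)
      moreover have "cball 0 r \<inter> \<Lambda> = {0}"
      proof -
        have "z = 0" if "z \<in> cball 0 r" "z \<in> \<Lambda>" for z
          using not_in_lattice_small[of z] that r(2) by fastforce
        then show ?thesis using lattice_0 r(1) by auto
      qed
      ultimately have "\<not> Metric_space.mcomplete (punctured_torus (\<i> * of_real y)) (torus_dist (\<i> * of_real y) \<rho>)"
        using not_mcomplete_if_finite_ray[OF r(1) _ c K] by blast
      then show False using chm unfolding complete_hyperbolic_metric_def by blast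
    qed
  qed
qed

lemma emeasure_fund_domain:
  assumes "y > 0"
  shows "fund_domain (\<i> * of_real y) \<in> sets borel" "emeasure lborel (fund_domain (\<i> * of_real y)) = ennreal y"
proof -
  show m: "fund_domain (\<i> * of_real y) \<in> sets borel"
    unfolding fund_domain_imag[OF assms] by measurable
  have 1: "fund_domain (\<i> * of_real y) \<subseteq> cbox 0 (Complex 1 y)" "box 0 (Complex 1 y) \<subseteq> fund_domain (\<i> * of_real y)"
    unfolding fund_domain_imag[OF assms] by (auto simp: mem_box Basis_complex_def)
  have "emeasure lborel (cbox 0 (Complex 1 y)) = ennreal y" "emeasure lborel (box 0 (Complex 1 y)) = ennreal y"
    using assms by (auto simp: emeasure_lborel_cbox_eq emeasure_lborel_box_eq Basis_complex_def)
  then show "emeasure lborel (fund_domain (\<i> * of_real y)) = ennreal y"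
    using emeasure_mono[OF 1(1), of lborel] emeasure_mono[OF 1(2), of lborel] m by simp
qed

context hyperbolic_torus begin

text \<open>t (b - t) / b is at most d = min (t, b - t), because the larger of the two factors is at
  most \<open>b\<close>; the Schwarz bound gives d^2 / 4 \<le> 1 / \<rho>.\<close>

lemma weight_le_inverse_rho:
  assumes b: "b > 0" "0 < t" "t < b"
    and avoid: "ball z (min t (b - t)) \<inter> \<Lambda> = {}"
  shows "t\<^sup>2 * (b - t)\<^sup>2 / (4 * b\<^sup>2) \<le> 1 / \<rho> z"
proof -
  define d where "d = min t (b - t)"
  have d: "d > 0" using b by (simp add: d_def)
  have "z \<in> ball z d" using d by simp
  then have "z \<notin> \<Lambda>" using avoid unfolding d_def by blast
  then have p: "\<rho> z > 0" by (rule pos)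
  have "t * (b - t) \<le> d * b"
    using b by (auto simp: d_def min_def intro!: mult_mono mult_right_mono)
  then have "t * (b - t) / b \<le> d" using b by (simp add: field_simps)
  then have "(t * (b - t) / b)\<^sup>2 \<le> d\<^sup>2" using b by (intro power_mono) auto
  moreover have "\<rho> z \<le> 4 / d\<^sup>2" using rho_le_ball[OF d] avoid by (simp add: d_def)
  then have "d\<^sup>2 / 4 \<le> 1 / \<rho> z" using d p by (simp add: field_simps)
  moreover have "t\<^sup>2 * (b - t)\<^sup>2 / (4 * b\<^sup>2) = (t * (b - t) / b)\<^sup>2 / 4"
    by (simp add: power_mult_distrib power_divide)
  ultimately show ?thesis by linarith
qed

text \<open>Let \<open>k\<close> be the common mean of \<phi> over the circles. The integral of
  \<phi> is y k and the Beltrami coefficient is - 1 / (2 y), so the pairing is - k / 2. The conorm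
  bound gives a b^3 |k|^2 / 120 \<le> 1, whence 30 = 120 / 4.\<close>

lemma pairing_le:
  assumes c: "c = Complex \<and> a = 1 \<and> b = y \<and> u = 1 \<or> c = (\<lambda>s t. Complex t s) \<and> a = y \<and> b = 1 \<and> u = \<i>"
    and \<phi>: "\<phi> \<in> quad_differentials (\<i> * of_real y)" "wp_conorm_sq \<rho> (\<i> * of_real y) \<phi> \<le> 1"
  shows "Re (LINT z : fund_domain (\<i> * of_real y) | lborel. tangent_beltrami (\<i> * of_real y) \<i> z * \<phi> z)
    \<le> sqrt (30 / (a * b ^ 3))"
proof -
  let ?F = "fund_domain (\<i> * of_real y)"
  have ab: "a > 0" "b > 0" "a * b = y" "u \<noteq> 0" and c': "c = Complex \<or> c = (\<lambda>s t. Complex t s)"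
    using c y by auto
  have cu: "c s t = c 0 t + of_real s * u" for s t using c by (auto simp: complex_eq_iff)
  have F: "c s t \<in> ?F \<longleftrightarrow> 0 \<le> s \<and> s < a \<and> 0 \<le> t \<and> t < b" for s t
    using c by (auto simp: fund_domain_imag[OF y])
  \<comment> \<open>The open strip between two neighbouring rows (or columns) of lattice points,
    where \<phi> is holomorphic.\<close>
  define S where "S = {c s t | s t. 0 < t \<and> t < b}"
  have S_eq: "S = (if c = Complex then {z. 0 < Im z} \<inter> {z. Im z < b} else {z. 0 < Re z} \<inter> {z. Re z < b})"
  proof (cases "c = Complex")
    case True
    then show ?thesis unfolding S_def by (auto simp: complex_eq_iff intro!: exI[of _ "Re _"])
  next
    case False
    then have "c = (\<lambda>s t. Complex t s)" using c' by blast
    then show ?thesis using False unfolding S_def by (auto simp: complex_eq_iff intro!: exI[of _ "Im _"])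
  qed
  have Sprops: "convex S" "open S"
    unfolding S_eq
    by (auto intro!: convex_Int open_Int convex_halfspace_Im_gt convex_halfspace_Im_lt convex_halfspace_Re_gt
        convex_halfspace_Re_lt open_Collect_less continuous_intros)
  have S\<Lambda>: "z \<notin> \<Lambda>" if "z \<in> S" for z
  proof
    assume "z \<in> \<Lambda>"
    then have i: "Re z \<in> \<int>" "Im z / y \<in> \<int>" by (auto simp: lattice_imag_iff[OF y])
    from \<open>z \<in> S\<close> obtain s t where "z = c s t" "0 < t" "t < b" unfolding S_def by blast
    then have "t / b \<in> \<int>" "0 < t / b" "t / b < 1" using i c by auto
    then show False by (auto elim!: Ints_cases)
  qed
  have mS: "c s t \<in> S" if "0 < t" "t < b" for s t using that unfolding S_def by blast
  have hol: "\<phi> holomorphic_on - \<Lambda>" and per\<phi>: "periodic (\<i> * of_real y) \<phi>"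
    and int: "set_integrable lborel ?F \<phi>" using \<phi>(1) unfolding quad_differentials_def by auto
  have holS: "\<phi> holomorphic_on S" using hol by (rule holomorphic_on_subset) (use S\<Lambda> in auto)
  have au: "of_real a * u \<in> \<Lambda>" using c y by (auto simp: lattice_imag_iff[OF y])
  have line: "z + of_real s * u \<in> S" if "z \<in> S" for z and s :: real
  proof -
    from that obtain s' t where st: "z = c s' t" "0 < t" "t < b" unfolding S_def by blast
    have "z + of_real s * u = c (s' + s) t" unfolding st(1) using cu[of s' t] cu[of "s' + s" t] by (simp add: algebra_simps)
    then show ?thesis using mS st by simp
  qed
  have "c 0 (b / 2) \<in> S" using ab by (intro mS) auto
  then obtain e where e: "\<And>z. z \<in> S \<Longrightarrow> ((\<lambda>s. \<phi> (z + of_real s * u)) has_integral e) {0..a}"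
    using mean_of_periodic_holomorphic[OF Sprops _ holS ab(4,1) line] per\<phi> au S\<Lambda>
    unfolding periodic_def by (metis ComplI empty_iff)
  define k where "k = e / of_real a"
  have mean: "((\<lambda>s. \<phi> (c s t)) has_integral of_real a * k) {0..a}" if "0 < t" "t < b" for t
    using e[OF mS[OF that, of 0]] ab(1) by (simp add: k_def cu[symmetric])
  have contS: "continuous_on S \<phi>" using holS by (rule holomorphic_on_imp_continuous_on)
  have cont: "continuous_on {0..a} (\<lambda>s. \<phi> (c s t))" if "0 < t" "t < b" for t
  proof (rule continuous_on_compose2[OF contS])
    have "(\<lambda>s. c s t) = (\<lambda>s. c 0 t + of_real s * u)" by (intro ext cu)
    then show "continuous_on {0..a} (\<lambda>s. c s t)" by (simp only:) (intro continuous_intros)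
  qed (use mS that in auto)
  have W: "t\<^sup>2 * (b - t)\<^sup>2 / (4 * b\<^sup>2) \<le> 1 / \<rho> (c s t)" if t: "0 < t" "t < b" for s t
  proof (rule weight_le_inverse_rho[OF ab(2) t])
    show "ball (c s t) (min t (b - t)) \<inter> \<Lambda> = {}"
    proof (rule ccontr)
      assume "ball (c s t) (min t (b - t)) \<inter> \<Lambda> \<noteq> {}"
      then obtain w where "w \<in> ball (c s t) (min t (b - t))" "w \<in> \<Lambda>" by blast
      then have w: "cmod (c s t - w) < min t (b - t)" "w \<in> \<Lambda>" by (simp_all add: dist_norm)
      obtain s' t' where w': "w = c s' t'" using c' by (metis complex.collapse)
      have "t' / b \<in> \<int>" using w(2) c unfolding w' by (auto simp: lattice_imag_iff[OF y])
      then obtain n :: int where n: "t' = of_int n * b" using ab(2) by (auto elim!: Ints_cases simp: field_simps)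
      have "\<bar>t - t'\<bar> \<le> cmod (c s t - w)"
        using c' abs_Re_le_cmod[of "c s t - w"] abs_Im_le_cmod[of "c s t - w"] unfolding w' by auto
      then have lt: "\<bar>t - t'\<bar> < t" "\<bar>t - t'\<bar> < b - t" using w(1) by auto
      then have "0 < of_int n * b" "of_int n * b < 1 * b" unfolding n by auto
      then have "0 < n" "n < 1" using ab(2) by (auto simp: zero_less_mult_iff mult_less_cancel_right)
      then show False by simp
    qed
  qed
  note rb = rectangle_mean_bound[OF c' ab(1,2) F int cont mean, of "\<lambda>z. 1 / \<rho> z"]
  have I1: "(LINT z:?F|lborel. \<phi> z) = of_real y * k" using rb(1) W ab(3) by simp
  have "ennreal (a * b ^ 3 / 120 * (cmod k)\<^sup>2) \<le> wp_conorm_sq \<rho> (\<i> * of_real y) \<phi>"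
    using rb(2) W unfolding wp_conorm_sq_def by simp
  also have "\<dots> \<le> ennreal 1" using \<phi>(2) by simp
  finally have "a * b ^ 3 / 120 * (cmod k)\<^sup>2 \<le> 1" by (simp add: ennreal_le_iff)
  then have "(cmod k / 2)\<^sup>2 \<le> 30 / (a * b ^ 3)"
    using ab(1,2) by (simp add: power_divide field_simps)
  then have "cmod k / 2 \<le> sqrt (30 / (a * b ^ 3))" by (rule real_le_rsqrt)
  moreover have "(LINT z:?F|lborel. tangent_beltrami (\<i> * of_real y) \<i> z * \<phi> z) = - k / 2"
    unfolding tangent_beltrami_imag[OF y] set_integral_mult_right I1 using y by simp
  moreover have "Re (- k / 2) \<le> cmod k / 2"
    using complex_Re_le_cmod[of "- k / 2"] by (simp add: norm_divide)
  ultimately show ?thesis by simp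
qed

lemma wp_norm_le:
  shows "wp_norm \<rho> (\<i> * of_real y) \<i> \<le> ennreal (sqrt 30 * y powr (- (3 / 2)))"
    and "wp_norm \<rho> (\<i> * of_real y) \<i> \<le> ennreal (sqrt 30 * y powr (- (1 / 2)))"
proof -
  have e: "sqrt (30 / (1 * y ^ 3)) = sqrt 30 * y powr (- (3 / 2))" "sqrt (30 / (y * 1 ^ 3)) = sqrt 30 * y powr (- (1 / 2))"
  proof -
    have "sqrt (y ^ 3) = (y powr 3) powr (1 / 2)" using y by (simp add: powr_half_sqrt powr_numeral)
    also have "\<dots> = y powr (3 / 2)" by (simp add: powr_powr)
    finally have s: "sqrt (y ^ 3) = y powr (3 / 2)" .
    show "sqrt (30 / (1 * y ^ 3)) = sqrt 30 * y powr (- (3 / 2))"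
      unfolding mult_1_left real_sqrt_divide s powr_minus by (simp only: divide_inverse)
    have h: "y powr (- (1 / 2)) = inverse (sqrt y)" unfolding powr_minus using y by (simp add: powr_half_sqrt)
    show "sqrt (30 / (y * 1 ^ 3)) = sqrt 30 * y powr (- (1 / 2))"
      unfolding power_one mult_1_right real_sqrt_divide h by (simp only: divide_inverse)
  qed
  show "wp_norm \<rho> (\<i> * of_real y) \<i> \<le> ennreal (sqrt 30 * y powr (- (3 / 2)))"
    unfolding wp_norm_def e(1)[symmetric]
    by (intro SUP_least ennreal_leI pairing_le[of Complex _ _ 1]) auto
  show "wp_norm \<rho> (\<i> * of_real y) \<i> \<le> ennreal (sqrt 30 * y powr (- (1 / 2)))"
    unfolding wp_norm_def e(2)[symmetric]
    by (intro SUP_least ennreal_leI pairing_le[of "\<lambda>s t. Complex t s" _ _ \<i>]) auto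
qed

text \<open>A constant differential of modulus \<open>c\<close> has squared conorm at most c^2 y /
  \<kappa>, which the choice of \<open>c\<close> makes 1.\<close>

lemma wp_norm_ge:
  assumes \<kappa>: "\<kappa> > 0" "\<And>z. z \<notin> \<Lambda> \<Longrightarrow> \<rho> z \<ge> \<kappa>"
  shows "wp_norm \<rho> (\<i> * of_real y) \<i> \<ge> ennreal (sqrt (\<kappa> / y) / 2)"
proof -
  let ?F = "fund_domain (\<i> * of_real y)"
  define c where "c = sqrt (\<kappa> / y)"
  \<comment> \<open>The sign matches that of the Beltrami coefficient, so the pairing is c / 2; a
    negative value would be truncated to 0 by \<open>ennreal\<close>.\<close>
  define \<phi> where "\<phi> = (\<lambda>z :: complex. - complex_of_real c)"
  have F: "?F \<in> sets lborel" "emeasure lborel ?F = ennreal y" using emeasure_fund_domain[OF y] by auto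
  have int: "set_integrable lborel ?F (\<lambda>z. k)" for k :: complex
    unfolding set_integrable_def using F by (intro integrable_scaleR_left integrable_real_indicator) auto
  have "\<phi> \<in> quad_differentials (\<i> * of_real y)"
    unfolding quad_differentials_def \<phi>_def periodic_def using int by auto
  moreover have "wp_conorm_sq \<rho> (\<i> * of_real y) \<phi> \<le> 1"
  proof -
    have "AE z in lborel. z \<notin> \<Lambda>"
      by (rule AE_not_in) (intro countable_imp_null_set_lborel countable_lattice)
    then have "AE z in lborel. ennreal ((cmod (\<phi> z))\<^sup>2 / \<rho> z) * indicator ?F z \<le> ennreal (c\<^sup>2 / \<kappa>) * indicator ?F z"
    proof eventually_elim
      case (elim z)
      have "(cmod (\<phi> z))\<^sup>2 / \<rho> z \<le> c\<^sup>2 / \<kappa>"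
        unfolding \<phi>_def using \<kappa>(1) \<kappa>(2)[OF elim] by (auto intro!: divide_left_mono)
      then show ?case by (intro mult_right_mono ennreal_leI) auto
    qed
    then have "wp_conorm_sq \<rho> (\<i> * of_real y) \<phi> \<le> (\<integral>\<^sup>+ z. ennreal (c\<^sup>2 / \<kappa>) * indicator ?F z \<partial>lborel)"
      unfolding wp_conorm_sq_def by (rule nn_integral_mono_AE)
    also have "\<dots> = ennreal (c\<^sup>2 / \<kappa>) * ennreal y" using F by (simp add: nn_integral_cmult_indicator)
    also have "\<dots> = ennreal (c\<^sup>2 / \<kappa> * y)"
      using \<kappa>(1) y by (intro ennreal_mult[symmetric]) auto
    also have "c\<^sup>2 / \<kappa> * y = 1" using \<kappa>(1) y by (simp add: c_def)
    finally show ?thesis by simp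
  qed
  ultimately have "ennreal (Re (LINT z : ?F | lborel. tangent_beltrami (\<i> * of_real y) \<i> z * \<phi> z)) \<le> wp_norm \<rho> (\<i> * of_real y) \<i>"
    unfolding wp_norm_def by (intro SUP_upper) auto
  moreover have "(LINT z : ?F | lborel. tangent_beltrami (\<i> * of_real y) \<i> z * \<phi> z) = of_real (c / 2)"
  proof -
    have "measure lborel ?F = y" using F y by (simp add: measure_def)
    then have "(LINT z : ?F | lborel. k) = of_real y * k" for k :: complex
      using F by (simp add: set_lebesgue_integral_def scaleR_conv_of_real)
    then show ?thesis unfolding tangent_beltrami_imag[OF y] \<phi>_def using y by simp
  qed
  ultimately show ?thesis by (simp add: c_def)
qed

end

text \<open>The minimum of the two powers. It respects the symmetry of the axis: profile (1 / y) /
  y^2 = profile y, so the two halves contribute 2 each to the integral.\<close>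

definition profile :: "real \<Rightarrow> real" where
  "profile y = (if y < 1 then y powr (- (1 / 2)) else y powr (- (3 / 2)))"

lemma nn_integral_profile:
  assumes "C \<ge> 0"
  shows "(\<integral>\<^sup>+ y \<in> {0<..}. ennreal (C * profile y) \<partial>lborel) = ennreal (4 * C)"
proof -
  have "((\<lambda>y. y powr (- (1 / 2))) has_integral (1 powr (- (1 / 2) + 1) / (- (1 / 2) + 1) :: real)) {0..1}"
    by (rule has_integral_powr_from_0) auto
  then have "((\<lambda>y. y powr (- (1 / 2))) has_integral (2 :: real)) {0<..<1}"
    unfolding has_integral_Icc_iff_Ioo by simp
  from nn_integral_has_integral_lebesgue'[OF _ this]
  have 1: "(\<integral>\<^sup>+ y. ennreal (y powr (- (1 / 2))) * indicator {0<..<1} y \<partial>lborel) = ennreal 2" by simp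
  have "((\<lambda>y. y powr (- (3 / 2))) has_integral (- (1 powr (- (3 / 2) + 1)) / (- (3 / 2) + 1) :: real)) {1..}"
    by (rule has_integral_powr_to_inf) auto
  then have "((\<lambda>y. y powr (- (3 / 2))) has_integral (2 :: real)) {1..}" by simp
  from nn_integral_has_integral_lebesgue'[OF _ this]
  have 2: "(\<integral>\<^sup>+ y. ennreal (y powr (- (3 / 2))) * indicator {1..} y \<partial>lborel) = ennreal 2" by simp
  have "(\<integral>\<^sup>+ y \<in> {0<..}. ennreal (C * profile y) \<partial>lborel) =
      (\<integral>\<^sup>+ y. ennreal C * (ennreal (y powr (- (1 / 2))) * indicator {0<..<1} y +
        ennreal (y powr (- (3 / 2))) * indicator {1..} y) \<partial>lborel)"
    using assms by (intro nn_integral_cong) (auto simp: profile_def ennreal_mult split: split_indicator)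
  also have "\<dots> = ennreal C * (ennreal 2 + ennreal 2)"
    by (subst nn_integral_cmult, measurable, subst nn_integral_add, measurable) (simp add: 1 2)
  also have "ennreal 2 + ennreal 2 = ennreal 4" by (simp flip: ennreal_plus)
  also have "ennreal C * ennreal 4 = ennreal (4 * C)"
    unfolding mult.commute[of 4 C] using assms by (intro ennreal_mult[symmetric]) auto
  finally show ?thesis .
qed

lemma wp_length_imaginary_axis:
  "wp_length \<rho> (\<lambda>y. \<i> * of_real y) {0<..} =
    (\<integral>\<^sup>+ y \<in> {0<..}. wp_norm (\<rho> (\<i> * of_real y)) (\<i> * of_real y) \<i> \<partial>lborel)"
proof -
  have "vector_derivative (\<lambda>y. \<i> * complex_of_real y) (at t) = \<i>" for t
    by (rule vector_derivative_at) (auto intro!: derivative_eq_intros)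
  then show ?thesis unfolding wp_length_def by simp
qed


section \<open>The volume of the octahedron\<close>

lemma Basis_vec3_eq:
  fixes e :: "real ^ 3"
  assumes "e \<in> Basis"
  obtains f g :: "real ^ 3" where "Basis = {e, f, g}" "e \<noteq> f" "e \<noteq> g" "f \<noteq> g"
proof -
  have "card (Basis :: (real ^ 3) set) = 3" by simp
  then have "card (Basis - {e}) = 2" using assms by simp
  then obtain f g where fg: "Basis - {e} = {f, g}" "f \<noteq> g" by (meson card_2_iff)
  then have "Basis = {e, f, g}" "e \<noteq> f" "e \<noteq> g" using assms by auto
  then show ?thesis using that fg(2) by blast
qed

text \<open>Tonelli's theorem with the basis vectors in arbitrary order, so that each of the three
  axes can play the distinguished role.\<close>

lemma nn_integral_vec3:
  fixes e f g :: "real ^ 3" and F :: "real \<Rightarrow> real \<Rightarrow> real \<Rightarrow> ennreal"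
  assumes B: "Basis = {e, f, g}" and ne: "e \<noteq> f" "e \<noteq> g" "f \<noteq> g"
    and F: "(\<lambda>(a, b, c). F a b c) \<in> borel_measurable (borel \<Otimes>\<^sub>M borel \<Otimes>\<^sub>M borel)"
  shows "(\<integral>\<^sup>+ x. F (x \<bullet> e) (x \<bullet> f) (x \<bullet> g) \<partial>lborel) =
    (\<integral>\<^sup>+ a. \<integral>\<^sup>+ b. \<integral>\<^sup>+ c. F a b c \<partial>lborel \<partial>lborel \<partial>lborel)"
proof -
  interpret P: product_sigma_finite "\<lambda>b :: real ^ 3. lborel :: real measure" by unfold_locales
  have Fm: "(\<lambda>x. F (p x) (q x) (r x)) \<in> borel_measurable M"
    if "p \<in> borel_measurable M" "q \<in> borel_measurable M" "r \<in> borel_measurable M"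
    for p q r :: "'z \<Rightarrow> real" and M
    using measurable_compose[OF measurable_Pair[OF that(1) measurable_Pair[OF that(2,3)]] F] by simp
  have efg: "e \<in> Basis" "f \<in> Basis" "g \<in> Basis" using B by auto
  have coord: "(\<Sum>b\<in>Basis. \<phi> b *\<^sub>R b) \<bullet> v = \<phi> v" if "v \<in> Basis" for \<phi> and v :: "real ^ 3"
    using that by (simp add: inner_sum_left inner_Basis if_distrib cong: if_cong)
  have "(\<integral>\<^sup>+ x. F (x \<bullet> e) (x \<bullet> f) (x \<bullet> g) \<partial>lborel) =
      (\<integral>\<^sup>+ \<phi>. F (\<phi> e) (\<phi> f) (\<phi> g) \<partial>(\<Pi>\<^sub>M b\<in>(Basis :: (real ^ 3) set). lborel))"
    unfolding lborel_eq[where 'a = "real ^ 3"]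
    by (subst nn_integral_distr) (auto intro!: Fm simp: coord efg)
  also have "\<dots> = (\<integral>\<^sup>+ a. (\<integral>\<^sup>+ \<phi>. F a (\<phi> f) (\<phi> g) \<partial>(\<Pi>\<^sub>M b\<in>{f, g}. lborel)) \<partial>lborel)"
    unfolding B using ne efg B
    by (subst P.product_nn_integral_insert_rev) (auto intro!: Fm)
  also have "\<dots> = (\<integral>\<^sup>+ a. \<integral>\<^sup>+ b. (\<integral>\<^sup>+ \<phi>. F a b (\<phi> g) \<partial>(\<Pi>\<^sub>M b\<in>{g}. lborel)) \<partial>lborel \<partial>lborel)"
    using ne
    by (intro nn_integral_cong, subst P.product_nn_integral_insert_rev) (auto intro!: Fm)
  also have "\<dots> = (\<integral>\<^sup>+ a. \<integral>\<^sup>+ b. \<integral>\<^sup>+ c. F a b c \<partial>lborel \<partial>lborel \<partial>lborel)"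
    by (intro nn_integral_cong P.product_nn_integral_singleton) (auto intro!: Fm)
  finally show ?thesis .
qed

lemma nn_integral_abs:
  fixes f :: "real \<Rightarrow> ennreal"
  assumes f: "f \<in> borel_measurable borel"
  shows "(\<integral>\<^sup>+ x. f \<bar>x\<bar> \<partial>lborel) = 2 * (\<integral>\<^sup>+ x. f x * indicator {0<..} x \<partial>lborel)"
proof -
  have m: "(\<lambda>x. f x * indicator {0<..} x) \<in> borel_measurable borel" using f by measurable
  have "AE x in lborel. x \<noteq> (0 :: real)" by (rule AE_lborel_singleton)
  then have "AE x in lborel. f \<bar>x\<bar> = f x * indicator {0<..} x + f (- x) * indicator {0<..} (- x)"
    by eventually_elim (auto split: split_indicator)
  then have "(\<integral>\<^sup>+ x. f \<bar>x\<bar> \<partial>lborel) =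
      (\<integral>\<^sup>+ x. f x * indicator {0<..} x + f (- x) * indicator {0<..} (- x) \<partial>lborel)"
    by (rule nn_integral_cong_AE)
  also have "\<dots> = (\<integral>\<^sup>+ x. f x * indicator {0<..} x \<partial>lborel) + (\<integral>\<^sup>+ x. f (- x) * indicator {0<..} (- x) \<partial>lborel)"
    using m measurable_compose[OF _ m, of uminus borel] by (intro nn_integral_add) auto
  also have "(\<integral>\<^sup>+ x. f (- x) * indicator {0<..} (- x) \<partial>lborel) = (\<integral>\<^sup>+ x. f x * indicator {0<..} x \<partial>lborel)"
    using nn_integral_real_affine[OF m, of "-1" 0] by simp
  finally show ?thesis by (simp add: mult_2)
qed

lemma area_l1_ball:
  fixes m :: real
  assumes "m \<ge> 0"
  shows "(\<integral>\<^sup>+ b. \<integral>\<^sup>+ c. indicator {..m} (\<bar>b\<bar> + \<bar>c\<bar>) \<partial>lborel \<partial>lborel) = ennreal (2 * m\<^sup>2)"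
proof -
  have inner: "(\<integral>\<^sup>+ c. indicator {..m} (\<bar>b\<bar> + \<bar>c\<bar>) \<partial>lborel) = ennreal (2 * (m - \<bar>b\<bar>))" for b
  proof -
    have "(\<integral>\<^sup>+ c. indicator {..m} (\<bar>b\<bar> + \<bar>c\<bar>) \<partial>lborel) = (\<integral>\<^sup>+ c. indicator {\<bar>b\<bar> - m..m - \<bar>b\<bar>} c \<partial>lborel)"
      by (intro nn_integral_cong) (auto split: split_indicator)
    \<comment> \<open>For |b| > m the slice is empty, in agreement with \<open>ennreal\<close>
      truncating the negative value to 0.\<close>
    also have "\<dots> = ennreal (2 * (m - \<bar>b\<bar>))"
      by (cases "\<bar>b\<bar> \<le> m") (auto simp: ennreal_neg)
    finally show ?thesis .
  qed
  have "((\<lambda>b. 2 * (m - b)) has_integral (2 * m * m - m\<^sup>2) - (2 * m * 0 - 0\<^sup>2)) {0..m}"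
    by (rule fundamental_theorem_of_calculus[of 0 m "\<lambda>b. 2 * m * b - b\<^sup>2"])
       (use assms in \<open>auto intro!: derivative_eq_intros simp flip: has_real_derivative_iff_has_vector_derivative\<close>)
  then have "((\<lambda>b. 2 * (m - b)) has_integral m\<^sup>2) {0<..<m}"
    unfolding has_integral_Icc_iff_Ioo by (simp add: power2_eq_square)
  from nn_integral_has_integral_lebesgue'[OF _ this]
  have half: "(\<integral>\<^sup>+ b. ennreal (2 * (m - b)) * indicator {0<..<m} b \<partial>lborel) = ennreal (m\<^sup>2)" by simp
  have "(\<integral>\<^sup>+ b. \<integral>\<^sup>+ c. indicator {..m} (\<bar>b\<bar> + \<bar>c\<bar>) \<partial>lborel \<partial>lborel) = (\<integral>\<^sup>+ b. ennreal (2 * (m - \<bar>b\<bar>)) \<partial>lborel)"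
    unfolding inner ..
  also have "\<dots> = 2 * (\<integral>\<^sup>+ b. ennreal (2 * (m - b)) * indicator {0<..} b \<partial>lborel)"
    by (rule nn_integral_abs) measurable
  also have "(\<integral>\<^sup>+ b. ennreal (2 * (m - b)) * indicator {0<..} b \<partial>lborel) = ennreal (m\<^sup>2)"
    unfolding half[symmetric] by (intro nn_integral_cong) (auto split: split_indicator simp: ennreal_neg)
  also have "2 * ennreal (m\<^sup>2) = ennreal (2 * m\<^sup>2)" by (simp add: ennreal_mult)
  finally show ?thesis .
qed

lemma nn_integral_corner_profile:
  "(\<integral>\<^sup>+ a. ennreal (2 / (max 1 (2 * a))\<^sup>2) * indicator {1 / 3..1} a * indicator {0<..} a \<partial>lborel) = ennreal (5 / 6)"
proof -
  have "((\<lambda>a. 1 / (2 * a\<^sup>2)) has_integral (- 1 / (2 * 1)) - (- 1 / (2 * (1 / 2 :: real)))) {1 / 2..1}"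
    by (rule fundamental_theorem_of_calculus[of "1 / 2" 1 "\<lambda>a. - 1 / (2 * a)"])
       (auto intro!: derivative_eq_intros simp: power2_eq_square simp flip: has_real_derivative_iff_has_vector_derivative)
  then have "((\<lambda>a. 1 / (2 * a\<^sup>2)) has_integral (1 / 2 :: real)) {1 / 2..1}" by simp
  then have "((\<lambda>a. 2 / (max 1 (2 * a))\<^sup>2) has_integral (1 / 2 :: real)) {1 / 2..1}"
    by (rule has_integral_eq[rotated]) (auto simp: max_def power2_eq_square)
  moreover have "((\<lambda>a. 2 :: real) has_integral (1 / 2 - 1 / 3) *\<^sub>R 2) {1 / 3..1 / 2 :: real}"
    using has_integral_const_real[of "2 :: real" "1 / 3" "1 / 2"] by simp
  then have "((\<lambda>a. 2 / (max 1 (2 * a))\<^sup>2) has_integral ((1 / 2 - 1 / 3) *\<^sub>R 2 :: real)) {1 / 3..1 / 2}"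
    by (rule has_integral_eq[rotated]) (simp add: max_absorb1)
  ultimately have "((\<lambda>a. 2 / (max 1 (2 * a))\<^sup>2) has_integral ((1 / 2 - 1 / 3) *\<^sub>R 2 + 1 / 2 :: real)) {1 / 3..1}"
    by (intro has_integral_combine[of "1 / 3" "1 / 2" 1]) auto
  then have "((\<lambda>a. 2 / (max 1 (2 * a))\<^sup>2) has_integral (5 / 6 :: real)) {1 / 3..1}" by simp
  from nn_integral_has_integral_lebesgue'[OF _ this]
  have "(\<integral>\<^sup>+ a. ennreal (2 / (max 1 (2 * a))\<^sup>2) * indicator {1 / 3..1} a \<partial>lborel) = ennreal (5 / 6)" by simp
  moreover have "indicator {1 / 3..1} a * indicator {0<..} a = (indicator {1 / 3..1} a :: ennreal)" for a :: real
    by (auto split: split_indicator)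
  ultimately show ?thesis by (simp add: mult.assoc)
qed

text \<open>For fixed \<open>a\<close> this is constant on an l1 disc of area 2 (1 - |a|)^2. That
  area cancels the factor (1 - |a|)^2 of the denominator, so the singularity at the ideal vertices
  integrates away.\<close>

definition corner_majorant :: "real \<Rightarrow> real \<Rightarrow> real \<Rightarrow> ennreal" where
  "corner_majorant a b c = ennreal (1 / ((1 - \<bar>a\<bar>) * max 1 (2 * \<bar>a\<bar>))\<^sup>2) * indicator {1 / 3..1} \<bar>a\<bar> *
     indicator {..1 - \<bar>a\<bar>} (\<bar>b\<bar> + \<bar>c\<bar>)"

lemma nn_integral_corner_majorant:
  "(\<integral>\<^sup>+ a. \<integral>\<^sup>+ b. \<integral>\<^sup>+ c. corner_majorant a b c \<partial>lborel \<partial>lborel \<partial>lborel) \<le> ennreal (5 / 3)"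
proof -
  have "(\<integral>\<^sup>+ a. \<integral>\<^sup>+ b. \<integral>\<^sup>+ c. corner_majorant a b c \<partial>lborel \<partial>lborel \<partial>lborel) \<le>
      (\<integral>\<^sup>+ a. ennreal (2 / (max 1 (2 * \<bar>a\<bar>))\<^sup>2) * indicator {1 / 3..1} \<bar>a\<bar> \<partial>lborel)"
  proof (rule nn_integral_mono)
    fix a :: real
    define K where "K = ennreal (1 / ((1 - \<bar>a\<bar>) * max 1 (2 * \<bar>a\<bar>))\<^sup>2) * indicator {1 / 3..1} \<bar>a\<bar>"
    have "(\<integral>\<^sup>+ b. \<integral>\<^sup>+ c. corner_majorant a b c \<partial>lborel \<partial>lborel) =
        K * (\<integral>\<^sup>+ b. \<integral>\<^sup>+ c. indicator {..1 - \<bar>a\<bar>} (\<bar>b\<bar> + \<bar>c\<bar>) \<partial>lborel \<partial>lborel)"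
      unfolding corner_majorant_def K_def[symmetric]
      by (subst nn_integral_cmult, measurable, subst nn_integral_cmult, measurable)
    also have "\<dots> \<le> ennreal (2 / (max 1 (2 * \<bar>a\<bar>))\<^sup>2) * indicator {1 / 3..1} \<bar>a\<bar>"
    proof (cases "\<bar>a\<bar> \<le> 1")
      case True
      have "1 / ((1 - \<bar>a\<bar>) * max 1 (2 * \<bar>a\<bar>))\<^sup>2 * (2 * (1 - \<bar>a\<bar>)\<^sup>2) \<le> 2 / (max 1 (2 * \<bar>a\<bar>))\<^sup>2"
        by (cases "\<bar>a\<bar> = 1") (auto simp: power_mult_distrib)
      then show ?thesis
        using True unfolding K_def
        by (subst area_l1_ball) (auto simp: ennreal_mult[symmetric] split: split_indicator intro!: ennreal_leI)
    next
      case False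
      then show ?thesis by (simp add: K_def)
    qed
    finally show "(\<integral>\<^sup>+ b. \<integral>\<^sup>+ c. corner_majorant a b c \<partial>lborel \<partial>lborel) \<le>
        ennreal (2 / (max 1 (2 * \<bar>a\<bar>))\<^sup>2) * indicator {1 / 3..1} \<bar>a\<bar>" .
  qed
  also have "\<dots> = 2 * ennreal (5 / 6)"
    unfolding nn_integral_corner_profile[symmetric]
    by (rule nn_integral_abs) measurable
  also have "\<dots> = ennreal (2 * (5 / 6))" by (subst ennreal_mult) auto
  finally show ?thesis by simp
qed

lemma regular_ideal_octahedron_subset:
  "regular_ideal_octahedron \<subseteq> {x. (\<Sum>b\<in>Basis. \<bar>x \<bullet> b\<bar>) \<le> 1}"
  unfolding regular_ideal_octahedron_def
proof (rule hull_minimal)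
  have 1: "(\<Sum>b\<in>Basis. \<bar>e \<bullet> b\<bar>) = 1" if "e \<in> Basis" for e :: "real ^ 3"
    using that by (simp add: inner_Basis if_distrib cong: if_cong)
  then show "Basis \<union> uminus ` Basis \<subseteq> {x :: real ^ 3. (\<Sum>b\<in>Basis. \<bar>x \<bullet> b\<bar>) \<le> 1}" by auto
  show "convex {x :: real ^ 3. (\<Sum>b\<in>Basis. \<bar>x \<bullet> b\<bar>) \<le> 1}"
  proof (rule convexI)
    fix x z :: "real ^ 3" and u v :: real
    assume x: "x \<in> {x. (\<Sum>b\<in>Basis. \<bar>x \<bullet> b\<bar>) \<le> 1}" and z: "z \<in> {x. (\<Sum>b\<in>Basis. \<bar>x \<bullet> b\<bar>) \<le> 1}"
      and uv: "0 \<le> u" "0 \<le> v" "u + v = 1"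
    have "(\<Sum>b\<in>Basis. \<bar>(u *\<^sub>R x + v *\<^sub>R z) \<bullet> b\<bar>) \<le> (\<Sum>b\<in>Basis. u * \<bar>x \<bullet> b\<bar> + v * \<bar>z \<bullet> b\<bar>)"
    proof (rule sum_mono)
      fix b :: "real ^ 3"
      have "\<bar>(u *\<^sub>R x + v *\<^sub>R z) \<bullet> b\<bar> \<le> \<bar>u * (x \<bullet> b)\<bar> + \<bar>v * (z \<bullet> b)\<bar>"
        unfolding inner_add_left inner_scaleR_left by (rule abs_triangle_ineq)
      then show "\<bar>(u *\<^sub>R x + v *\<^sub>R z) \<bullet> b\<bar> \<le> u * \<bar>x \<bullet> b\<bar> + v * \<bar>z \<bullet> b\<bar>"
        using uv by (simp add: abs_mult)
    qed
    also have "\<dots> = u * (\<Sum>b\<in>Basis. \<bar>x \<bullet> b\<bar>) + v * (\<Sum>b\<in>Basis. \<bar>z \<bullet> b\<bar>)"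
      by (simp add: sum.distrib sum_distrib_left)
    also have "\<dots> \<le> u * 1 + v * 1" using x z uv by (intro add_mono mult_left_mono) auto
    finally show "u *\<^sub>R x + v *\<^sub>R z \<in> {x. (\<Sum>b\<in>Basis. \<bar>x \<bullet> b\<bar>) \<le> 1}" using uv by simp
  qed
qed

lemma norm_sq_Basis_sum: "(norm x)\<^sup>2 = (\<Sum>b\<in>Basis. (x \<bullet> b)\<^sup>2)"
  unfolding power2_norm_eq_inner by (subst euclidean_inner) (simp add: power2_eq_square)

text \<open>If \<open>e\<close> carries the largest coordinate \<open>s\<close>, then \<open>\<bar>x\<bar>\<^sup>2 \<le> s\<close> and
  \<open>\<bar>x\<bar>\<^sup>2 \<le> s\<^sup>2 + (1 - s)\<^sup>2\<close>, whence the two factors of the majorant.\<close>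

lemma klein_density_le_corner:
  fixes x :: "real ^ 3"
  assumes l1: "(\<Sum>b\<in>Basis. \<bar>x \<bullet> b\<bar>) \<le> 1" and B: "Basis = {e, f, g}" "e \<noteq> f" "e \<noteq> g" "f \<noteq> g"
    and mx: "\<And>b. b \<in> Basis \<Longrightarrow> \<bar>x \<bullet> b\<bar> \<le> \<bar>x \<bullet> e\<bar>" and ge: "\<bar>x \<bullet> e\<bar> \<ge> 1 / 3"
  shows "ennreal (1 / (1 - (norm x)\<^sup>2)\<^sup>2) \<le> corner_majorant (x \<bullet> e) (x \<bullet> f) (x \<bullet> g)"
proof -
  define s p q where "s = \<bar>x \<bullet> e\<bar>" and "p = \<bar>x \<bullet> f\<bar>" and "q = \<bar>x \<bullet> g\<bar>"
  have spq: "s + (p + q) \<le> 1" using l1 B(2-4) unfolding B(1) by (simp add: s_def p_def q_def)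
  have nn: "0 \<le> s" "0 \<le> p" "0 \<le> q" "p \<le> s" "q \<le> s" "1 / 3 \<le> s"
    using mx[of f] mx[of g] ge B by (auto simp: s_def p_def q_def)
  have N: "(norm x)\<^sup>2 = s * s + (p * p + q * q)"
    unfolding norm_sq_Basis_sum B(1) using B(2-4) by (simp add: s_def p_def q_def power2_eq_square abs_mult_self_eq)
  have "p * p \<le> s * p" "q * q \<le> s * q" using nn by (auto intro: mult_right_mono)
  then have "(norm x)\<^sup>2 \<le> s * (s + (p + q))" unfolding N by (simp add: algebra_simps)
  also have "\<dots> \<le> s * 1" using spq nn by (intro mult_left_mono) auto
  finally have 1: "1 - s \<le> 1 - (norm x)\<^sup>2" by simp
  have "p * p + q * q \<le> (p + q) * (p + q)" using nn by (simp add: algebra_simps)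
  also have "\<dots> \<le> (1 - s) * (1 - s)" using spq nn by (intro mult_mono) auto
  finally have 2: "(1 - s) * (2 * s) \<le> 1 - (norm x)\<^sup>2" unfolding N by (simp add: algebra_simps)
  have s1: "s \<le> 1" using spq nn by linarith
  have maj: "corner_majorant (x \<bullet> e) (x \<bullet> f) (x \<bullet> g) = ennreal (1 / ((1 - s) * max 1 (2 * s))\<^sup>2)"
    using spq nn s1 by (simp add: corner_majorant_def s_def[symmetric] p_def[symmetric] q_def[symmetric])
  show ?thesis
  proof (cases "s = 1")
    case True
    then have "p = 0" "q = 0" using spq nn by auto
    \<comment> \<open>At the ideal vertex both densities are 1 / 0, that is, 0.\<close>
    then show ?thesis unfolding maj N using True by simp
  next
    case False
    have "(1 - s) * max 1 (2 * s) \<le> 1 - (norm x)\<^sup>2" using 1 2 by (simp add: max_def)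
    moreover have A: "0 < (1 - s) * max 1 (2 * s)" using False s1 by simp
    ultimately have "((1 - s) * max 1 (2 * s))\<^sup>2 \<le> (1 - (norm x)\<^sup>2)\<^sup>2" "0 < 1 - (norm x)\<^sup>2"
      by (auto intro!: power_mono simp del: mult_pos_pos)
    with A show ?thesis unfolding maj
      by (intro ennreal_leI divide_left_mono) (simp_all only: zero_le_one mult_pos_pos zero_less_power)
  qed
qed

text \<open>In the cube of half-side 1 / 3 one has |x|^2 \<le> 1 / 3, so the density is at most 9 /
  4 and the cube contributes at most (9 / 4) (8 / 27) = 2 / 3. Outside it, each of the three
  majorants covers a pair of opposite vertices and contributes at most 5 / 3.\<close>

lemma V8_le: "V8 \<le> ennreal (17 / 3)"
proof -
  define C :: "(real ^ 3) set" where "C = cbox (- (1 / 3) *\<^sub>R One) ((1 / 3) *\<^sub>R One)"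
  obtain e :: "real ^ 3" where e0: "e \<in> Basis" using nonempty_Basis by blast
  obtain f g where B: "Basis = {e, f, g}" "e \<noteq> f" "e \<noteq> g" "f \<noteq> g" using Basis_vec3_eq[OF e0] .
  define M where "M x = ennreal (9 / 4) * indicator C x + (corner_majorant (x \<bullet> e) (x \<bullet> f) (x \<bullet> g) +
      (corner_majorant (x \<bullet> f) (x \<bullet> e) (x \<bullet> g) + corner_majorant (x \<bullet> g) (x \<bullet> e) (x \<bullet> f)))" for x :: "real ^ 3"
  have pw: "ennreal (1 / (1 - (norm x)\<^sup>2)\<^sup>2) * indicator regular_ideal_octahedron x \<le> M x" for x :: "real ^ 3"
  proof (cases "x \<in> regular_ideal_octahedron")
    case True
    then have l1: "(\<Sum>b\<in>Basis. \<bar>x \<bullet> b\<bar>) \<le> 1" using regular_ideal_octahedron_subset by blast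
    have "ennreal (1 / (1 - (norm x)\<^sup>2)\<^sup>2) \<le> M x"
    proof (cases "\<forall>b\<in>Basis. \<bar>x \<bullet> b\<bar> \<le> 1 / 3")
      case True
      then have "x \<in> C" by (auto simp: C_def mem_box abs_le_iff)
      have "(norm x)\<^sup>2 \<le> (\<Sum>b\<in>(Basis :: (real ^ 3) set). 1 / 9)"
        unfolding norm_sq_Basis_sum
      proof (rule sum_mono)
        fix b :: "real ^ 3" assume "b \<in> Basis"
        then have "\<bar>x \<bullet> b\<bar>\<^sup>2 \<le> (1 / 3)\<^sup>2" using True by (intro power_mono) auto
        then show "(x \<bullet> b)\<^sup>2 \<le> 1 / 9" by (simp add: power2_eq_square)
      qed
      then have "2 / 3 \<le> 1 - (norm x)\<^sup>2" by simp
      then have "(2 / 3)\<^sup>2 \<le> (1 - (norm x)\<^sup>2)\<^sup>2" by (intro power_mono) auto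
      then have "1 / (1 - (norm x)\<^sup>2)\<^sup>2 \<le> 1 / (2 / 3)\<^sup>2"
        using \<open>2 / 3 \<le> 1 - (norm x)\<^sup>2\<close> by (intro divide_left_mono) auto
      then have "ennreal (1 / (1 - (norm x)\<^sup>2)\<^sup>2) \<le> ennreal (9 / 4)"
        by (intro ennreal_leI) (simp add: power2_eq_square)
      also have "\<dots> \<le> M x" using \<open>x \<in> C\<close> by (simp add: M_def)
      finally show ?thesis .
    next
      case False
      obtain v where v: "v \<in> Basis" "\<And>b. b \<in> Basis \<Longrightarrow> \<bar>x \<bullet> b\<bar> \<le> \<bar>x \<bullet> v\<bar>"
      proof -
        define h where "h b = \<bar>x \<bullet> b\<bar>" for b
        have "Max (h ` Basis) \<in> h ` Basis"
          using finite_Basis nonempty_Basis by (intro Max_in) auto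
        then obtain v where v: "v \<in> Basis" "Max (h ` Basis) = h v" by (rule imageE)
        have "h b \<le> h v" if "b \<in> Basis" for b
          unfolding v(2)[symmetric] using that by (intro Max_ge) auto
        then show thesis using that[of v] v(1) unfolding h_def by blast
      qed
      then have ge: "\<bar>x \<bullet> v\<bar> \<ge> 1 / 3" using False by force
      consider "v = e" | "v = f" | "v = g" using v(1) B by auto
      then show ?thesis
      proof cases
        case 1
        have "ennreal (1 / (1 - (norm x)\<^sup>2)\<^sup>2) \<le> corner_majorant (x \<bullet> e) (x \<bullet> f) (x \<bullet> g)"
          by (rule klein_density_le_corner[OF l1]) (use B v(2) ge 1 in auto)
        then show ?thesis unfolding M_def by (rule order_trans) (simp add: add_increasing add_increasing2)
      next
        case 2
        have "ennreal (1 / (1 - (norm x)\<^sup>2)\<^sup>2) \<le> corner_majorant (x \<bullet> f) (x \<bullet> e) (x \<bullet> g)"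
          by (rule klein_density_le_corner[OF l1]) (use B v(2) ge 2 in auto)
        then show ?thesis unfolding M_def by (rule order_trans) (simp add: add_increasing add_increasing2)
      next
        case 3
        have "ennreal (1 / (1 - (norm x)\<^sup>2)\<^sup>2) \<le> corner_majorant (x \<bullet> g) (x \<bullet> e) (x \<bullet> f)"
          by (rule klein_density_le_corner[OF l1]) (use B v(2) ge 3 in auto)
        then show ?thesis unfolding M_def by (rule order_trans) (simp add: add_increasing add_increasing2)
      qed
    qed
    then show ?thesis using True by simp
  next
    case False
    then show ?thesis by simp
  qed
  have cm: "(\<lambda>(a, b, c). corner_majorant a b c) \<in> borel_measurable (borel \<Otimes>\<^sub>M borel \<Otimes>\<^sub>M borel)"
    unfolding corner_majorant_def indicator_def atMost_iff atLeastAtMost_iff by measurable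
  have cmx: "(\<lambda>x :: real ^ 3. corner_majorant (x \<bullet> u) (x \<bullet> v) (x \<bullet> w)) \<in> borel_measurable lborel" for u v w
    unfolding corner_majorant_def indicator_def atMost_iff atLeastAtMost_iff by measurable
  have part: "(\<integral>\<^sup>+ x. corner_majorant (x \<bullet> u) (x \<bullet> v) (x \<bullet> w) \<partial>lborel) \<le> ennreal (5 / 3)"
    if "Basis = {u, v, w}" "u \<noteq> v" "u \<noteq> w" "v \<noteq> w" for u v w :: "real ^ 3"
    unfolding nn_integral_vec3[OF that cm] by (rule nn_integral_corner_majorant)
  have "V8 \<le> (\<integral>\<^sup>+ x. M x \<partial>lborel)"
    unfolding V8_def klein_volume_def by (intro nn_integral_mono pw)
  also have "\<dots> = ennreal (9 / 4) * emeasure lborel C + ((\<integral>\<^sup>+ x. corner_majorant (x \<bullet> e) (x \<bullet> f) (x \<bullet> g) \<partial>lborel) +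
      ((\<integral>\<^sup>+ x. corner_majorant (x \<bullet> f) (x \<bullet> e) (x \<bullet> g) \<partial>lborel) + (\<integral>\<^sup>+ x. corner_majorant (x \<bullet> g) (x \<bullet> e) (x \<bullet> f) \<partial>lborel)))"
    unfolding M_def using cmx
    by (simp add: nn_integral_add nn_integral_cmult_indicator C_def)
  also have "emeasure lborel C = ennreal (8 / 27)"
    unfolding C_def emeasure_lborel_cbox_eq by (simp add: power_divide)
  also have "ennreal (9 / 4) * ennreal (8 / 27) + ((\<integral>\<^sup>+ x. corner_majorant (x \<bullet> e) (x \<bullet> f) (x \<bullet> g) \<partial>lborel) +
      ((\<integral>\<^sup>+ x. corner_majorant (x \<bullet> f) (x \<bullet> e) (x \<bullet> g) \<partial>lborel) + (\<integral>\<^sup>+ x. corner_majorant (x \<bullet> g) (x \<bullet> e) (x \<bullet> f) \<partial>lborel)))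
      \<le> ennreal (9 / 4) * ennreal (8 / 27) + (ennreal (5 / 3) + (ennreal (5 / 3) + ennreal (5 / 3)))"
    using B by (intro add_mono order_refl part) auto
  also have "\<dots> = ennreal (17 / 3)"
  proof -
    have "ennreal (17 / 3) = ennreal (9 / 4 * (8 / 27) + (5 / 3 + (5 / 3 + 5 / 3)))" by simp
    also have "\<dots> = ennreal (9 / 4 * (8 / 27)) + ennreal (5 / 3 + (5 / 3 + 5 / 3))"
      by (rule ennreal_plus) simp_all
    also have "ennreal (5 / 3 + (5 / 3 + 5 / 3)) = ennreal (5 / 3) + ennreal (5 / 3 + 5 / 3)"
      by (rule ennreal_plus) simp_all
    also have "ennreal (5 / 3 + 5 / 3) = ennreal (5 / 3) + ennreal (5 / 3)"
      by (rule ennreal_plus) simp_all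
    also have "ennreal (9 / 4 * (8 / 27)) = ennreal (9 / 4) * ennreal (8 / 27)"
      by (rule ennreal_mult) simp_all
    finally show ?thesis by (rule sym)
  qed
  finally show ?thesis .
qed


section \<open>The length of the imaginary axis\<close>

text \<open>The final numerical comparison (17 / 9)^2 (2 / pi) \<le> 4 \<kappa>, multiplied by 2 pi.
  The function t exp (- t) increases up to t = 1, so pi / 4 may be replaced by 3 / 4.\<close>

lemma lower_constant_ge: "(1156 :: real) / 81 \<le> 14 / 11 * exp (- pi / 4) * (8 * pi)"
proof -
  have x: "3 / 4 \<le> pi / 4" using pi_gt3 by simp
  have mono: "3 / 4 * exp (- (3 / 4)) \<le> pi / 4 * exp (- (pi / 4))"
  proof (rule DERIV_nonneg_imp_nondecreasing[OF x])
    fix t :: real assume t: "3 / 4 \<le> t" "t \<le> pi / 4"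
    have "((\<lambda>t. t * exp (- t)) has_real_derivative (1 - t) * exp (- t)) (at t)"
      by (auto intro!: derivative_eq_intros simp: algebra_simps)
    moreover have "(1 - t) * exp (- t) \<ge> 0" using t pi_less_4 by simp
    ultimately show "\<exists>d. ((\<lambda>t. t * exp (- t)) has_real_derivative d) (at t) \<and> 0 \<le> d" by blast
  qed
  have "exp (3 / 4 :: real) ^ 4 \<le> (107 / 50) ^ 4"
  proof -
    \<comment> \<open>The fourth power reduces the estimate to e < 2.72; the bound 107 / 50 leaves
      very little room in the last step.\<close>
    have "exp (3 / 4 :: real) ^ 4 = exp 1 ^ 3" by (simp flip: exp_of_nat_mult)
    also have "\<dots> \<le> (272 / 100) ^ 3" using e_less_272 by (intro power_mono) auto
    also have "\<dots> \<le> (107 / 50 :: real) ^ 4" by (simp add: power_divide)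
    finally show ?thesis .
  qed
  then have "exp (3 / 4 :: real) \<le> 107 / 50" by (rule power_le_imp_le_base[of _ 3, simplified]) simp
  then have "50 / 107 \<le> exp (- (3 / 4 :: real))" by (simp add: exp_minus field_simps)
  then have "3 / 4 * (50 / 107) \<le> pi / 4 * exp (- (pi / 4))" using mono by linarith
  then show ?thesis by simp
qed

text \<open>Turns the upper bound 4 sqrt 30 into the stated one; it amounts to 16 \<le>
  pi^3.\<close>

lemma two_le_pi_powr: "2 \<le> pi powr (3 / 4)"
proof -
  have "(2 :: real) = (16 powr (1 / 4))"
  proof -
    have "(16 :: real) = 2 powr 4" by simp
    then show ?thesis by (simp only: powr_powr) simp
  qed
  also have "\<dots> \<le> (pi powr 3) powr (1 / 4)"
  proof (rule powr_mono2)
    have "(3 :: real) ^ 3 \<le> pi ^ 3" using pi_gt3 by (intro power_mono) auto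
    then show "(16 :: real) \<le> pi powr 3" by (simp add: powr_numeral)
  qed auto
  also have "\<dots> = pi powr (3 / 4)" unfolding powr_powr by simp
  finally show ?thesis .
qed

lemma mult_indicator_mono:
  fixes f g :: "'a \<Rightarrow> ennreal"
  assumes "x \<in> A \<Longrightarrow> f x \<le> g x"
  shows "f x * indicator A x \<le> g x * indicator A x"
  using assms by (cases "x \<in> A") auto

theorem theorem1p7:
  fixes \<rho> :: "complex \<Rightarrow> complex \<Rightarrow> real"
  assumes "\<And>\<tau>. Im \<tau> > 0 \<Longrightarrow> complete_hyperbolic_metric \<tau> (\<rho> \<tau>)"
  shows "ennreal (1 / 3 * sqrt (2 / pi)) * V8 \<le> wp_length \<rho> (\<lambda>y. \<i> * of_real y) {0<..} \<and>
         wp_length \<rho> (\<lambda>y. \<i> * of_real y) {0<..} \<le> ennreal (2 * sqrt 30 * pi powr (3 / 4))"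
proof
  define \<kappa> where "\<kappa> = 14 / 11 * exp (- pi / 4)"
  have \<kappa>: "\<kappa> > 0" by (simp add: \<kappa>_def)
  have chm: "complete_hyperbolic_metric (\<i> * of_real y) (\<rho> (\<i> * of_real y))" if "y > 0" for y
    using assms[of "\<i> * of_real y"] that by simp
  have gen: "a / b / 2 = a / 2 * inverse b" for a b :: real by (simp add: inverse_eq_divide)
  have lower: "ennreal (sqrt \<kappa> / 2 * profile y) \<le> wp_norm (\<rho> (\<i> * of_real y)) (\<i> * of_real y) \<i>" if y: "y > 0" for y
  proof -
    interpret hyperbolic_torus y "\<rho> (\<i> * of_real y)" by (rule hyperbolic_torusI[OF y chm[OF y]])
    note large = rho_large_if_complete[OF y chm[OF y]]
    show ?thesis
    proof (cases "y < 1")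
      case True
      have "ennreal (sqrt (\<kappa> / y) / 2) \<le> wp_norm (\<rho> (\<i> * of_real y)) (\<i> * of_real y) \<i>"
        using rho_ge_wide[OF _ large] True unfolding \<kappa>_def[symmetric] by (intro wp_norm_ge[OF \<kappa>]) auto
      moreover have "sqrt (\<kappa> / y) / 2 = sqrt \<kappa> / 2 * profile y"
      proof -
        have "profile y = inverse (sqrt y)"
          unfolding profile_def powr_minus using True y by (simp add: powr_half_sqrt)
        then show ?thesis unfolding real_sqrt_divide gen by simp
      qed
      ultimately show ?thesis by simp
    next
      case False
      have "ennreal (sqrt (\<kappa> / y\<^sup>2 / y) / 2) \<le> wp_norm (\<rho> (\<i> * of_real y)) (\<i> * of_real y) \<i>"
        using rho_ge_tall[OF _ large] False \<kappa> y unfolding \<kappa>_def[symmetric] by (intro wp_norm_ge) auto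
      moreover have "sqrt (\<kappa> / y\<^sup>2 / y) / 2 = sqrt \<kappa> / 2 * profile y"
      proof -
        have "sqrt (y\<^sup>2 * y) = (y powr 3) powr (1 / 2)"
          using y by (simp add: powr_half_sqrt powr_numeral power2_eq_square power3_eq_cube)
        also have "\<dots> = y powr (3 / 2)" by (simp add: powr_powr)
        finally have s: "sqrt (y\<^sup>2 * y) = y powr (3 / 2)" .
        have "profile y = inverse (y powr (3 / 2))"
          unfolding profile_def powr_minus using False by simp
        then show ?thesis unfolding divide_divide_eq_left[of \<kappa>] real_sqrt_divide s gen by simp
      qed
      ultimately show ?thesis by simp
    qed
  qed
  have upper: "wp_norm (\<rho> (\<i> * of_real y)) (\<i> * of_real y) \<i> \<le> ennreal (sqrt 30 * profile y)" if y: "y > 0" for y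
  proof -
    interpret hyperbolic_torus y "\<rho> (\<i> * of_real y)" by (rule hyperbolic_torusI[OF y chm[OF y]])
    show ?thesis using wp_norm_le unfolding profile_def by simp
  qed
  have "ennreal (1 / 3 * sqrt (2 / pi)) * V8 \<le> ennreal (1 / 3 * sqrt (2 / pi)) * ennreal (17 / 3)"
    by (intro mult_left_mono V8_le) simp
  also have "\<dots> = ennreal (17 / 9 * sqrt (2 / pi))" by (simp add: ennreal_mult[symmetric])
  \<comment> \<open>The right side is the integral of the minorant: 4 for the profile times its
    coefficient sqrt \<kappa> / 2.\<close>
  also have "\<dots> \<le> ennreal (4 * (sqrt \<kappa> / 2))"
  proof (rule ennreal_leI)
    have "(17 / 9)\<^sup>2 * (2 / pi) \<le> 4 * \<kappa>"
      using lower_constant_ge unfolding \<kappa>_def[symmetric] by (simp add: power2_eq_square field_simps)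
    then have "sqrt ((17 / 9)\<^sup>2 * (2 / pi)) \<le> sqrt (4 * \<kappa>)" by (rule real_sqrt_le_mono)
    moreover have "sqrt ((17 / 9)\<^sup>2 * (2 / pi)) = 17 / 9 * sqrt (2 / pi)" unfolding real_sqrt_mult by simp
    moreover have "sqrt (4 * \<kappa>) = 2 * sqrt \<kappa>" unfolding real_sqrt_mult by simp
    ultimately show "17 / 9 * sqrt (2 / pi) \<le> 4 * (sqrt \<kappa> / 2)" by simp
  qed
  also have "\<dots> = (\<integral>\<^sup>+ y \<in> {0<..}. ennreal (sqrt \<kappa> / 2 * profile y) \<partial>lborel)"
    by (rule nn_integral_profile[symmetric]) (use \<kappa> in simp)
  also have "\<dots> \<le> wp_length \<rho> (\<lambda>y. \<i> * of_real y) {0<..}"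
    unfolding wp_length_imaginary_axis
    by (intro nn_integral_mono mult_indicator_mono) (rule lower, simp)
  finally show "ennreal (1 / 3 * sqrt (2 / pi)) * V8 \<le> wp_length \<rho> (\<lambda>y. \<i> * of_real y) {0<..}" .
  have "wp_length \<rho> (\<lambda>y. \<i> * of_real y) {0<..} \<le> (\<integral>\<^sup>+ y \<in> {0<..}. ennreal (sqrt 30 * profile y) \<partial>lborel)"
    unfolding wp_length_imaginary_axis
    by (intro nn_integral_mono mult_indicator_mono) (rule upper, simp)
  also have "\<dots> = ennreal (4 * sqrt 30)" by (rule nn_integral_profile) simp
  also have "\<dots> \<le> ennreal (2 * sqrt 30 * pi powr (3 / 4))"
    using two_le_pi_powr by (intro ennreal_leI) simp
  finally show "wp_length \<rho> (\<lambda>y. \<i> * of_real y) {0<..} \<le> ennreal (2 * sqrt 30 * pi powr (3 / 4))" .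
qed

end
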